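(* Let $q\in GL_n(R)$ be any matrix with $q^t=\pm q$, let $\tau$ be the involution of $GL_n$ defined by $x^{\tau}=q^{-1}(x^t)^{-1}q$, and let $\mathcal H_q(x)=x^tqx$ and $\mathcal B_q(x,y)=x^tqy$ be the normalized quadratic map and the normalized bilinear map attached to $q$. Then: 1) There is a unique lift of Frobenius $\phi_{GL_n}$ on $\widehat{GL_n}$ that is $\mathcal H_q$-horizontal and $\mathcal B_q$-symmetric with respect to $\phi_{GL_n,0}$. 2) If, in addition, $n=2r$ and $q^t=q\in GL_r^c$, then $GL_r^c$ is $\phi_{GL_{2r}}$-horizontal (where $\phi_{GL_{2r}}$ is the lift in 1)); in particular the lift of Frobenius $\phi_{GL_r^c}$ on $\widehat{GL_r^c}$ induced by $\phi_{GL_{2r}}$ is $\mathcal H_q$-horizontal and $\mathcal B_q$-symmetric with respect to $\phi_{GL_r^c,0}$ (and is the unique lift of Frobenius on $\widehat{GL_r^c}$ with these properties). 3) Assume the situation in 2) with $q=1$ the identity matrix, and consider the lift of Frobenius $\phi_{GL_r^c}$ on $\widehat{GL_r^c}$ defined in 2). Then there is no lift of Frobenius $\phi_{GL_r}$ on $\widehat{GL_r}$ such that $\phi_{GL_r^c}$ is $c$-horizontal with respect to $\phi_{GL_r}$.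
   Context: Fix an odd prime $p$. $R$ is the unique complete discrete valuation ring with maximal ideal $pR$ and residue field $k=R/pR$ an algebraic closure of $\mathbb F_p$; $\phi:R\to R$ is the unique ring homomorphism lifting the $p$-power Frobenius of $k$ (it is bijective). A hat denotes $p$-adic completion of rings and schemes. For a smooth $R$-scheme $X$ of finite type, a lift of Frobenius on $\widehat X$ is a morphism of formal schemes $\phi_X:\widehat X\to\widehat X$ whose reduction mod $p$ is the $p$-power Frobenius and which is compatible with $\phi$ on $R$ (so it is $\phi$-semilinear, not a morphism over $R$); for $X$ affine it is the same as a ring endomorphism of $\mathcal O(X)^{\wedge}$ extending $\phi$ and reducing to $f\mapsto f^p$ mod $p$. A smooth closed subscheme $Z\subset X$ is $\phi_X$-horizontal if $\phi_X$ maps the ideal of $\widehat Z$ into itself; then it induces a lift of Frobenius $\phi_Z$ on $\widehat Z$. $GL_n=\mathrm{Spec}\,R[x,\det(x)^{-1}]$, $x=(x_{ij})$ a matrix of indeterminates; $x^{(p)}:=(x_{ij}^p)$; $x^t$ is the transpose; $\phi_{GL_n,0}$ is the lift of Frobenius on $\widehat{GL_n}$ with $\phi_{GL_n,0}(x)=x^{(p)}$. Let $G$ be a smooth affine group scheme over $R$ with lifts of Frobenius $\phi_G,\phi_{G,0}$ on $\widehat G$, and let $\mathcal H_q:G\to G$, $\mathcal B_q:G\times G\to G$ be morphisms over $R$ as in the claim ($G=GL_n$, or $G=GL_r^c$ below with the restricted maps). $\phi_G$ is $\mathcal H_q$-horizontal with respect to $\phi_{G,0}$ if $\mathcal H_q\circ\phi_G=\phi_{G,0}\circ\mathcal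 H_q$ as maps $\widehat G\to\widehat G$; $\phi_G$ is $\mathcal B_q$-symmetric with respect to $\phi_{G,0}$ if $\mathcal B_q\circ(\phi_{G,0}\times\phi_G)=\mathcal B_q\circ(\phi_G\times\phi_{G,0})$ as maps $\widehat G\to\widehat G$, where $f_1\times f_2:\widehat G\to\widehat G\times\widehat G$ is the map with components $f_1,f_2$. $GL_r^c$ is the centralizer in $GL_{2r}$ of $q_0=\begin{pmatrix}0&1_r\\-1_r&0\end{pmatrix}$; it is a smooth closed subgroup scheme of $GL_{2r}$ whose points are the invertible matrices $z=\begin{pmatrix}a&b\\-b&a\end{pmatrix}$; it is stable under transposition and is $\phi_{GL_{2r},0}$-horizontal, and $\phi_{GL_r^c,0}$ denotes the lift of Frobenius on $\widehat{GL_r^c}$ induced by $\phi_{GL_{2r},0}$. Fix a square root $\sqrt{-1}\in R$ of $-1$ and let $c:GL_r^c\to GL_r$ be the homomorphism $c(z)=a+\sqrt{-1}\,b$. A lift of Frobenius $\phi_{GL_r^c}$ on $\widehat{GL_r^c}$ is $c$-horizontal with respect to a lift of Frobenius $\phi_{GL_r}$ on $\widehat{GL_r}$ if $c\circ\phi_{GL_r^c}=\phi_{GL_r}\circ c$. *)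

theory Defs
  imports
    "HOL-Analysis.Determinants"
    "HOL-Library.Poly_Mapping"
    "HOL-Library.FuncSet"
    "HOL-Algebra.QuotRing"
    "HOL-Algebra.Algebraic_Closure"
    "HOL-Algebra.Algebraic_Closure_Type"
begin

section \<open>The p-adic completion of a ring\<close>

definition padic_ideal :: "nat \<Rightarrow> ('a, 'm) ring_scheme \<Rightarrow> nat \<Rightarrow> 'a set" where
  "padic_ideal p A k = PIdl\<^bsub>A\<^esub> ([(p ^ k)] \<cdot>\<^bsub>A\<^esub> \<one>\<^bsub>A\<^esub>)"

text \<open>
  The inverse limit of the rings \<open>A / p^k A\<close>. The transition map from \<open>A / p^(k+1) A\<close> to
  \<open>A / p^k A\<close> sends a coset to the unique coset containing it, so the compatible sequences
  are the decreasing sequences of cosets.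
\<close>

definition padic_completion :: "nat \<Rightarrow> ('a, 'm) ring_scheme \<Rightarrow> (nat \<Rightarrow> 'a set) ring" where
  "padic_completion p A =
    \<lparr>carrier = {s. \<forall>k. s k \<in> carrier (A Quot padic_ideal p A k) \<and> s (Suc k) \<subseteq> s k},
     mult = (\<lambda>s t k. s k \<otimes>\<^bsub>A Quot padic_ideal p A k\<^esub> t k),
     one = (\<lambda>k. \<one>\<^bsub>A Quot padic_ideal p A k\<^esub>),
     zero = (\<lambda>k. \<zero>\<^bsub>A Quot padic_ideal p A k\<^esub>),
     add = (\<lambda>s t k. s k \<oplus>\<^bsub>A Quot padic_ideal p A k\<^esub> t k)\<rparr>"

definition to_completion :: "nat \<Rightarrow> ('a, 'm) ring_scheme \<Rightarrow> 'a \<Rightarrow> nat \<Rightarrow> 'a set" where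
  "to_completion p A a = (\<lambda>k. padic_ideal p A k +>\<^bsub>A\<^esub> a)"


section \<open>The base ring\<close>

text \<open>
  The type \<open>'a\<close> is a complete discrete valuation ring with maximal ideal generated by \<open>p\<close>
  whose residue field is an algebraic closure of its prime field. A discrete valuation ring is a
  principal ideal domain which has exactly one maximal ideal, and this ideal is nonzero; the
  image of the integers in the residue field is the field with \<open>p\<close> elements.
\<close>

definition complete_dvr_Fpbar :: "nat \<Rightarrow> 'a::idom itself \<Rightarrow> bool" where
  "complete_dvr_Fpbar p _ \<longleftrightarrow>
    (let R = (ring_of_type_algebra :: 'a ring);
         m = PIdl\<^bsub>R\<^esub> (of_nat p);
         k = R Quot m
     in principal_domain R \<and>
        (\<forall>I. maximalideal I R \<longleftrightarrow> I = m) \<and> m \<noteq> {0} \<and>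
        bij_betw (to_completion p R) (carrier R) (carrier (padic_completion p R)) \<and>
        algebraic_closure k (range (\<lambda>z::int. [z] \<cdot>\<^bsub>k\<^esub> \<one>\<^bsub>k\<^esub>)))"


section \<open>Polynomials and affine schemes given by equations\<close>

type_synonym ('v, 'a) mpoly = "('v \<Rightarrow>\<^sub>0 nat) \<Rightarrow>\<^sub>0 'a"

text \<open>The type of the elements of the p-adic completion of a quotient of the polynomial ring.\<close>

type_synonym ('v, 'a) ffun = "nat \<Rightarrow> ('v, 'a) mpoly set set"

definition Const :: "'a::comm_ring_1 \<Rightarrow> ('v, 'a) mpoly" where
  "Const c = Poly_Mapping.single 0 c"

definition Var :: "'v \<Rightarrow> ('v, 'a::comm_ring_1) mpoly" where
  "Var v = Poly_Mapping.single (Poly_Mapping.single v 1) 1"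

definition rename_vars :: "('v \<Rightarrow> 'w) \<Rightarrow> ('v, 'a) mpoly \<Rightarrow> ('w, 'a::comm_ring_1) mpoly" where
  "rename_vars e f =
    (\<Sum>m\<in>Poly_Mapping.keys f.
       Const (Poly_Mapping.lookup f m) *
       (\<Prod>v\<in>Poly_Mapping.keys m. Var (e v) ^ Poly_Mapping.lookup m v))"

text \<open>
  A set \<open>E\<close> of polynomials stands for the closed subscheme of affine space that it cuts out;
  \<open>formal_ring p E\<close> is the ring of functions on its p-adic completion, and \<open>fn p E f\<close> is the
  function on that completion given by the polynomial \<open>f\<close>.
\<close>

definition coord_ring :: "('v, 'a::comm_ring_1) mpoly set \<Rightarrow> ('v, 'a) mpoly set ring" where
  "coord_ring E = ring_of_type_algebra Quot (Idl\<^bsub>ring_of_type_algebra\<^esub> E)"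

definition formal_ring ::
    "nat \<Rightarrow> ('v, 'a::comm_ring_1) mpoly set \<Rightarrow> ('v, 'a) ffun ring" where
  "formal_ring p E = padic_completion p (coord_ring E)"

definition fn ::
    "nat \<Rightarrow> ('v, 'a::comm_ring_1) mpoly set \<Rightarrow> ('v, 'a) mpoly \<Rightarrow> ('v, 'a) ffun" where
  "fn p E f = to_completion p (coord_ring E)
     (Idl\<^bsub>ring_of_type_algebra\<^esub> E +>\<^bsub>ring_of_type_algebra\<^esub> f)"

definition product_eqs ::
    "('v, 'a::comm_ring_1) mpoly set \<Rightarrow> ('w, 'a) mpoly set \<Rightarrow> ('v + 'w, 'a) mpoly set" where
  "product_eqs E F = rename_vars Inl ` E \<union> rename_vars Inr ` F"

text \<open>
  Morphisms of formal schemes are represented by their effect on functions, hence with the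
  direction reversed. The condition \<open>h \<in> extensional _\<close> only fixes the irrelevant values of \<open>h\<close>
  off the carrier, so that equality of functions is equality of morphisms.
\<close>

definition formal_hom ::
    "nat \<Rightarrow> ('v, 'a::comm_ring_1) mpoly set \<Rightarrow> ('w, 'a) mpoly set \<Rightarrow>
     (('v, 'a) ffun \<Rightarrow> ('w, 'a) ffun) set" where
  "formal_hom p E F =
    ring_hom (formal_ring p E) (formal_ring p F) \<inter> extensional (carrier (formal_ring p E))"

definition frobenius_lift ::
    "nat \<Rightarrow> ('a \<Rightarrow> 'a) \<Rightarrow> ('v, 'a::comm_ring_1) mpoly set \<Rightarrow>
     (('v, 'a) ffun \<Rightarrow> ('v, 'a) ffun) \<Rightarrow> bool" where
  "frobenius_lift p \<phi> E \<Phi> \<longleftrightarrow>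
    \<Phi> \<in> formal_hom p E E \<and>
    (\<forall>c. \<Phi> (fn p E (Const c)) = fn p E (Const (\<phi> c))) \<and>
    (\<forall>f\<in>carrier (formal_ring p E).
       \<Phi> f \<ominus>\<^bsub>formal_ring p E\<^esub> f [^]\<^bsub>formal_ring p E\<^esub> p
         \<in> PIdl\<^bsub>formal_ring p E\<^esub> ([p] \<cdot>\<^bsub>formal_ring p E\<^esub> \<one>\<^bsub>formal_ring p E\<^esub>))"


section \<open>Closed subschemes of the general linear group\<close>

text \<open>\<open>DetInv\<close> is the coordinate function \<open>det(x)\<^sup>-\<^sup>1\<close>.\<close>

datatype 'n gl_var = Entry 'n 'n | DetInv

definition Xmat :: "('n gl_var \<Rightarrow> 'w) \<Rightarrow> ('w, 'a::comm_ring_1) mpoly ^ 'n ^ 'n" where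
  "Xmat e = (\<chi> i j. Var (e (Entry i j)))"

definition Cmat :: "'a::comm_ring_1 ^ 'n ^ 'n \<Rightarrow> ('w, 'a) mpoly ^ 'n ^ 'n" where
  "Cmat q = (\<chi> i j. Const (q $ i $ j))"

definition GL :: "('n::finite gl_var, 'a::comm_ring_1) mpoly set" where
  "GL = {Var DetInv * det (Xmat id) - 1}"

definition q0 :: "'a::comm_ring_1 ^ ('r::finite + 'r) ^ ('r + 'r)" where
  "q0 = (\<chi> i j. case (i, j) of
           (Inl a, Inr b) \<Rightarrow> if a = b then 1 else 0
         | (Inr a, Inl b) \<Rightarrow> if a = b then - 1 else 0
         | _ \<Rightarrow> 0)"

definition GLc :: "(('r::finite + 'r) gl_var, 'a::comm_ring_1) mpoly set" where
  "GLc = GL \<union> {(Xmat id ** Cmat q0 - Cmat q0 ** Xmat id) $ i $ j | i j. True}"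

text \<open>
  The morphism over the base ring, from the completion of \<open>F\<close> to the completion of a closed
  subscheme \<open>E\<close> of the general linear group, given by a matrix \<open>M\<close> of functions on \<open>F\<close>.
  It is determined by \<open>M\<close>, since the inverse of a determinant is unique.
\<close>

definition matrix_map ::
    "nat \<Rightarrow> ('n::finite gl_var, 'a::comm_ring_1) mpoly set \<Rightarrow> ('w, 'a) mpoly set \<Rightarrow>
     ('w, 'a) mpoly ^ 'n ^ 'n \<Rightarrow>
     ('n gl_var, 'a) ffun \<Rightarrow> ('w, 'a) ffun" where
  "matrix_map p E F M = (THE h.
     h \<in> formal_hom p E F \<and>
     (\<forall>c. h (fn p E (Const c)) = fn p F (Const c)) \<and>
     (\<forall>i j. h (fn p E (Var (Entry i j))) = fn p F (M $ i $ j)))"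

definition phi_GL0 ::
    "nat \<Rightarrow> ('a \<Rightarrow> 'a) \<Rightarrow>
     ('n::finite gl_var, 'a::comm_ring_1) ffun \<Rightarrow> ('n gl_var, 'a) ffun" where
  "phi_GL0 p \<phi> = (THE \<Phi>.
     frobenius_lift p \<phi> GL \<Phi> \<and>
     (\<forall>i j. \<Phi> (fn p GL (Var (Entry i j))) = fn p GL (Var (Entry i j) ^ p)))"

text \<open>
  For a closed subscheme \<open>Z \<subseteq> E\<close>, given by a larger set of equations: restriction of functions,
  horizontality of \<open>Z\<close>, and the lift of Frobenius induced on \<open>Z\<close>.
\<close>

definition restriction ::
    "nat \<Rightarrow> ('n::finite gl_var, 'a::comm_ring_1) mpoly set \<Rightarrow> ('n gl_var, 'a) mpoly set \<Rightarrow>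
     ('n gl_var, 'a) ffun \<Rightarrow> ('n gl_var, 'a) ffun" where
  "restriction p E Z = matrix_map p E Z (Xmat id)"

definition horizontal ::
    "nat \<Rightarrow> ('n::finite gl_var, 'a::comm_ring_1) mpoly set \<Rightarrow> ('n gl_var, 'a) mpoly set \<Rightarrow>
     (('n gl_var, 'a) ffun \<Rightarrow> ('n gl_var, 'a) ffun) \<Rightarrow> bool" where
  "horizontal p E Z \<Phi> \<longleftrightarrow>
    (let I = a_kernel (formal_ring p E) (formal_ring p Z) (restriction p E Z)
     in \<Phi> ` I \<subseteq> I)"

definition induced_lift ::
    "nat \<Rightarrow> ('a \<Rightarrow> 'a) \<Rightarrow>
     ('n::finite gl_var, 'a::comm_ring_1) mpoly set \<Rightarrow> ('n gl_var, 'a) mpoly set \<Rightarrow>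
     (('n gl_var, 'a) ffun \<Rightarrow> ('n gl_var, 'a) ffun) \<Rightarrow>
     ('n gl_var, 'a) ffun \<Rightarrow> ('n gl_var, 'a) ffun" where
  "induced_lift p \<phi> E Z \<Phi> = (THE \<Psi>.
     frobenius_lift p \<phi> Z \<Psi> \<and>
     (\<forall>f\<in>carrier (formal_ring p E). \<Psi> (restriction p E Z f) = restriction p E Z (\<Phi> f)))"


section \<open>The quadratic and bilinear maps attached to a matrix\<close>

text \<open>Here \<open>E\<close> is \<open>GL\<close> or \<open>GLc\<close>.\<close>

definition quadratic_map ::
    "nat \<Rightarrow> ('n::finite gl_var, 'a::comm_ring_1) mpoly set \<Rightarrow> 'a ^ 'n ^ 'n \<Rightarrow>
     ('n gl_var, 'a) ffun \<Rightarrow> ('n gl_var, 'a) ffun" where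
  "quadratic_map p E q = matrix_map p E E (transpose (Xmat id) ** Cmat q ** Xmat id)"

definition bilinear_map ::
    "nat \<Rightarrow> ('n::finite gl_var, 'a::comm_ring_1) mpoly set \<Rightarrow> 'a ^ 'n ^ 'n \<Rightarrow>
     ('n gl_var, 'a) ffun \<Rightarrow> ('n gl_var + 'n gl_var, 'a) ffun" where
  "bilinear_map p E q =
    matrix_map p E (product_eqs E E) (transpose (Xmat Inl) ** Cmat q ** Xmat Inr)"

text \<open>The map to the product with components \<open>f\<^sub>1\<close> and \<open>f\<^sub>2\<close>, which need not be linear over the base.\<close>

definition pairing ::
    "nat \<Rightarrow> ('n::finite gl_var, 'a::comm_ring_1) mpoly set \<Rightarrow>
     (('n gl_var, 'a) ffun \<Rightarrow> ('n gl_var, 'a) ffun) \<Rightarrow>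
     (('n gl_var, 'a) ffun \<Rightarrow> ('n gl_var, 'a) ffun) \<Rightarrow>
     ('n gl_var + 'n gl_var, 'a) ffun \<Rightarrow> ('n gl_var, 'a) ffun" where
  "pairing p E f\<^sub>1 f\<^sub>2 = (THE h.
     h \<in> formal_hom p (product_eqs E E) E \<and>
     (\<forall>f\<in>carrier (formal_ring p E).
        h (matrix_map p E (product_eqs E E) (Xmat Inl) f) = f\<^sub>1 f \<and>
        h (matrix_map p E (product_eqs E E) (Xmat Inr) f) = f\<^sub>2 f))"

definition H_horizontal ::
    "nat \<Rightarrow> ('n::finite gl_var, 'a::comm_ring_1) mpoly set \<Rightarrow> 'a ^ 'n ^ 'n \<Rightarrow>
     (('n gl_var, 'a) ffun \<Rightarrow> ('n gl_var, 'a) ffun) \<Rightarrow>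
     (('n gl_var, 'a) ffun \<Rightarrow> ('n gl_var, 'a) ffun) \<Rightarrow> bool" where
  "H_horizontal p E q \<Phi>\<^sub>0 \<Phi> \<longleftrightarrow>
    (\<forall>f\<in>carrier (formal_ring p E).
       \<Phi> (quadratic_map p E q f) = quadratic_map p E q (\<Phi>\<^sub>0 f))"

definition B_symmetric ::
    "nat \<Rightarrow> ('n::finite gl_var, 'a::comm_ring_1) mpoly set \<Rightarrow> 'a ^ 'n ^ 'n \<Rightarrow>
     (('n gl_var, 'a) ffun \<Rightarrow> ('n gl_var, 'a) ffun) \<Rightarrow>
     (('n gl_var, 'a) ffun \<Rightarrow> ('n gl_var, 'a) ffun) \<Rightarrow> bool" where
  "B_symmetric p E q \<Phi>\<^sub>0 \<Phi> \<longleftrightarrow>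
    (\<forall>f\<in>carrier (formal_ring p E).
       pairing p E \<Phi>\<^sub>0 \<Phi> (bilinear_map p E q f) = pairing p E \<Phi> \<Phi>\<^sub>0 (bilinear_map p E q f))"

definition symmetric_horizontal_lift ::
    "nat \<Rightarrow> ('a \<Rightarrow> 'a) \<Rightarrow> ('n::finite gl_var, 'a::comm_ring_1) mpoly set \<Rightarrow> 'a ^ 'n ^ 'n \<Rightarrow>
     (('n gl_var, 'a) ffun \<Rightarrow> ('n gl_var, 'a) ffun) \<Rightarrow>
     (('n gl_var, 'a) ffun \<Rightarrow> ('n gl_var, 'a) ffun) \<Rightarrow> bool" where
  "symmetric_horizontal_lift p \<phi> E q \<Phi>\<^sub>0 \<Phi> \<longleftrightarrow>
    frobenius_lift p \<phi> E \<Phi> \<and> H_horizontal p E q \<Phi>\<^sub>0 \<Phi> \<and> B_symmetric p E q \<Phi>\<^sub>0 \<Phi>"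

text \<open>The lift of Frobenius on \<open>GL\<close> attached to \<open>q\<close>, and the one it induces on \<open>GLc\<close>.\<close>

definition phi_GL ::
    "nat \<Rightarrow> ('a \<Rightarrow> 'a) \<Rightarrow> 'a::comm_ring_1 ^ 'n ^ 'n \<Rightarrow>
     ('n::finite gl_var, 'a) ffun \<Rightarrow> ('n gl_var, 'a) ffun" where
  "phi_GL p \<phi> q = (THE \<Phi>. symmetric_horizontal_lift p \<phi> GL q (phi_GL0 p \<phi>) \<Phi>)"

definition phi_GLc ::
    "nat \<Rightarrow> ('a \<Rightarrow> 'a) \<Rightarrow> 'a::comm_ring_1 ^ ('r + 'r) ^ ('r + 'r) \<Rightarrow>
     (('r::finite + 'r) gl_var, 'a) ffun \<Rightarrow> (('r + 'r) gl_var, 'a) ffun" where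
  "phi_GLc p \<phi> q = induced_lift p \<phi> GL GLc (phi_GL p \<phi> q)"

definition phi_GLc0 ::
    "nat \<Rightarrow> ('a \<Rightarrow> 'a) \<Rightarrow>
     (('r::finite + 'r) gl_var, 'a::comm_ring_1) ffun \<Rightarrow> (('r + 'r) gl_var, 'a) ffun" where
  "phi_GLc0 p \<phi> = induced_lift p \<phi> GL GLc (phi_GL0 p \<phi>)"

text \<open>On points, \<open>c_map\<close> sends a matrix with upper blocks \<open>a\<close> and \<open>b\<close> to \<open>a + \<iota> b\<close>.\<close>

definition c_map ::
    "nat \<Rightarrow> 'a::comm_ring_1 \<Rightarrow>
     ('r::finite gl_var, 'a) ffun \<Rightarrow> (('r + 'r) gl_var, 'a) ffun" where
  "c_map p \<iota> = matrix_map p GL GLc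
     (\<chi> i j. Var (Entry (Inl i) (Inl j)) + Const \<iota> * Var (Entry (Inl i) (Inr j)))"

definition c_horizontal ::
    "nat \<Rightarrow> 'a::comm_ring_1 \<Rightarrow>
     (('r::finite gl_var, 'a) ffun \<Rightarrow> ('r gl_var, 'a) ffun) \<Rightarrow>
     ((('r + 'r) gl_var, 'a) ffun \<Rightarrow> (('r + 'r) gl_var, 'a) ffun) \<Rightarrow> bool" where
  "c_horizontal p \<iota> \<Theta> \<Psi> \<longleftrightarrow>
    (\<forall>f\<in>carrier (formal_ring p GL). \<Psi> (c_map p \<iota> f) = c_map p \<iota> (\<Theta> f))"

end

theory Submission
  imports Defs
begin

text \<open>
  Let \<open>x\<close> be the matrix of coordinates, \<open>x\<^sub>0\<close> the matrix of the p-th powers of its entries, \<open>Q\<close> the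
  matrix obtained by applying \<open>\<phi>\<close> to the entries of \<open>q\<close>, and \<open>B\<close> the matrix of the p-th powers of
  the entries of \<open>x\<^sup>t q x\<close>. A lift of Frobenius is determined by the matrix \<open>Y\<close> of the images of the
  coordinates, and being horizontal and symmetric with respect to \<open>q\<close> means (lemma
  \<open>symmetric_horizontal_iff\<close>)
    \<open>Y\<^sup>t Q Y = B\<close> and \<open>x\<^sub>0\<^sup>t Q Y = Y\<^sup>t Q x\<^sub>0\<close>.

  Put \<open>A = x\<^sub>0\<^sup>t Q x\<^sub>0\<close> and \<open>Y = x\<^sub>0 V\<close>. Then \<open>V\<close> is congruent to 1 modulo \<open>p\<close>, and the equations become
  \<open>V\<^sup>t A V = B\<close> and \<open>A V = V\<^sup>t A\<close>; together they say that \<open>V V = A\<^sup>-\<^sup>1 B\<close> and \<open>A V = V\<^sup>t A\<close>.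
  Since \<open>A\<close> and \<open>B\<close> agree modulo \<open>p\<close> and \<open>p\<close> is odd, \<open>A\<^sup>-\<^sup>1 B\<close> has exactly one square root congruent
  to 1 (\<open>sqrt_unique\<close>, \<open>sqrt_exists\<close>). It satisfies \<open>A V = V\<^sup>t A\<close>: as \<open>A\<close> and \<open>B\<close> are both
  symmetric or both antisymmetric, \<open>A\<^sup>-\<^sup>1 V\<^sup>t A\<close> is a square root of \<open>A\<^sup>-\<^sup>1 B\<close> congruent to 1 as well,
  hence equal to \<open>V\<close>. This proves the first part.

  For the second part, conjugation by \<open>q0\<close> maps solutions of the equations on the centralizer to
  solutions. By uniqueness \<open>Y\<close> commutes with \<open>q0\<close> there (\<open>solution_commutes\<close>), so the lift preserves
  the ideal of the centralizer and induces the solution of the same equations on it.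

  For the third part, let \<open>q = 1\<close> and evaluate the first block row of \<open>Y\<close> at the matrices \<open>z\<close> with
  blocks \<open>a\<close> and \<open>b\<close> that are scalars with \<open>n = a\<^sup>2 + b\<^sup>2\<close> a unit. There \<open>V\<close> is a scalar with square
  \<open>n\<^sup>p / (a\<^sup>2\<^sup>p + b\<^sup>2\<^sup>p)\<close>. If a lift on the smaller group existed, then the value
  \<open>(a\<^sup>p + \<phi>(\<iota>) b\<^sup>p) V\<close> would depend on \<open>a + \<iota> b\<close> only. But \<open>(2, 0)\<close> and \<open>(3, \<iota>)\<close> both give \<open>a + \<iota> b = 2\<close>,
  and equality of the squares of the two values is \<open>9\<^sup>p - 1 = 2\<^sup>p (3\<^sup>p + e)\<^sup>2\<close> where
  \<open>e = \<phi>(\<iota>) \<iota>\<^sup>p\<close> is 1 or -1. The right side is larger; this is impossible because the base ring has characteristic zero.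

  The elements of the completions are handled through representatives. A power series
  with polynomial coefficients, evaluated at \<open>p\<close>, gives an element of the completion, every element
  arises in this way, and the power series with value zero form an ideal \<open>null\<close>. Power series are
  the elements of a commutative ring type, over which matrices and determinants are available, and the
  mathematics takes place in congruences modulo \<open>null\<close>. A homomorphism out of a completion is the
  same as a point: a choice of values of the variables that satisfies the equations modulo \<open>null\<close>
  (\<open>point_hom_formal_hom\<close>, \<open>formal_hom_is_point\<close>).
\<close>

no_notation fps_nth (infixl \<open>$\<close> 75)

section \<open>Congruences of numbers and matrices modulo an ideal\<close>

definition cong_mod :: "'c::comm_ring_1 \<Rightarrow> 'c set \<Rightarrow> 'c \<Rightarrow> bool" ("(_ \<approx>[_] _)" [51, 0, 51] 50)
  where "x \<approx>[J] y \<longleftrightarrow> x - y \<in> J"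

definition mat_cong ::
    "'c::comm_ring_1 ^ 'n ^ 'm \<Rightarrow> 'c set \<Rightarrow> 'c ^ 'n ^ 'm \<Rightarrow> bool" ("(_ \<simeq>[_] _)" [51, 0, 51] 50)
  where "A \<simeq>[J] B \<longleftrightarrow> (\<forall>i j. A $ i $ j \<approx>[J] B $ i $ j)"

text \<open>
  The p-th power is multiplicative, but additive only modulo \<open>p\<close>, and a homomorphism between
  completions lifts to a map of representatives that is a homomorphism only up to
  representatives of zero. Both are homomorphisms in this sense.
\<close>

definition hom_mod :: "'c::comm_ring_1 set \<Rightarrow> ('b::comm_ring_1 \<Rightarrow> 'c) \<Rightarrow> bool" where
  "hom_mod J h \<longleftrightarrow> (\<forall>a b. h (a + b) \<approx>[J] h a + h b) \<and> (\<forall>a b. h (a * b) \<approx>[J] h a * h b) \<and> h 1 \<approx>[J] 1"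

lemma cong_mod_mono: "x \<approx>[J] y \<Longrightarrow> J \<subseteq> J' \<Longrightarrow> x \<approx>[J'] y"
  by (auto simp: cong_mod_def)

lemma mat_cong_mono: "A \<simeq>[J] B \<Longrightarrow> J \<subseteq> J' \<Longrightarrow> A \<simeq>[J'] B"
  by (auto simp: mat_cong_def intro: cong_mod_mono)

locale ring_ideal =
  fixes J :: "'c::comm_ring_1 set"
  assumes zero_mem: "0 \<in> J"
    and add_mem: "\<And>x y. x \<in> J \<Longrightarrow> y \<in> J \<Longrightarrow> x + y \<in> J"
    and mult_mem: "\<And>x c. x \<in> J \<Longrightarrow> c * x \<in> J"
begin

lemma mult_mem_right: "x \<in> J \<Longrightarrow> x * c \<in> J"
  using mult_mem[of x c] by (simp add: mult.commute)

lemma uminus_mem: "x \<in> J \<Longrightarrow> - x \<in> J"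
  using mult_mem[of x "-1"] by simp

lemma diff_mem: "x \<in> J \<Longrightarrow> y \<in> J \<Longrightarrow> x - y \<in> J"
  using add_mem[of x "- y"] uminus_mem by simp

lemma sum_mem: "(\<And>i. i \<in> S \<Longrightarrow> f i \<in> J) \<Longrightarrow> sum f S \<in> J"
  by (induction S rule: infinite_finite_induct) (auto simp: zero_mem add_mem)

lemma cong_refl [simp]: "x \<approx>[J] x"
  by (simp add: cong_mod_def zero_mem)

lemma cong_sym: "x \<approx>[J] y \<Longrightarrow> y \<approx>[J] x"
  using uminus_mem[of "x - y"] by (simp add: cong_mod_def)

lemma cong_trans [trans]: "x \<approx>[J] y \<Longrightarrow> y \<approx>[J] z \<Longrightarrow> x \<approx>[J] z"
  using add_mem[of "x - y" "y - z"] by (simp add: cong_mod_def)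

lemma cong_add: "x \<approx>[J] y \<Longrightarrow> x' \<approx>[J] y' \<Longrightarrow> x + x' \<approx>[J] y + y'"
  using add_mem[of "x - y" "x' - y'"] by (simp add: cong_mod_def algebra_simps)

lemma cong_uminus: "x \<approx>[J] y \<Longrightarrow> - x \<approx>[J] - y"
  using uminus_mem[of "x - y"] by (simp add: cong_mod_def)

lemma cong_diff: "x \<approx>[J] y \<Longrightarrow> x' \<approx>[J] y' \<Longrightarrow> x - x' \<approx>[J] y - y'"
  using cong_add[of x y "- x'" "- y'"] cong_uminus by simp

lemma cong_mult: "x \<approx>[J] y \<Longrightarrow> x' \<approx>[J] y' \<Longrightarrow> x * x' \<approx>[J] y * y'"
proof -
  assume "x \<approx>[J] y" "x' \<approx>[J] y'"
  then have "x' * (x - y) + y * (x' - y') \<in> J"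
    by (intro add_mem mult_mem) (auto simp: cong_mod_def)
  then show ?thesis
    by (simp add: cong_mod_def algebra_simps)
qed

lemma cong_power: "x \<approx>[J] y \<Longrightarrow> x ^ n \<approx>[J] y ^ n"
  by (induction n) (auto intro: cong_mult)

lemma cong_sum: "(\<And>i. i \<in> S \<Longrightarrow> f i \<approx>[J] g i) \<Longrightarrow> sum f S \<approx>[J] sum g S"
  by (induction S rule: infinite_finite_induct) (auto intro: cong_add)

lemma cong_prod: "(\<And>i. i \<in> S \<Longrightarrow> f i \<approx>[J] g i) \<Longrightarrow> prod f S \<approx>[J] prod g S"
  by (induction S rule: infinite_finite_induct) (auto intro: cong_mult)

lemma cong_cancel_unit: "u * c \<approx>[J] 1 \<Longrightarrow> c * x \<approx>[J] c * y \<Longrightarrow> x \<approx>[J] y"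
proof -
  assume u: "u * c \<approx>[J] 1" and xy: "c * x \<approx>[J] c * y"
  have "x \<approx>[J] (u * c) * x"
    using cong_mult[OF cong_sym[OF u], of x x] by simp
  also have "(u * c) * x \<approx>[J] (u * c) * y"
    using cong_mult[OF cong_refl xy, of u] by (simp add: mult.assoc)
  also have "(u * c) * y \<approx>[J] y"
    using cong_mult[OF u, of y y] by simp
  finally show ?thesis .
qed

lemma mat_refl [simp]: "A \<simeq>[J] A"
  by (simp add: mat_cong_def)

lemma mat_sym: "A \<simeq>[J] B \<Longrightarrow> B \<simeq>[J] A"
  by (auto simp: mat_cong_def intro: cong_sym)

lemma mat_trans [trans]: "A \<simeq>[J] B \<Longrightarrow> B \<simeq>[J] C \<Longrightarrow> A \<simeq>[J] C"
  unfolding mat_cong_def by (meson cong_trans)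

lemma mat_cong_mult: "A \<simeq>[J] B \<Longrightarrow> A' \<simeq>[J] B' \<Longrightarrow> A ** A' \<simeq>[J] B ** B'"
  by (auto simp: mat_cong_def matrix_matrix_mult_def intro!: cong_sum cong_mult)

lemma mat_cong_multL: "A \<simeq>[J] B \<Longrightarrow> C ** A \<simeq>[J] C ** B"
  by (rule mat_cong_mult) auto

lemma mat_cong_multR: "A \<simeq>[J] B \<Longrightarrow> A ** C \<simeq>[J] B ** C"
  by (rule mat_cong_mult) auto

lemma mat_cong_transpose: "A \<simeq>[J] B \<Longrightarrow> transpose A \<simeq>[J] transpose B"
  by (auto simp: mat_cong_def transpose_def)

lemma mat_cong_diff: "A \<simeq>[J] B \<Longrightarrow> A' \<simeq>[J] B' \<Longrightarrow> A - A' \<simeq>[J] B - B'"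
  by (auto simp: mat_cong_def intro: cong_diff)

lemma cong_det: "A \<simeq>[J] B \<Longrightarrow> det A \<approx>[J] det B"
  unfolding det_def by (auto simp: mat_cong_def intro!: cong_sum cong_mult cong_prod)

context
  fixes h :: "'b::comm_ring_1 \<Rightarrow> 'c"
  assumes h: "hom_mod J h"
begin

lemma hom_mod_add: "h (a + b) \<approx>[J] h a + h b" and hom_mod_mult: "h (a * b) \<approx>[J] h a * h b"
  and hom_mod_1: "h 1 \<approx>[J] 1"
  using h by (auto simp: hom_mod_def)

lemma hom_mod_0: "h 0 \<approx>[J] 0"
  using cong_diff[OF hom_mod_add[of 0 0] cong_refl[of "h 0"]] cong_sym by simp

lemma hom_mod_uminus: "h (- a) \<approx>[J] - h a"
proof -
  have "h a + h (- a) \<approx>[J] 0"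
    using cong_trans[OF cong_sym[OF hom_mod_add[of a "- a"]]] hom_mod_0 by simp
  from cong_diff[OF this cong_refl[of "h a"]] show ?thesis
    by simp
qed

lemma hom_mod_diff: "h (a - b) \<approx>[J] h a - h b"
  using cong_trans[OF hom_mod_add[of a "- b"] cong_add[OF cong_refl hom_mod_uminus]] by simp

lemma hom_mod_sum: "h (sum f S) \<approx>[J] (\<Sum>i\<in>S. h (f i))"
  by (induction S rule: infinite_finite_induct)
     (auto simp: hom_mod_0 intro: cong_trans[OF hom_mod_add cong_add[OF cong_refl]])

lemma hom_mod_prod: "h (prod f S) \<approx>[J] (\<Prod>i\<in>S. h (f i))"
  by (induction S rule: infinite_finite_induct)
     (auto simp: hom_mod_1 intro: cong_trans[OF hom_mod_mult cong_mult[OF cong_refl]])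

lemma hom_mod_power: "h (a ^ n) \<approx>[J] h a ^ n"
  by (induction n) (auto simp: hom_mod_1 intro: cong_trans[OF hom_mod_mult cong_mult[OF cong_refl]])

lemma hom_mod_of_nat: "h (of_nat n) \<approx>[J] of_nat n"
  by (induction n) (auto simp: hom_mod_0 intro: cong_trans[OF hom_mod_add cong_add[OF hom_mod_1]])

lemma hom_mod_matrix_mult:
  "map_matrix h (A ** B) \<simeq>[J] map_matrix h A ** map_matrix h B"
  unfolding mat_cong_def
proof (intro allI)
  fix i j
  have "h (\<Sum>k\<in>UNIV. A $ i $ k * B $ k $ j) \<approx>[J] (\<Sum>k\<in>UNIV. h (A $ i $ k) * h (B $ k $ j))"
    by (rule cong_trans[OF hom_mod_sum]) (intro cong_sum hom_mod_mult)
  then show "map_matrix h (A ** B) $ i $ j \<approx>[J] (map_matrix h A ** map_matrix h B) $ i $ j"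
    by (simp add: matrix_matrix_mult_def)
qed

lemma hom_mod_det: "h (det A) \<approx>[J] det (map_matrix h A)"
proof -
  have sgn: "h (of_int (sign q)) \<approx>[J] of_int (sign q)" for q :: "'n \<Rightarrow> 'n"
    using hom_mod_1 cong_trans[OF hom_mod_uminus[of 1] cong_uminus[OF hom_mod_1]]
    by (auto simp: sign_def)
  show ?thesis
    unfolding det_def map_matrix_def vec_lambda_beta
    by (rule cong_trans[OF hom_mod_sum], rule cong_sum, rule cong_trans[OF hom_mod_mult])
       (intro cong_mult sgn hom_mod_prod)
qed

end

text \<open>
  The binomial coefficients strictly between the ends are divisible by \<open>p\<close>.
\<close>

lemma hom_mod_Frobenius:
  assumes "prime p" and p: "of_nat p \<in> J"
  shows "hom_mod J (\<lambda>x. x ^ p)"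
  unfolding hom_mod_def
proof (intro conjI allI)
  fix a b :: 'c
  have p0: "p > 0" using assms(1) by (rule prime_gt_0_nat)
  let ?f = "\<lambda>k. of_nat (p choose k) * a ^ k * b ^ (p - k)"
  have mid: "?f k \<in> J" if "k \<in> {..p} - {0, p}" for k
  proof -
    have "p dvd p choose k"
      using that assms(1) by (intro dvd_choose_prime) auto
    then obtain c where "p choose k = p * c" by blast
    then have "?f k = (of_nat c * a ^ k * b ^ (p - k)) * of_nat p"
      by (simp add: algebra_simps)
    then show ?thesis using mult_mem[OF p] by simp
  qed
  have "(a + b) ^ p = sum ?f ({..p} - {0, p}) + sum ?f {0, p}"
    unfolding binomial_ring by (subst sum.subset_diff[of "{0, p}"]) auto
  also have "sum ?f {0, p} = b ^ p + a ^ p"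
    using p0 by simp
  finally show "(a + b) ^ p \<approx>[J] a ^ p + b ^ p"
    using sum_mem[of "{..p} - {0, p}", OF mid] by (simp add: cong_mod_def)
qed (auto simp: power_mult_distrib)

end

lemma hom_mod_mono: "hom_mod J h \<Longrightarrow> J \<subseteq> J' \<Longrightarrow> hom_mod J' h"
  unfolding hom_mod_def by (meson cong_mod_mono)


section \<open>Inverses of matrices over a commutative ring\<close>

text \<open>
  The entry is a cofactor, written as the determinant in which one row is replaced by a unit vector.
\<close>

definition adjugate :: "'c::comm_ring_1 ^ 'n ^ 'n \<Rightarrow> 'c ^ 'n ^ 'n" where
  "adjugate A = (\<chi> i k. det (\<chi> a. if a = k then axis i 1 else A $ a))"

text \<open>
  By linearity of the determinant in row \<open>k\<close>, the entry in place \<open>(l, k)\<close> of the product is the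
  determinant of \<open>A\<close> with row \<open>k\<close> replaced by row \<open>l\<close>.
\<close>

lemma mult_adjugate: "A ** adjugate A = mat (det A)"
proof -
  have "(\<Sum>i\<in>UNIV. A $ l $ i * det (\<chi> a. if a = k then axis i 1 else A $ a))
      = (if l = k then det A else 0)" for l k
  proof -
    have "(\<Sum>i\<in>UNIV. A $ l $ i * det (\<chi> a. if a = k then axis i 1 else A $ a))
        = (\<Sum>i\<in>UNIV. det (\<chi> a. if a = k then A $ l $ i *s axis i 1 else A $ a))"
      by (simp add: det_row_mul)
    also have "\<dots> = det (\<chi> a. if a = k then (\<Sum>i\<in>UNIV. A $ l $ i *s axis i 1) else A $ a)"
      by (rule det_linear_row_sum[symmetric]) simp
    also have "(\<Sum>i\<in>UNIV. A $ l $ i *s axis i 1) = A $ l"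
      by (rule basis_expansion)
    also have "det (\<chi> a. if a = k then A $ l else A $ a) = (if l = k then det A else 0)"
    proof (cases "l = k")
      case True
      then have "(\<chi> a. if a = k then A $ l else A $ a) = A"
        by (auto simp: vec_eq_iff)
      with True show ?thesis by simp
    next
      case False
      then show ?thesis
        by (auto intro!: det_identical_rows[of l k] simp: row_def vec_eq_iff)
    qed
    finally show ?thesis .
  qed
  then show ?thesis
    by (simp add: adjugate_def matrix_matrix_mult_def mat_def vec_eq_iff)
qed

lemma mat_mult: "mat d ** A = (\<chi> i j. d * A $ i $ j)" and mult_mat: "A ** mat d = (\<chi> i j. A $ i $ j * d)"
  for A :: "'c::comm_ring_1 ^ 'n ^ 'n"
  by (auto simp: matrix_matrix_mult_def mat_def vec_eq_iff if_distrib if_distribR cong: if_cong)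

lemma mat_mult_mat: "mat c ** mat d = (mat (c * d) :: 'c::comm_ring_1 ^ 'n ^ 'n)"
  unfolding mat_mult by (simp add: mat_def vec_eq_iff)

lemma (in ring_ideal) mat_cong_mat: "c \<approx>[J] d \<Longrightarrow> mat c \<simeq>[J] mat d"
  by (auto simp: mat_cong_def mat_def)

text \<open>
  The adjugate provides a right inverse and, applied to the transpose, a left inverse.
\<close>

lemma (in ring_ideal) inverse_mod:
  fixes A :: "'c ^ 'n ^ 'n"
  assumes d: "d * det A \<approx>[J] 1"
  obtains B where "A ** B \<simeq>[J] mat 1" and "B ** A \<simeq>[J] mat 1"
proof
  let ?R = "adjugate A ** mat d"
  let ?L = "transpose (adjugate (transpose A) ** mat d)"
  have right: "A ** adjugate A ** mat d \<simeq>[J] mat 1" if "det A * d \<approx>[J] 1" for A :: "'c ^ 'n ^ 'n"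
    unfolding mult_adjugate mat_mult_mat by (rule mat_cong_mat[OF that])
  show R: "A ** ?R \<simeq>[J] mat 1"
    using right[of A] d by (simp add: matrix_mul_assoc mult.commute)
  have "transpose A ** (adjugate (transpose A) ** mat d) \<simeq>[J] mat 1"
    using right[of "transpose A"] d by (simp add: matrix_mul_assoc mult.commute)
  from mat_cong_transpose[OF this] have L: "?L ** A \<simeq>[J] mat 1"
    by (simp add: matrix_transpose_mul)
  have "?R \<simeq>[J] (?L ** A) ** ?R"
    using mat_cong_multR[OF mat_sym[OF L]] by simp
  also have "(?L ** A) ** ?R \<simeq>[J] ?L"
    using mat_cong_multL[OF R, of ?L] by (simp add: matrix_mul_assoc)
  finally show "?R ** A \<simeq>[J] mat 1"
    using L mat_cong_multR mat_trans by blast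
qed


lemma matrix_diff_ldistrib: "A ** (B - C) = A ** B - A ** C"
  and matrix_diff_rdistrib: "(B - C) ** D = B ** D - C ** D"
  for A :: "'c::comm_ring_1 ^ 'n ^ 'm" and D :: "'c ^ 'k ^ 'n"
  by (simp_all add: matrix_matrix_mult_def vec_eq_iff algebra_simps sum_subtractf)

section \<open>Square roots congruent to the identity\<close>

text \<open>
  The model is \<open>L k = I + (p\<^sup>k)\<close>, whose intersection consists of the elements that vanish in
  the completion.
\<close>

locale ideal_filtration =
  fixes L :: "nat \<Rightarrow> 'c::comm_ring_1 set"
  assumes ideal: "\<And>k. ring_ideal (L k)"
    and level_0: "L 0 = UNIV"
    and level_mult: "\<And>a b k. a \<in> L 1 \<Longrightarrow> b \<in> L k \<Longrightarrow> a * b \<in> L (Suc k)"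
begin

text \<open>
  With \<open>D = U - V\<close> the difference of the squares is \<open>2 D + (U - 1) D + D (V - 1)\<close>. So \<open>2 D\<close>, and with it
  \<open>D\<close>, lies one level deeper than \<open>D\<close> was known to lie, and this can be iterated.
\<close>

lemma sqrt_unique:
  fixes U V :: "'c ^ 'n ^ 'n" and c :: 'c
  assumes half: "c * 2 = 1"
    and U: "U \<simeq>[L 1] mat 1" and V: "V \<simeq>[L 1] mat 1"
    and eq: "U ** U \<simeq>[(\<Inter>k. L k)] V ** V"
  shows "U \<simeq>[(\<Inter>k. L k)] V"
proof -
  define D where "D = U - V"
  have "D $ i $ j \<in> L k" for k i j
  proof (induction k arbitrary: i j)
    case 0
    show ?case by (simp add: level_0)
  next
    case (Suc k)
    interpret ring_ideal "L (Suc k)" by (rule ideal)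
    define F G where "F = (U - mat 1) ** D" and "G = D ** (V - mat 1)"
    have *: "U ** U - V ** V = D + D + F + G"
      by (simp add: F_def G_def D_def matrix_diff_ldistrib matrix_diff_rdistrib)
    have "(U - mat 1) $ i $ j \<in> L 1" "(V - mat 1) $ i $ j \<in> L 1" for i j
      using U V by (simp_all add: mat_cong_def cong_mod_def)
    with Suc.IH have "F $ i $ j \<in> L (Suc k)" "G $ i $ j \<in> L (Suc k)"
      unfolding F_def G_def matrix_matrix_mult_def vec_lambda_beta
      using level_mult level_mult[of "(V - mat 1) $ _ $ _" "D $ _ $ _" k]
      by (auto intro!: sum_mem simp: mult.commute[of "D $ _ $ _"])
    moreover have "(D + D + F + G) $ i $ j \<in> L (Suc k)"
      using eq unfolding *[symmetric] by (auto simp: mat_cong_def cong_mod_def)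
    ultimately have "(D + D + F + G) $ i $ j - F $ i $ j - G $ i $ j \<in> L (Suc k)"
      by (intro diff_mem)
    then have "2 * D $ i $ j \<in> L (Suc k)" by simp
    then have "c * (2 * D $ i $ j) \<in> L (Suc k)" by (rule mult_mem)
    moreover have "c * (2 * D $ i $ j) = D $ i $ j"
      by (metis half mult.assoc mult_1)
    ultimately show ?case by simp
  qed
  then show ?thesis
    by (auto simp: mat_cong_def cong_mod_def D_def)
qed

end

section \<open>Ring homomorphisms out of polynomial rings\<close>

definition ring_map :: "('b::comm_ring_1 \<Rightarrow> 'c::comm_ring_1) \<Rightarrow> bool" where
  "ring_map h \<longleftrightarrow> (\<forall>a b. h (a + b) = h a + h b) \<and> (\<forall>a b. h (a * b) = h a * h b) \<and> h 1 = 1"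

lemma ring_ideal_0: "ring_ideal {0::'c::comm_ring_1}"
  by unfold_locales auto

lemma cong_mod_0_iff: "x \<approx>[{0}] y \<longleftrightarrow> x = y"
  by (simp add: cong_mod_def)

lemma mat_cong_0_eq: "A \<simeq>[{0}] B \<longleftrightarrow> A = B"
  by (simp add: mat_cong_def cong_mod_0_iff vec_eq_iff)

text \<open>
  Ordinary homomorphisms are homomorphisms modulo the zero ideal, which transfers the facts on
  matrices and determinants.
\<close>

lemma ring_map_iff: "ring_map h \<longleftrightarrow> hom_mod {0} h"
  by (simp add: ring_map_def hom_mod_def cong_mod_0_iff)

lemma ring_map_hom_mod: "ring_map h \<Longrightarrow> ring_ideal J \<Longrightarrow> hom_mod J h"
  unfolding ring_map_iff by (erule hom_mod_mono) (auto simp: ring_ideal.zero_mem)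

context
  fixes h :: "'b::comm_ring_1 \<Rightarrow> 'c::comm_ring_1"
  assumes h: "ring_map h"
begin

lemma ring_map_add: "h (a + b) = h a + h b" and ring_map_mult: "h (a * b) = h a * h b"
  and ring_map_1: "h 1 = 1"
  using h by (auto simp: ring_map_def)

lemma ring_map_0: "h 0 = 0" and ring_map_uminus: "h (- a) = - h a"
  and ring_map_diff: "h (a - b) = h a - h b" and ring_map_power: "h (a ^ n) = h a ^ n"
  and ring_map_of_nat: "h (of_nat n) = of_nat n"
  using ring_ideal.hom_mod_0[OF ring_ideal_0 h[unfolded ring_map_iff]]
    ring_ideal.hom_mod_uminus[OF ring_ideal_0 h[unfolded ring_map_iff]]
    ring_ideal.hom_mod_diff[OF ring_ideal_0 h[unfolded ring_map_iff]]
    ring_ideal.hom_mod_power[OF ring_ideal_0 h[unfolded ring_map_iff]]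
    ring_ideal.hom_mod_of_nat[OF ring_ideal_0 h[unfolded ring_map_iff]]
  unfolding cong_mod_0_iff by auto

lemma ring_map_matrix_mult: "map_matrix h (A ** B) = map_matrix h A ** map_matrix h B"
  using ring_ideal.hom_mod_matrix_mult[OF ring_ideal_0 h[unfolded ring_map_iff]]
  unfolding mat_cong_0_eq .

lemma ring_map_det: "h (det A) = det (map_matrix h A)"
  using ring_ideal.hom_mod_det[OF ring_ideal_0 h[unfolded ring_map_iff]]
  unfolding cong_mod_0_iff .

lemma ring_map_matrix_1: "map_matrix h (mat 1) = mat 1"
  by (simp add: map_matrix_def mat_def vec_eq_iff ring_map_0 ring_map_1)

end

lemma transpose_map_matrix: "transpose (map_matrix h A) = map_matrix h (transpose A)"
  by (simp add: map_matrix_def transpose_def)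

lemma map_matrix_map_matrix: "map_matrix g (map_matrix h A) = map_matrix (\<lambda>x. g (h x)) A"
  by (simp add: map_matrix_def vec_eq_iff)

lemma ring_map_comp: "ring_map g \<Longrightarrow> ring_map h \<Longrightarrow> ring_map (\<lambda>x. g (h x))"
  by (simp add: ring_map_def)

definition insertion ::
    "('a::comm_ring_1 \<Rightarrow> 'c::comm_ring_1) \<Rightarrow> ('v \<Rightarrow> 'c) \<Rightarrow> ('v, 'a) mpoly \<Rightarrow> 'c" where
  "insertion \<sigma> y f =
    (\<Sum>m\<in>Poly_Mapping.keys f.
       \<sigma> (Poly_Mapping.lookup f m) * (\<Prod>v\<in>Poly_Mapping.keys m. y v ^ Poly_Mapping.lookup m v))"

definition monomial_value :: "('v \<Rightarrow> 'c::comm_ring_1) \<Rightarrow> ('v \<Rightarrow>\<^sub>0 nat) \<Rightarrow> 'c" where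
  "monomial_value y m = (\<Prod>v\<in>Poly_Mapping.keys m. y v ^ Poly_Mapping.lookup m v)"

lemma monomial_value_superset:
  "finite S \<Longrightarrow> Poly_Mapping.keys m \<subseteq> S \<Longrightarrow> monomial_value y m = (\<Prod>v\<in>S. y v ^ Poly_Mapping.lookup m v)"
  unfolding monomial_value_def
  by (rule prod.mono_neutral_left) (auto simp: in_keys_iff)

lemma monomial_value_add: "monomial_value y (m + m') = monomial_value y m * monomial_value y m'"
proof -
  let ?S = "Poly_Mapping.keys m \<union> Poly_Mapping.keys m'"
  have "Poly_Mapping.keys (m + m') \<subseteq> ?S"
    by (rule Poly_Mapping.keys_add)
  then show ?thesis
    using monomial_value_superset[of ?S "m + m'" y] monomial_value_superset[of ?S m y]
      monomial_value_superset[of ?S m' y]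
    by (simp add: lookup_add power_add prod.distrib)
qed

lemma poly_mapping_sum_single:
  "(\<Sum>m\<in>Poly_Mapping.keys f. Poly_Mapping.single m (Poly_Mapping.lookup f m)) = f"
  by (rule poly_mapping_eqI)
     (auto simp: lookup_sum lookup_single when_def in_keys_iff)

lemma Const_ring_map: "ring_map Const"
  by (simp add: ring_map_def Const_def single_add mult_single)

lemma Var_power: "Var v ^ n = Poly_Mapping.single (Poly_Mapping.single v n) 1"
  by (induction n) (simp_all add: Var_def mult_single single_add[symmetric] add.commute)

lemma monomial_value_Var: "monomial_value Var m = Poly_Mapping.single m 1"
proof -
  have "(\<Prod>v\<in>S. Poly_Mapping.single (Poly_Mapping.single v (k v)) (1::'b::comm_ring_1))
      = Poly_Mapping.single (\<Sum>v\<in>S. Poly_Mapping.single v (k v)) 1" for S and k :: "'a \<Rightarrow> nat"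
    by (induction S rule: infinite_finite_induct) (simp_all add: mult_single)
  then show ?thesis
    by (simp add: monomial_value_def Var_power poly_mapping_sum_single)
qed

lemma single_eq_Const_mult: "Poly_Mapping.single m c = Const c * monomial_value Var m"
  by (simp add: monomial_value_Var Const_def mult_single)

text \<open>
  Every polynomial is built from constants and variables, so homomorphisms are determined by their
  values there, also modulo an ideal.
\<close>

lemma mpoly_induct [case_names Const Var add mult]:
  fixes f :: "('v, 'a::comm_ring_1) mpoly"
  assumes Const: "\<And>c. P (Const c)" and Var: "\<And>v. P (Var v)"
    and add: "\<And>f g. P f \<Longrightarrow> P g \<Longrightarrow> P (f + g)" and mult: "\<And>f g. P f \<Longrightarrow> P g \<Longrightarrow> P (f * g)"
  shows "P f"
proof -
  have c01: "Const 0 = (0 :: ('v, 'a) mpoly)" "Const 1 = (1 :: ('v, 'a) mpoly)"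
    by (simp_all add: Const_def)
  have 0: "P 0" and 1: "P 1"
    using Const[of 0] Const[of 1] unfolding c01 by auto
  have pow: "P (f ^ n)" if "P f" for f n
    using that by (induction n) (auto intro: 1 mult)
  have prod: "P (prod g S)" if "\<And>x. P (g x)" for g :: "'v \<Rightarrow> _" and S
    using that by (induction S rule: infinite_finite_induct) (auto intro: 1 mult)
  have sum: "P (sum g S)" if "\<And>x. P (g x)" for g :: "('v \<Rightarrow>\<^sub>0 nat) \<Rightarrow> _" and S
    using that by (induction S rule: infinite_finite_induct) (auto intro: 0 add)
  have "P (\<Sum>m\<in>Poly_Mapping.keys f. Poly_Mapping.single m (Poly_Mapping.lookup f m))"
    unfolding single_eq_Const_mult monomial_value_def by (intro sum mult Const prod pow Var)
  then show ?thesis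
    by (simp add: poly_mapping_sum_single)
qed

lemma rename_vars_eq: "rename_vars e = insertion Const (\<lambda>v. Var (e v))"
  by (simp add: fun_eq_iff rename_vars_def insertion_def)

context
  fixes \<sigma> :: "'a::comm_ring_1 \<Rightarrow> 'c::comm_ring_1" and y :: "'v \<Rightarrow> 'c"
  assumes \<sigma>: "ring_map \<sigma>"
begin

lemma insertion_superset:
  "finite S \<Longrightarrow> Poly_Mapping.keys f \<subseteq> S \<Longrightarrow>
    insertion \<sigma> y f = (\<Sum>m\<in>S. \<sigma> (Poly_Mapping.lookup f m) * monomial_value y m)"
  unfolding insertion_def monomial_value_def
  by (rule sum.mono_neutral_left) (auto simp: in_keys_iff ring_map_0[OF \<sigma>])

lemma insertion_single: "insertion \<sigma> y (Poly_Mapping.single m c) = \<sigma> c * monomial_value y m"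
  using insertion_superset[of "{m}" "Poly_Mapping.single m c"] by simp

lemma insertion_add: "insertion \<sigma> y (f + g) = insertion \<sigma> y f + insertion \<sigma> y g"
proof -
  let ?S = "Poly_Mapping.keys f \<union> Poly_Mapping.keys g"
  have "Poly_Mapping.keys (f + g) \<subseteq> ?S"
    by (rule Poly_Mapping.keys_add)
  then show ?thesis
    using insertion_superset[of ?S "f + g"] insertion_superset[of ?S f] insertion_superset[of ?S g]
    by (simp add: lookup_add ring_map_add[OF \<sigma>] distrib_right sum.distrib)
qed

lemma insertion_sum: "insertion \<sigma> y (sum f S) = (\<Sum>i\<in>S. insertion \<sigma> y (f i))"
proof -
  have "insertion \<sigma> y 0 = 0" by (simp add: insertion_def)
  then show ?thesis
    by (induction S rule: infinite_finite_induct) (auto simp: insertion_add)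
qed

lemma ring_map_insertion: "ring_map (insertion \<sigma> y)"
  unfolding ring_map_def
proof (intro conjI allI)
  fix f g :: "('v, 'a) mpoly"
  let ?s = "\<lambda>f m. Poly_Mapping.single m (Poly_Mapping.lookup f m)"
  have "f * g = (\<Sum>m\<in>Poly_Mapping.keys f. ?s f m) * (\<Sum>n\<in>Poly_Mapping.keys g. ?s g n)"
    by (simp add: poly_mapping_sum_single)
  also have "\<dots> = (\<Sum>m\<in>Poly_Mapping.keys f. \<Sum>n\<in>Poly_Mapping.keys g.
      Poly_Mapping.single (m + n) (Poly_Mapping.lookup f m * Poly_Mapping.lookup g n))"
    by (simp add: sum_product mult_single)
  also have "insertion \<sigma> y \<dots> = (\<Sum>m\<in>Poly_Mapping.keys f. \<Sum>n\<in>Poly_Mapping.keys g.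
      (\<sigma> (Poly_Mapping.lookup f m) * monomial_value y m)
        * (\<sigma> (Poly_Mapping.lookup g n) * monomial_value y n))"
    by (simp add: insertion_sum insertion_single ring_map_mult[OF \<sigma>] monomial_value_add mult_ac)
  also have "\<dots> = insertion \<sigma> y f * insertion \<sigma> y g"
    unfolding insertion_def monomial_value_def by (rule sum_product[symmetric])
  finally show "insertion \<sigma> y (f * g) = insertion \<sigma> y f * insertion \<sigma> y g" .
next
  have "insertion \<sigma> y (Poly_Mapping.single 0 1) = 1"
    by (simp only: insertion_single) (simp add: ring_map_1[OF \<sigma>] monomial_value_def)
  then show "insertion \<sigma> y 1 = 1" by simp
qed (rule insertion_add)

lemma insertion_Const: "insertion \<sigma> y (Const c) = \<sigma> c"
  unfolding Const_def insertion_single by (simp add: monomial_value_def)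

lemma insertion_Var: "insertion \<sigma> y (Var v) = y v"
  unfolding Var_def insertion_single by (simp add: monomial_value_def ring_map_1[OF \<sigma>])

end

lemma (in ring_ideal) hom_mod_mpoly_eq:
  fixes f :: "('v, 'a::comm_ring_1) mpoly"
  assumes h: "hom_mod J h" and h': "hom_mod J h'"
    and Const: "\<And>c. h (Const c) \<approx>[J] h' (Const c)" and Var: "\<And>v. h (Var v) \<approx>[J] h' (Var v)"
  shows "h f \<approx>[J] h' f"
proof (induction f rule: mpoly_induct)
  case (add f g)
  have "h (f + g) \<approx>[J] h f + h g" by (rule hom_mod_add[OF h])
  also have "h f + h g \<approx>[J] h' f + h' g" by (intro cong_add add)
  also have "h' f + h' g \<approx>[J] h' (f + g)" by (rule cong_sym[OF hom_mod_add[OF h']])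
  finally show ?case .
next
  case (mult f g)
  have "h (f * g) \<approx>[J] h f * h g" by (rule hom_mod_mult[OF h])
  also have "h f * h g \<approx>[J] h' f * h' g" by (intro cong_mult mult)
  also have "h' f * h' g \<approx>[J] h' (f * g)" by (rule cong_sym[OF hom_mod_mult[OF h']])
  finally show ?case .
qed (rule assms)+

lemma ring_map_mpoly_eq:
  fixes f :: "('v, 'a::comm_ring_1) mpoly"
  assumes "ring_map h" "ring_map h'" "\<And>c. h (Const c) = h' (Const c)" "\<And>v. h (Var v) = h' (Var v)"
  shows "h f = h' f"
  using ring_ideal.hom_mod_mpoly_eq[OF ring_ideal_0, of h h' f] assms
  by (simp add: ring_map_iff cong_mod_0_iff)

lemma insertion_rename_vars:
  assumes "ring_map \<sigma>"
  shows "insertion \<sigma> y (rename_vars e f) = insertion \<sigma> (\<lambda>v. y (e v)) f"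
  unfolding rename_vars_eq
  by (rule ring_map_mpoly_eq[where h = "\<lambda>f. insertion \<sigma> y (insertion Const _ f)"])
     (simp_all add: insertion_Const insertion_Var assms Const_ring_map ring_map_insertion
        ring_map_comp[OF ring_map_insertion ring_map_insertion])


section \<open>Power series as representatives of p-adic limits\<close>

lemma fps_head_tail: "g = fps_const (fps_nth g 0) + fps_X * fps_shift 1 g"
  for g :: "'c::comm_ring_1 fps"
  by (simp add: fps_eq_iff)

lemma fps_head_tailE:
  fixes g :: "'c::comm_ring_1 fps"
  obtains a g' where "g = fps_const a + fps_X * g'"
  using fps_head_tail by blast

lemma fps_const_ring_map: "ring_map (fps_const :: 'c::comm_ring_1 \<Rightarrow> 'c fps)"
  by (simp add: ring_map_def)

text \<open>The ideal of the power series divisible by the m-th power of the variable.\<close>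

definition zero_below :: "nat \<Rightarrow> 'c::comm_ring_1 fps set" where
  "zero_below m = {g. \<forall>n<m. fps_nth g n = 0}"

lemma ring_ideal_zero_below: "ring_ideal (zero_below m)"
  by unfold_locales (auto simp: zero_below_def fps_mult_nth intro!: sum.neutral)

lemma fps_eq_iff_zero_below: "g = h \<longleftrightarrow> (\<forall>m. g - h \<in> zero_below m)"
  by (auto simp: zero_below_def fps_eq_iff)

lemma zero_below_0 [simp]: "zero_below 0 = UNIV"
  by (simp add: zero_below_def)

lemma X_mult_zero_below: "fps_X * g \<in> zero_below (Suc m) \<longleftrightarrow> g \<in> zero_below m"
  by (auto simp: zero_below_def less_Suc_eq_0_disj)

text \<open>
  This is the map that sends \<open>\<Sum> g\<^sub>i t\<^sup>i\<close> to \<open>\<Sum> H(g\<^sub>i) t\<^sup>i\<close>; the coefficients are spelled out since each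
  \<open>H(g\<^sub>i)\<close> is itself a power series.
\<close>

definition fps_extend :: "('b::comm_ring_1 \<Rightarrow> 'c::comm_ring_1 fps) \<Rightarrow> 'b fps \<Rightarrow> 'c fps" where
  "fps_extend H g = Abs_fps (\<lambda>n. \<Sum>i\<le>n. fps_nth (H (fps_nth g i)) (n - i))"

lemma fps_extend_nth: "fps_nth (fps_extend H g) n = (\<Sum>i\<le>n. fps_nth (H (fps_nth g i)) (n - i))"
  by (simp add: fps_extend_def)

lemma fps_extend_head_tail:
  assumes H: "ring_map H"
  shows "fps_extend H (fps_const a + fps_X * g) = H a + fps_X * fps_extend H g"
proof (rule fps_ext)
  fix n
  show "fps_nth (fps_extend H (fps_const a + fps_X * g)) n = fps_nth (H a + fps_X * fps_extend H g) n"
    by (cases n) (simp_all add: fps_extend_nth sum.atMost_Suc_shift ring_map_0[OF H] del: sum.atMost_Suc)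
qed

context
  fixes H :: "'b::comm_ring_1 \<Rightarrow> 'c::comm_ring_1 fps"
  assumes H: "ring_map H"
begin

lemma fps_extend_const: "fps_extend H (fps_const a) = H a"
proof -
  have "fps_extend H 0 = 0"
    by (simp add: fps_eq_iff fps_extend_nth ring_map_0[OF H])
  then show ?thesis
    using fps_extend_head_tail[OF H, of a 0] by simp
qed

lemma fps_extend_X_mult: "fps_extend H (fps_X * g) = fps_X * fps_extend H g"
  using fps_extend_head_tail[OF H, of 0 g] by (simp add: ring_map_0[OF H])

lemma fps_extend_add: "fps_extend H (g + h) = fps_extend H g + fps_extend H h"
  by (simp add: fps_eq_iff fps_extend_nth ring_map_add[OF H] sum.distrib)

text \<open>
  Here and for the product of two power series, the constant term is split off and the rest is
  handled by induction on the precision.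
\<close>

lemma fps_extend_const_mult: "fps_extend H (fps_const a * g) = H a * fps_extend H g"
  unfolding fps_eq_iff_zero_below
proof
  fix m
  show "fps_extend H (fps_const a * g) - H a * fps_extend H g \<in> zero_below m"
  proof (induction m arbitrary: g)
    case (Suc m)
    obtain b g' where g: "g = fps_const b + fps_X * g'" by (rule fps_head_tailE)
    have ag: "fps_const a * g = fps_const (a * b) + fps_X * (fps_const a * g')"
      by (simp add: g algebra_simps)
    have "fps_extend H (fps_const a * g) = H a * H b + fps_X * fps_extend H (fps_const a * g')"
      unfolding ag by (simp only: fps_extend_head_tail[OF H] ring_map_mult[OF H])
    then have "fps_extend H (fps_const a * g) - H a * fps_extend H g
        = fps_X * (fps_extend H (fps_const a * g') - H a * fps_extend H g')"
      by (simp only: g fps_extend_head_tail[OF H]) (simp add: algebra_simps)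
    with Suc show ?case by (simp add: X_mult_zero_below)
  qed simp
qed

lemma ring_map_fps_extend: "ring_map (fps_extend H)"
  unfolding ring_map_def
proof (intro conjI allI)
  fix g h
  show "fps_extend H (g * h) = fps_extend H g * fps_extend H h"
    unfolding fps_eq_iff_zero_below
  proof
    fix m
    show "fps_extend H (g * h) - fps_extend H g * fps_extend H h \<in> zero_below m"
    proof (induction m arbitrary: g)
      case (Suc m)
      obtain a g' where g: "g = fps_const a + fps_X * g'" by (rule fps_head_tailE)
      have gh: "g * h = fps_const a * h + fps_X * (g' * h)"
        by (simp add: g algebra_simps)
      have "fps_extend H (g * h) - fps_extend H g * fps_extend H h
          = fps_X * (fps_extend H (g' * h) - fps_extend H g' * fps_extend H h)"
        unfolding gh fps_extend_add fps_extend_const_mult fps_extend_X_mult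
        by (simp add: g fps_extend_head_tail[OF H] algebra_simps)
      with Suc show ?case by (simp add: X_mult_zero_below)
    qed simp
  qed
next
  show "fps_extend H 1 = 1"
    using fps_extend_const[of 1] by (simp add: ring_map_1[OF H])
qed (rule fps_extend_add)

lemma fps_extend_X: "fps_extend H fps_X = fps_X"
  using fps_extend_X_mult[of 1] ring_map_1[OF ring_map_fps_extend] by simp

end

text \<open>
  The coefficient of index \<open>n\<close> no longer changes after \<open>n + 1\<close> iterations of a contraction.
\<close>

lemma fps_matrix_fixpoint:
  fixes T :: "'c::comm_ring_1 fps ^ 'n ^ 'n \<Rightarrow> 'c fps ^ 'n ^ 'n"
  assumes contr: "\<And>m A B. A \<simeq>[zero_below m] B \<Longrightarrow> T A \<simeq>[zero_below (Suc m)] T B"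
  obtains U where "T U = U"
proof -
  define s where "s m = (T ^^ m) 0" for m
  have step: "s m \<simeq>[zero_below m] s (Suc m)" for m
  proof (induction m)
    case 0
    show ?case by (simp add: mat_cong_def cong_mod_def)
  next
    case (Suc m)
    from contr[OF this] show ?case by (simp add: s_def)
  qed
  have steps: "fps_nth (s m $ i $ j) n = fps_nth (s (Suc n) $ i $ j) n" if "n < m" for m n i j
    using that
  proof (induction m)
    case (Suc m)
    show ?case
    proof (cases "n < m")
      case True
      have "fps_nth (s m $ i $ j) n = fps_nth (s (Suc m) $ i $ j) n"
        using step[of m] True by (simp add: mat_cong_def cong_mod_def zero_below_def)
      with Suc.IH True show ?thesis by simp
    next
      case False
      with Suc.prems have "m = n" by simp
      then show ?thesis by simp
    qed
  qed simp
  define U where "U = (\<chi> i j. Abs_fps (\<lambda>n. fps_nth (s (Suc n) $ i $ j) n))"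
  have U: "U \<simeq>[zero_below m] s m" for m
    unfolding U_def mat_cong_def cong_mod_def zero_below_def by (auto intro: steps[symmetric])
  have "T U \<simeq>[zero_below m] U" for m
  proof -
    interpret ring_ideal "zero_below m" by (rule ring_ideal_zero_below)
    have "T U \<simeq>[zero_below (Suc m)] s (Suc m)"
      using contr[OF U[of m]] by (simp add: s_def)
    then have "T U \<simeq>[zero_below m] s (Suc m)"
      by (rule mat_cong_mono) (auto simp: zero_below_def)
    also have "s (Suc m) \<simeq>[zero_below m] s m" by (rule mat_sym[OF step])
    also have "s m \<simeq>[zero_below m] U" by (rule mat_sym[OF U])
    finally show ?thesis .
  qed
  then have "T U = U"
    by (simp add: vec_eq_iff fps_eq_iff_zero_below mat_cong_def cong_mod_def)
  then show ?thesis by (rule that)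
qed

lemma matrix_add_rdistrib: "(B + C) ** D = B ** D + C ** D"
  for B :: "'c::comm_ring_1 ^ 'n ^ 'm" and D :: "'c ^ 'k ^ 'n"
  by (simp add: matrix_matrix_mult_def vec_eq_iff algebra_simps sum.distrib)

text \<open>
  The equation amounts to \<open>2 U + t U\<^sup>2 = N\<close>, and \<open>U \<mapsto> (N - t U\<^sup>2) / 2\<close> is a contraction.
\<close>

lemma fps_matrix_sqrt:
  fixes N :: "'c::comm_ring_1 fps ^ 'n ^ 'n" and c :: "'c fps"
  assumes half: "c * 2 = 1"
  obtains U where
    "(mat 1 + mat fps_X ** U) ** (mat 1 + mat fps_X ** U) = mat 1 + mat fps_X ** N"
proof -
  define T where "T A = mat c ** (N - mat fps_X ** (A ** A))" for A
  have "T A \<simeq>[zero_below (Suc m)] T B" if "A \<simeq>[zero_below m] B" for m A B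
  proof -
    have "A ** A \<simeq>[zero_below m] B ** B"
      using that by (intro ring_ideal.mat_cong_mult ring_ideal_zero_below)
    then have *: "mat fps_X ** (A ** A) \<simeq>[zero_below (Suc m)] mat fps_X ** (B ** B)"
      unfolding mat_mult
      by (simp add: mat_cong_def cong_mod_def X_mult_zero_below right_diff_distrib[symmetric])
    interpret ring_ideal "zero_below (Suc m)" by (rule ring_ideal_zero_below)
    show ?thesis
      unfolding T_def by (intro mat_cong_multL mat_cong_diff mat_refl *)
  qed
  then obtain U where U: "T U = U" by (rule fps_matrix_fixpoint)
  have "(U + U) $ i $ j = (N - mat fps_X ** (U ** U)) $ i $ j" for i j
  proof -
    have "(U + U) $ i $ j = 2 * T U $ i $ j" by (simp add: U)
    also have "\<dots> = (c * 2) * (N - mat fps_X ** (U ** U)) $ i $ j"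
      unfolding T_def mat_mult[of c] by (simp only: vec_lambda_beta ac_simps)
    finally show ?thesis by (simp add: half)
  qed
  then have UU: "U + U = N - mat fps_X ** (U ** U)" by (simp add: vec_eq_iff)
  have comm: "U ** (mat fps_X ** U) = mat fps_X ** (U ** U)"
    unfolding mat_mult by (simp add: matrix_matrix_mult_def vec_eq_iff sum_distrib_left mult_ac)
  have "(mat 1 + mat fps_X ** U) ** (mat 1 + mat fps_X ** U)
      = mat 1 + mat fps_X ** (U + U + mat fps_X ** (U ** U))"
    by (simp only: matrix_add_ldistrib matrix_add_rdistrib matrix_mul_lid matrix_mul_rid
        matrix_mul_assoc[symmetric] comm add_ac)
  also have "\<dots> = mat 1 + mat fps_X ** N"
    by (simp add: UU)
  finally show ?thesis by (rule that)
qed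

section \<open>Power series modulo equations and powers of p\<close>

type_synonym ('v, 'a) series = "('v, 'a) mpoly fps"

lemma ring_of_type_algebra_simps [simp]:
  "carrier ring_of_type_algebra = UNIV"
  "x \<otimes>\<^bsub>ring_of_type_algebra\<^esub> y = x * y" "x \<oplus>\<^bsub>ring_of_type_algebra\<^esub> y = x + y"
  "\<one>\<^bsub>ring_of_type_algebra\<^esub> = 1" "\<zero>\<^bsub>ring_of_type_algebra\<^esub> = 0"
  for x y :: "'c::comm_ring_1"
  by (simp_all add: ring_of_type_algebra_def)

lemma a_inv_ring_of_type_algebra [simp]: "\<ominus>\<^bsub>ring_of_type_algebra\<^esub> x = - x"
  for x :: "'c::comm_ring_1"
proof -
  interpret T: cring "ring_of_type_algebra :: 'c ring" by (rule cring_from_type_algebra)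
  show ?thesis
    using T.minus_equality[of "- x" x] by simp
qed

lemma ideal_iff_ring_ideal: "ideal J ring_of_type_algebra \<longleftrightarrow> ring_ideal J"
  for J :: "'c::comm_ring_1 set"
proof
  assume "ideal J ring_of_type_algebra"
  then interpret ideal J "ring_of_type_algebra :: 'c ring" .
  show "ring_ideal J"
    using additive_subgroup.zero_closed[OF additive_subgroup_axioms]
      additive_subgroup.a_closed[OF additive_subgroup_axioms] I_l_closed
    by unfold_locales auto
next
  assume "ring_ideal J"
  then interpret ring_ideal J .
  interpret T: cring "ring_of_type_algebra :: 'c ring" by (rule cring_from_type_algebra)
  show "ideal J ring_of_type_algebra"
  proof (rule idealI)
    show "subgroup J (add_monoid ring_of_type_algebra)"
    proof (rule T.add.subgroupI)
      show "\<And>a. a \<in> J \<Longrightarrow> \<ominus>\<^bsub>ring_of_type_algebra\<^esub> a \<in> J"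
        by (simp add: uminus_mem)
    qed (use zero_mem in \<open>auto simp: add_mem\<close>)
  qed (auto simp: mult_mem mult_mem_right T.ring_axioms)
qed

abbreviation gen_ideal :: "'c::comm_ring_1 set \<Rightarrow> 'c set" where
  "gen_ideal E \<equiv> Idl\<^bsub>ring_of_type_algebra\<^esub> E"

lemma ring_ideal_gen_ideal: "ring_ideal (gen_ideal E)" for E :: "'c::comm_ring_1 set"
proof -
  interpret T: cring "ring_of_type_algebra :: 'c ring" by (rule cring_from_type_algebra)
  show ?thesis
    using T.genideal_ideal[of E] by (simp add: ideal_iff_ring_ideal)
qed

lemma gen_ideal_superset: "E \<subseteq> gen_ideal E" for E :: "'c::comm_ring_1 set"
proof -
  interpret T: cring "ring_of_type_algebra :: 'c ring" by (rule cring_from_type_algebra)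
  show ?thesis
    using T.genideal_self[of E] by simp
qed

lemma gen_ideal_minimal: "ring_ideal J \<Longrightarrow> E \<subseteq> J \<Longrightarrow> gen_ideal E \<subseteq> J"
  for E :: "'c::comm_ring_1 set"
proof -
  interpret T: cring "ring_of_type_algebra :: 'c ring" by (rule cring_from_type_algebra)
  show "ring_ideal J \<Longrightarrow> E \<subseteq> J \<Longrightarrow> gen_ideal E \<subseteq> J"
    using T.genideal_minimal[of J E] by (simp add: ideal_iff_ring_ideal)
qed

lemma gen_ideal_mono: "E \<subseteq> F \<Longrightarrow> gen_ideal E \<subseteq> gen_ideal F" for E :: "'c::comm_ring_1 set"
  using gen_ideal_minimal[OF ring_ideal_gen_ideal] gen_ideal_superset by blast


text \<open>
  The value at \<open>p\<close> of the truncated series. The term of index \<open>k\<close> does not matter modulo \<open>p\<^sup>k\<close>; it is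
  included so that a constant series has its constant as value also for \<open>k = 0\<close>.
\<close>

definition approx :: "nat \<Rightarrow> nat \<Rightarrow> 'c::comm_ring_1 fps \<Rightarrow> 'c" where
  "approx p k g = (\<Sum>i\<le>k. of_nat p ^ i * fps_nth g i)"

definition poly_level :: "nat \<Rightarrow> 'c::comm_ring_1 set \<Rightarrow> nat \<Rightarrow> 'c set" where
  "poly_level p E k = {f. \<exists>e\<in>gen_ideal E. \<exists>u. f = e + of_nat p ^ k * u}"

definition level :: "nat \<Rightarrow> 'c::comm_ring_1 set \<Rightarrow> nat \<Rightarrow> 'c fps set" where
  "level p E k = {g. approx p k g \<in> poly_level p E k}"

text \<open>
  Two power series represent the same element of the completion if their difference is in this ideal.
\<close>

definition null :: "nat \<Rightarrow> 'c::comm_ring_1 set \<Rightarrow> 'c fps set" where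
  "null p E = (\<Inter>k. level p E k)"

lemma approx_add: "approx p k (g + h) = approx p k g + approx p k h"
  by (simp add: approx_def sum.distrib algebra_simps)

lemma approx_const_mult: "approx p k (fps_const a * g) = a * approx p k g"
  by (simp add: approx_def sum_distrib_left mult_ac)

lemma approx_0: "approx p k 0 = 0"
  by (simp add: approx_def)

lemma approx_1: "approx p k 1 = 1"
  by (induction k) (simp_all add: approx_def)

lemma approx_const: "approx p k (fps_const a) = a"
  using approx_const_mult[of p k a 1] by (simp add: approx_1)

lemma approx_X_mult: "approx p (Suc k) (fps_X * g) = of_nat p * approx p k g"
  unfolding approx_def
  by (subst sum.atMost_Suc_shift) (simp add: sum_distrib_left mult_ac del: sum.atMost_Suc)

lemma approx_Suc: "approx p (Suc k) g = approx p k g + of_nat p ^ Suc k * fps_nth g (Suc k)"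
  by (simp add: approx_def)

lemma approx_head_tail:
  "approx p (Suc k) (fps_const a + fps_X * g) = a + of_nat p * approx p k g"
  by (simp only: approx_add approx_const approx_X_mult)

text \<open>
  Truncation is harmless because the terms that it drops are multiples of \<open>p\<^sup>k\<close>.
\<close>

lemma approx_mult: "\<exists>w. approx p k (g * h) = approx p k g * approx p k h + of_nat p ^ k * w"
proof (induction k arbitrary: g)
  case 0
  have "approx p 0 (g * h) = approx p 0 g * approx p 0 h
      + of_nat p ^ 0 * (approx p 0 (g * h) - approx p 0 g * approx p 0 h)"
    by simp
  then show ?case by blast
next
  case (Suc k)
  obtain a g' where g: "g = fps_const a + fps_X * g'" by (rule fps_head_tailE)
  obtain w where w: "approx p k (g' * h) = approx p k g' * approx p k h + of_nat p ^ k * w"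
    using Suc.IH by blast
  have "g * h = fps_const a * h + fps_X * (g' * h)"
    by (simp add: g algebra_simps)
  then have "approx p (Suc k) (g * h)
      = a * approx p (Suc k) h + of_nat p * (approx p k g' * approx p k h + of_nat p ^ k * w)"
    by (simp only: approx_add approx_const_mult approx_X_mult w)
  also have "\<dots> = (a + of_nat p * approx p k g') * approx p (Suc k) h
      + of_nat p ^ Suc k * (w - of_nat p * approx p k g' * fps_nth h (Suc k))"
    by (simp add: approx_Suc algebra_simps)
  finally show ?case
    by (auto simp: g approx_head_tail)
qed

lemma ring_ideal_poly_level: "ring_ideal (poly_level p E k)"
proof -
  interpret G: ring_ideal "gen_ideal E" by (rule ring_ideal_gen_ideal)
  show ?thesis
  proof
    show "0 \<in> poly_level p E k"
      unfolding poly_level_def using G.zero_mem by (auto intro!: bexI[of _ 0] exI[of _ 0])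
  next
    fix x y assume "x \<in> poly_level p E k" "y \<in> poly_level p E k"
    then obtain e u e' u' where "e \<in> gen_ideal E" "e' \<in> gen_ideal E"
      "x = e + of_nat p ^ k * u" "y = e' + of_nat p ^ k * u'"
      by (auto simp: poly_level_def)
    then show "x + y \<in> poly_level p E k"
      unfolding poly_level_def
      by (auto intro!: bexI[of _ "e + e'"] exI[of _ "u + u'"] G.add_mem simp: algebra_simps)
  next
    fix x c assume "x \<in> poly_level p E k"
    then obtain e u where "e \<in> gen_ideal E" "x = e + of_nat p ^ k * u"
      by (auto simp: poly_level_def)
    then show "c * x \<in> poly_level p E k"
      unfolding poly_level_def
      by (auto intro!: bexI[of _ "c * e"] exI[of _ "c * u"] G.mult_mem simp: algebra_simps)
  qed
qed

lemma gen_ideal_poly_level: "e \<in> gen_ideal E \<Longrightarrow> e \<in> poly_level p E k"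
  unfolding poly_level_def by (auto intro!: bexI[of _ e] exI[of _ 0])

lemma power_mult_poly_level: "of_nat p ^ k * u \<in> poly_level p E k"
  unfolding poly_level_def
  using ring_ideal.zero_mem[OF ring_ideal_gen_ideal] by (auto intro!: bexI[of _ 0])

lemma ring_ideal_level: "ring_ideal (level p E k)"
proof -
  interpret P: ring_ideal "poly_level p E k" by (rule ring_ideal_poly_level)
  show ?thesis
  proof
    fix x c assume x: "x \<in> level p E k"
    obtain w where "approx p k (c * x) = approx p k c * approx p k x + of_nat p ^ k * w"
      using approx_mult by blast
    with x show "c * x \<in> level p E k"
      by (simp add: level_def P.add_mem P.mult_mem power_mult_poly_level)
  qed (auto simp: level_def approx_0 approx_add P.zero_mem P.add_mem)
qed

lemma null_subset_level: "null p E \<subseteq> level p E k"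
  by (auto simp: null_def)

lemma const_gen_level: "e \<in> gen_ideal E \<Longrightarrow> fps_const e \<in> level p E k"
  by (simp add: level_def approx_const gen_ideal_poly_level)

lemma X_minus_p_level: "fps_X - of_nat p \<in> level p E k"
proof (cases k)
  case 0
  have "approx p 0 (fps_X - of_nat p :: 'a fps) = of_nat p ^ 0 * approx p 0 (fps_X - of_nat p)"
    by simp
  then show ?thesis
    unfolding level_def mem_Collect_eq 0 by (metis power_mult_poly_level)
next
  case (Suc m)
  have "approx p (Suc m) (fps_const (- of_nat p) + fps_X * 1 :: 'a fps) = 0"
    unfolding approx_head_tail by (simp add: approx_1)
  moreover have "fps_const (- of_nat p) + fps_X * 1 = (fps_X - of_nat p :: 'a fps)"
    by (simp add: fps_of_nat[symmetric])
  ultimately show ?thesis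
    using ring_ideal.zero_mem[OF ring_ideal_poly_level] by (simp add: level_def Suc)
qed

lemma X_mult_level: "g \<in> level p E k \<Longrightarrow> fps_X * g \<in> level p E (Suc k)"
proof -
  assume "g \<in> level p E k"
  then obtain e u where "e \<in> gen_ideal E" "approx p k g = e + of_nat p ^ k * u"
    by (auto simp: level_def poly_level_def)
  then show ?thesis
    unfolding level_def poly_level_def mem_Collect_eq approx_X_mult
    by (auto intro!: bexI[of _ "of_nat p * e"] exI[of _ u] ring_ideal.mult_mem[OF ring_ideal_gen_ideal]
        simp: algebra_simps)
qed

lemma level_0: "level p E 0 = UNIV"
proof -
  have "f \<in> poly_level p E 0" for f
    using power_mult_poly_level[of p 0 f E] by simp
  then show ?thesis by (auto simp: level_def)
qed

lemma X_power_level: "fps_X ^ k * g \<in> level p E k"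
proof (induction k)
  case (Suc k)
  from X_mult_level[OF this] show ?case by (simp add: mult.assoc)
qed (simp add: level_0)

lemma ring_ideal_null: "ring_ideal (null p E)"
  unfolding null_def
  by unfold_locales
     (auto intro: ring_ideal.zero_mem[OF ring_ideal_level] ring_ideal.add_mem[OF ring_ideal_level]
        ring_ideal.mult_mem[OF ring_ideal_level])

lemma const_gen_null: "e \<in> gen_ideal E \<Longrightarrow> fps_const e \<in> null p E"
  by (simp add: null_def const_gen_level)

lemma X_minus_p_null: "fps_X - of_nat p \<in> null p E"
  by (simp add: null_def X_minus_p_level)

lemma X_cong_p: "fps_X \<approx>[null p E] of_nat p"
  by (simp add: cong_mod_def X_minus_p_null)

lemma of_nat_level: "of_nat p \<in> level p E 1"
proof -
  have "fps_X ^ 1 * 1 - (fps_X - of_nat p) \<in> level p E 1"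
    by (intro ring_ideal.diff_mem[OF ring_ideal_level] X_power_level X_minus_p_level)
  then show ?thesis by simp
qed

lemma level_mono:
  assumes "E \<subseteq> F"
  shows "level p E k \<subseteq> level p F k"
  using gen_ideal_mono[OF assms] by (force simp: level_def poly_level_def)

lemma null_mono: "E \<subseteq> F \<Longrightarrow> null p E \<subseteq> null p F"
  using level_mono[of E F p] by (auto simp: null_def)

text \<open>
  An element of the first level has the value \<open>e + p u\<close> with \<open>e\<close> in the ideal of the equations, and
  multiplication by \<open>p\<close> may be replaced by multiplication by the variable. This is what turns
  congruences modulo \<open>p\<close> into divisibility by the variable, where power series methods apply.
\<close>

lemma level_1E:
  assumes "g \<in> level p E 1"
  obtains u where "g \<approx>[null p E] fps_X * u"
proof -
  interpret N: ring_ideal "null p E" by (rule ring_ideal_null)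
  obtain a g' where g: "g = fps_const a + fps_X * g'" by (rule fps_head_tailE)
  have "approx p 1 g = a + of_nat p * approx p 0 g'"
    using approx_head_tail[of p 0 a g'] by (simp add: g)
  then obtain e u where e: "e \<in> gen_ideal E" and "a + of_nat p * approx p 0 g' = e + of_nat p * u"
    using assms by (auto simp: level_def poly_level_def)
  then have a: "a = e + of_nat p * (u - approx p 0 g')" by (simp add: algebra_simps)
  have "g - fps_X * (fps_const (u - approx p 0 g') + g')
      = fps_const e - (fps_X - of_nat p) * fps_const (u - approx p 0 g')"
    unfolding g a fps_of_nat[symmetric]
    by (simp add: algebra_simps flip: fps_const_add fps_const_mult fps_const_sub)
  also have "\<dots> \<in> null p E"
    by (intro N.diff_mem N.mult_mem_right const_gen_null e X_minus_p_null)
  finally show ?thesis by (intro that) (simp add: cong_mod_def)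
qed

lemma level_mult:
  assumes a: "a \<in> level p E 1" and b: "b \<in> level p E k"
  shows "a * b \<in> level p E (Suc k)"
proof -
  interpret L: ring_ideal "level p E (Suc k)" by (rule ring_ideal_level)
  obtain u where "a \<approx>[null p E] fps_X * u" using a by (rule level_1E)
  then have "a - fps_X * u \<in> level p E (Suc k)"
    using null_subset_level by (auto simp: cong_mod_def)
  then have "(a - fps_X * u) * b + u * (fps_X * b) \<in> level p E (Suc k)"
    by (intro L.add_mem L.mult_mem L.mult_mem_right X_mult_level b)
  then show ?thesis by (simp add: algebra_simps)
qed

lemma ideal_filtration_level: "ideal_filtration (level p E)"
  by unfold_locales
     (auto simp: level_0 level_mult[of _ p E, unfolded One_nat_def] ring_ideal.zero_mem[OF ring_ideal_level]
        ring_ideal.add_mem[OF ring_ideal_level] ring_ideal.mult_mem[OF ring_ideal_level])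

text \<open>
  Division by \<open>t - p\<close>: the polynomials \<open>t\<^sup>i - p\<^sup>i\<close> are divisible by it.
\<close>

lemma approx_remainder:
  "\<exists>a b. g - fps_const (approx p k g) = (fps_X - of_nat p) * a + fps_X ^ Suc k * b"
proof (induction k arbitrary: g)
  case 0
  obtain a g' where g: "g = fps_const a + fps_X * g'" by (rule fps_head_tailE)
  then have "g - fps_const (approx p 0 g) = (fps_X - of_nat p) * 0 + fps_X ^ Suc 0 * g'"
    by (simp add: approx_def)
  then show ?case by blast
next
  case (Suc k)
  obtain c g' where g: "g = fps_const c + fps_X * g'" by (rule fps_head_tailE)
  obtain a b where ab: "g' - fps_const (approx p k g') = (fps_X - of_nat p) * a + fps_X ^ Suc k * b"
    using Suc.IH by blast
  have "g - fps_const (approx p (Suc k) g)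
      = fps_X * (g' - fps_const (approx p k g')) + (fps_X - of_nat p) * fps_const (approx p k g')"
    unfolding g approx_head_tail fps_of_nat[symmetric]
    by (simp add: algebra_simps flip: fps_const_add fps_const_mult)
  also have "\<dots> = (fps_X - of_nat p) * (fps_X * a + fps_const (approx p k g')) + fps_X ^ Suc (Suc k) * b"
    unfolding ab by (simp add: algebra_simps)
  finally show ?case by blast
qed

text \<open>
  A power series is the sum of its truncated value, a multiple of \<open>t - p\<close> and a multiple of \<open>t\<^sup>k\<close>. The
  extension preserves the last two, and on polynomials the claim is the hypothesis on \<open>E\<close>.
\<close>

lemma fps_extend_level:
  assumes H: "ring_map H" and E: "\<And>e. e \<in> E \<Longrightarrow> H e \<in> null p F" and g: "g \<in> level p E k"
  shows "fps_extend H g \<in> level p F k"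
proof -
  interpret L: ring_ideal "level p F k" by (rule ring_ideal_level)
  have gen: "H e \<in> null p F" if "e \<in> gen_ideal E" for e
  proof -
    interpret N: ring_ideal "null p F" by (rule ring_ideal_null)
    have "ring_ideal (H -` null p F)"
      by unfold_locales (auto simp: ring_map_0[OF H] ring_map_add[OF H] ring_map_mult[OF H]
          N.zero_mem N.add_mem N.mult_mem)
    from gen_ideal_minimal[OF this] E that show ?thesis by auto
  qed
  obtain e u where e: "e \<in> gen_ideal E" and eu: "approx p k g = e + of_nat p ^ k * u"
    using g by (auto simp: level_def poly_level_def)
  obtain a b where "g - fps_const (approx p k g) = (fps_X - of_nat p) * a + fps_X ^ Suc k * b"
    using approx_remainder by blast
  then have geq: "g = fps_const (e + of_nat p ^ k * u) + (fps_X - of_nat p) * a + fps_X ^ k * (fps_X * b)"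
    by (simp add: eu algebra_simps)
  note Hx = ring_map_fps_extend[OF H]
  have "of_nat p ^ k * H u \<in> level p F k"
  proof -
    have "of_nat p ^ k * H u = fps_const (of_nat p ^ k) * H u"
      by (simp add: fps_of_nat flip: fps_const_power)
    also have "\<dots> \<in> level p F k"
      unfolding level_def mem_Collect_eq approx_const_mult by (rule power_mult_poly_level)
    finally show ?thesis .
  qed
  moreover have "H e \<in> level p F k"
    using gen[OF e] null_subset_level by blast
  moreover have "fps_extend H g = H e + of_nat p ^ k * H u
      + (fps_X - of_nat p) * fps_extend H a + fps_X ^ k * (fps_X * fps_extend H b)"
    unfolding geq by (simp only: ring_map_add[OF Hx] ring_map_mult[OF Hx] ring_map_diff[OF Hx]
        ring_map_power[OF Hx] ring_map_of_nat[OF Hx] fps_extend_const[OF H] fps_extend_X[OF H]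
        ring_map_add[OF H] ring_map_mult[OF H] ring_map_power[OF H] ring_map_of_nat[OF H])
  ultimately show ?thesis
    by (auto intro!: L.add_mem L.mult_mem_right X_power_level X_minus_p_level)
qed

text \<open>
  Continuity is automatic: a homomorphism that fixes \<open>t\<close>, and hence maps \<open>t - p\<close> and \<open>t\<^sup>k\<close> to level
  \<open>k\<close>, is determined up to level \<open>k\<close> by its values on polynomials.
\<close>

lemma hom_mod_fps_eq:
  fixes \<eta> \<eta>' :: "('v, 'a::comm_ring_1) series \<Rightarrow> 'c::comm_ring_1 fps"
  assumes h: "hom_mod (null p F) \<eta>" and h': "hom_mod (null p F) \<eta>'"
    and X: "\<eta> fps_X \<approx>[null p F] fps_X" and X': "\<eta>' fps_X \<approx>[null p F] fps_X"
    and Const: "\<And>c. \<eta> (fps_const (Const c)) \<approx>[null p F] \<eta>' (fps_const (Const c))"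
    and Var: "\<And>v. \<eta> (fps_const (Var v)) \<approx>[null p F] \<eta>' (fps_const (Var v))"
  shows "\<eta> g \<approx>[null p F] \<eta>' g"
proof -
  interpret N: ring_ideal "null p F" by (rule ring_ideal_null)
  have const: "\<eta> (fps_const f) \<approx>[null p F] \<eta>' (fps_const f)" for f
  proof (rule N.hom_mod_mpoly_eq[where h = "\<lambda>f. \<eta> (fps_const f)" and h' = "\<lambda>f. \<eta>' (fps_const f)"])
    show "hom_mod (null p F) (\<lambda>f. \<eta> (fps_const f))" "hom_mod (null p F) (\<lambda>f. \<eta>' (fps_const f))"
      using h h' by (simp_all add: hom_mod_def flip: fps_const_add fps_const_mult)
  qed (use Const Var in auto)
  have rem: "\<zeta> g - \<zeta> (fps_const (approx p k g)) \<in> level p F k"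
    if z: "hom_mod (null p F) \<zeta>" and zX: "\<zeta> fps_X \<approx>[null p F] fps_X" for \<zeta> k
  proof -
    interpret L: ring_ideal "level p F k" by (rule ring_ideal_level)
    note zk = hom_mod_mono[OF z null_subset_level[of p F k]]
    obtain a b where ab: "g = fps_const (approx p k g) + ((fps_X - of_nat p) * a + fps_X ^ k * (fps_X * b))"
      using approx_remainder[of g p k] by (auto simp: algebra_simps)
    have zX': "\<zeta> fps_X \<approx>[level p F k] fps_X"
      using zX null_subset_level by (rule cong_mod_mono)
    have "\<zeta> ((fps_X - of_nat p) * a) \<approx>[level p F k] 0"
    proof -
      have "\<zeta> ((fps_X - of_nat p) * a) \<approx>[level p F k] \<zeta> (fps_X - of_nat p) * \<zeta> a"
        by (rule L.hom_mod_mult[OF zk])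
      also have "\<dots> \<approx>[level p F k] (fps_X - of_nat p) * \<zeta> a"
        by (intro L.cong_mult L.cong_refl L.cong_trans[OF L.hom_mod_diff[OF zk]] L.cong_diff zX'
            L.hom_mod_of_nat[OF zk])
      also have "\<dots> \<approx>[level p F k] 0"
        by (simp add: cong_mod_def L.mult_mem_right X_minus_p_level)
      finally show ?thesis .
    qed
    moreover have "\<zeta> (fps_X ^ k * (fps_X * b)) \<approx>[level p F k] 0"
    proof -
      have "\<zeta> (fps_X ^ k * (fps_X * b)) \<approx>[level p F k] \<zeta> (fps_X ^ k) * \<zeta> (fps_X * b)"
        by (rule L.hom_mod_mult[OF zk])
      also have "\<dots> \<approx>[level p F k] fps_X ^ k * \<zeta> (fps_X * b)"
        by (intro L.cong_mult L.cong_refl L.cong_trans[OF L.hom_mod_power[OF zk]] L.cong_power zX')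
      also have "\<dots> \<approx>[level p F k] 0"
        by (simp add: cong_mod_def X_power_level)
      finally show ?thesis .
    qed
    ultimately have "\<zeta> (fps_const (approx p k g)) + (\<zeta> ((fps_X - of_nat p) * a) + \<zeta> (fps_X ^ k * (fps_X * b)))
        \<approx>[level p F k] \<zeta> (fps_const (approx p k g)) + (0 + 0)"
      by (intro L.cong_add L.cong_refl)
    moreover have "\<zeta> g \<approx>[level p F k]
        \<zeta> (fps_const (approx p k g)) + (\<zeta> ((fps_X - of_nat p) * a) + \<zeta> (fps_X ^ k * (fps_X * b)))"
    proof -
      have "\<zeta> (fps_const (approx p k g) + ((fps_X - of_nat p) * a + fps_X ^ k * (fps_X * b)))
        \<approx>[level p F k]
        \<zeta> (fps_const (approx p k g)) + (\<zeta> ((fps_X - of_nat p) * a) + \<zeta> (fps_X ^ k * (fps_X * b)))"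
        by (intro L.cong_trans[OF L.hom_mod_add[OF zk]] L.cong_add L.cong_refl L.hom_mod_add[OF zk])
      then show ?thesis using ab by metis
    qed
    ultimately show ?thesis
      using L.cong_trans by (fastforce simp: cong_mod_def)
  qed
  have "\<eta> g - \<eta>' g \<in> level p F k" for k
  proof -
    interpret L: ring_ideal "level p F k" by (rule ring_ideal_level)
    let ?c = "fps_const (approx p k g)"
    have "\<eta> ?c - \<eta>' ?c \<in> level p F k"
      using const[of "approx p k g"] null_subset_level[of p F k] by (auto simp: cong_mod_def)
    then have "(\<eta> g - \<eta> ?c) - (\<eta>' g - \<eta>' ?c) + (\<eta> ?c - \<eta>' ?c) \<in> level p F k"
      by (rule L.add_mem[OF L.diff_mem[OF rem[OF h X] rem[OF h' X']]])
    then show ?thesis by simp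
  qed
  then show ?thesis by (simp add: cong_mod_def null_def)
qed

text \<open>
  Modulo \<open>null\<close> the matrix \<open>M\<close> has the form \<open>1 + t N\<close>, and this has a square root among power series.
\<close>

lemma sqrt_exists:
  fixes M :: "'c::comm_ring_1 fps ^ 'n ^ 'n" and c :: "'c fps"
  assumes half: "c * 2 = 1" and M: "M \<simeq>[level p E 1] mat 1"
  obtains V where "V \<simeq>[level p E 1] mat 1" and "V ** V \<simeq>[null p E] M"
proof -
  have "\<forall>i j. \<exists>u. (M - mat 1) $ i $ j \<approx>[null p E] fps_X * u"
    using M level_1E unfolding mat_cong_def cong_mod_def vector_minus_component by metis
  then obtain n where n: "\<And>i j. (M - mat 1) $ i $ j \<approx>[null p E] fps_X * n i j"
    by metis
  define N where "N = (\<chi> i j. n i j)"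
  have MN: "mat 1 + mat fps_X ** N \<simeq>[null p E] M"
  proof -
    interpret ring_ideal "null p E" by (rule ring_ideal_null)
    show ?thesis
      unfolding mat_cong_def
    proof (intro allI)
      fix i j
      show "(mat 1 + mat fps_X ** N) $ i $ j \<approx>[null p E] M $ i $ j"
        using cong_sym[OF n[of i j]]
        by (simp add: cong_mod_def mat_mult N_def algebra_simps)
    qed
  qed
  obtain U where U: "(mat 1 + mat fps_X ** U) ** (mat 1 + mat fps_X ** U) = mat 1 + mat fps_X ** N"
    using fps_matrix_sqrt[OF half] by metis
  have "fps_X * g \<in> level p E 1" for g
    using X_power_level[of 1 g p E] by simp
  then have "mat 1 + mat fps_X ** U \<simeq>[level p E 1] mat 1"
    by (simp add: mat_cong_def cong_mod_def mat_mult)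
  then show ?thesis
    using MN U that by metis
qed

text \<open>
  Modulo \<open>null\<close> the element \<open>a\<close> has the form \<open>1 + t u\<close>, which is invertible as a power series.
\<close>

lemma unit_lift:
  assumes "a \<approx>[level p E 1] 1"
  obtains c where "c * a \<approx>[null p E] 1"
proof -
  interpret ring_ideal "null p E" by (rule ring_ideal_null)
  obtain u where "a - 1 \<approx>[null p E] fps_X * u"
    using assms level_1E unfolding cong_mod_def by metis
  from cong_add[OF this cong_refl[of 1]] have a: "a \<approx>[null p E] fps_X * u + 1" by simp
  have "(fps_X * u + 1) * fps_right_inverse (fps_X * u + 1) 1 = 1"
    by (rule fps_right_inverse) simp
  with cong_mult[OF cong_refl a] show ?thesis
    by (metis mult.commute that)
qed

section \<open>The matrix equations of a symmetric horizontal lift\<close>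

lemma matrix_uminus_mult: "(- A) ** B = - (A ** B)" "A ** (- B) = - (A ** B)"
  for A :: "'c::comm_ring_1 ^ 'n ^ 'm" and B :: "'c ^ 'k ^ 'n"
  by (simp_all add: matrix_matrix_mult_def vec_eq_iff sum_negf)

text \<open>
  The unknown \<open>Y\<close> is the matrix of images of the coordinates under a lift of Frobenius. In the
  application \<open>S\<close> is the matrix of the p-th powers of the coordinates.
\<close>

definition solves ::
    "'c::comm_ring_1 set \<Rightarrow> 'c ^ 'n ^ 'n \<Rightarrow> 'c ^ 'n ^ 'n \<Rightarrow> 'c ^ 'n ^ 'n \<Rightarrow> 'c ^ 'n ^ 'n \<Rightarrow> bool" where
  "solves J S Q B Y \<longleftrightarrow>
    transpose Y ** Q ** Y \<simeq>[J] B \<and> transpose S ** Q ** Y \<simeq>[J] transpose Y ** Q ** S"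

context
  fixes p :: nat and E :: "'c::comm_ring_1 set" and c :: "'c fps"
    and S Si Q Qi :: "'c fps ^ 'n ^ 'n"
  assumes half: "c * 2 = 1"
    and SSi: "S ** Si \<simeq>[null p E] mat 1" and SiS: "Si ** S \<simeq>[null p E] mat 1"
    and QQi: "Q ** Qi = mat 1" and QiQ: "Qi ** Q = mat 1"
begin

interpretation N: ring_ideal "null p E" by (rule ring_ideal_null)
interpretation L1: ring_ideal "level p E 1" by (rule ring_ideal_level)

private lemma null_L1: "M \<simeq>[null p E] M' \<Longrightarrow> M \<simeq>[level p E 1] M'"
  by (rule mat_cong_mono[OF _ null_subset_level])

private definition A where "A = transpose S ** Q ** S"
private definition Ai where "Ai = Si ** Qi ** transpose Si"

private lemma tSSi: "transpose Si ** transpose S \<simeq>[null p E] mat 1"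
  and tSiS: "transpose S ** transpose Si \<simeq>[null p E] mat 1"
  using N.mat_cong_transpose[OF SSi] N.mat_cong_transpose[OF SiS]
  by (simp_all add: matrix_transpose_mul)

private lemma AiA: "Ai ** A \<simeq>[null p E] mat 1"
proof -
  have "Ai ** A = (Si ** Qi) ** (transpose Si ** transpose S) ** (Q ** S)"
    by (simp add: A_def Ai_def matrix_mul_assoc)
  also have "\<dots> \<simeq>[null p E] (Si ** Qi) ** mat 1 ** (Q ** S)"
    by (intro N.mat_cong_multL N.mat_cong_multR tSSi)
  also have "(Si ** Qi) ** mat 1 ** (Q ** S) = Si ** (Qi ** Q) ** S"
    by (simp add: matrix_mul_assoc)
  also have "\<dots> \<simeq>[null p E] mat 1"
    using SiS by (simp add: QiQ)
  finally show ?thesis .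
qed

private lemma AAi: "A ** Ai \<simeq>[null p E] mat 1"
proof -
  have "A ** Ai = (transpose S ** Q) ** (S ** Si) ** (Qi ** transpose Si)"
    by (simp add: A_def Ai_def matrix_mul_assoc)
  also have "\<dots> \<simeq>[null p E] (transpose S ** Q) ** mat 1 ** (Qi ** transpose Si)"
    by (intro N.mat_cong_multL N.mat_cong_multR SSi)
  also have "(transpose S ** Q) ** mat 1 ** (Qi ** transpose Si) = transpose S ** (Q ** Qi) ** transpose Si"
    by (simp add: matrix_mul_assoc)
  also have "\<dots> \<simeq>[null p E] mat 1"
    using tSiS by (simp add: QQi)
  finally show ?thesis .
qed

text \<open>
  For a solution \<open>Z\<close> the matrix \<open>S\<^sup>-\<^sup>1 Z\<close> is congruent to 1 and a square root of \<open>A\<^sup>-\<^sup>1 B\<close>.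
\<close>

lemma normalized_solution_unique:
  assumes Y: "Y \<simeq>[level p E 1] S" "solves (null p E) S Q B Y"
    and Y': "Y' \<simeq>[level p E 1] S" "solves (null p E) S Q B Y'"
  shows "Y \<simeq>[null p E] Y'"
proof -
  have one: "Si ** Z \<simeq>[level p E 1] mat 1" if "Z \<simeq>[level p E 1] S" for Z
    using L1.mat_trans[OF L1.mat_cong_multL[OF that] null_L1[OF SiS]] .
  have square: "(Si ** Z) ** (Si ** Z) \<simeq>[null p E] Ai ** B" if Z: "solves (null p E) S Q B Z" for Z
  proof -
    have "A ** (Si ** Z) ** (Si ** Z) = transpose S ** Q ** (S ** Si) ** Z ** (Si ** Z)"
      by (simp add: A_def matrix_mul_assoc)
    also have "\<dots> \<simeq>[null p E] transpose S ** Q ** mat 1 ** Z ** (Si ** Z)"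
      by (intro N.mat_cong_multL N.mat_cong_multR SSi)
    also have "transpose S ** Q ** mat 1 ** Z ** (Si ** Z) = transpose S ** Q ** Z ** (Si ** Z)"
      by simp
    also have "\<dots> \<simeq>[null p E] transpose Z ** Q ** S ** (Si ** Z)"
      using Z by (intro N.mat_cong_multR) (simp add: solves_def)
    also have "transpose Z ** Q ** S ** (Si ** Z) = transpose Z ** Q ** (S ** Si) ** Z"
      by (simp add: matrix_mul_assoc)
    also have "\<dots> \<simeq>[null p E] transpose Z ** Q ** mat 1 ** Z"
      by (intro N.mat_cong_multL N.mat_cong_multR SSi)
    also have "transpose Z ** Q ** mat 1 ** Z = transpose Z ** Q ** Z"
      by simp
    also have "\<dots> \<simeq>[null p E] B"
      using Z by (simp add: solves_def)
    finally have B: "A ** (Si ** Z) ** (Si ** Z) \<simeq>[null p E] B" .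
    have "(Si ** Z) ** (Si ** Z) = mat 1 ** ((Si ** Z) ** (Si ** Z))"
      by simp
    also have "\<dots> \<simeq>[null p E] (Ai ** A) ** ((Si ** Z) ** (Si ** Z))"
      by (intro N.mat_cong_multR N.mat_sym[OF AiA])
    also have "(Ai ** A) ** ((Si ** Z) ** (Si ** Z)) = Ai ** (A ** (Si ** Z) ** (Si ** Z))"
      by (simp add: matrix_mul_assoc)
    also have "\<dots> \<simeq>[null p E] Ai ** B"
      by (rule N.mat_cong_multL[OF B])
    finally show ?thesis .
  qed
  have eq: "Si ** Y \<simeq>[null p E] Si ** Y'"
    using ideal_filtration.sqrt_unique[OF ideal_filtration_level half one[OF Y(1)] one[OF Y'(1)]]
      N.mat_trans[OF square[OF Y(2)] N.mat_sym[OF square[OF Y'(2)]]]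
    by (simp add: null_def)
  have recover: "Z \<simeq>[null p E] S ** (Si ** Z)" for Z
    using N.mat_cong_multR[OF N.mat_sym[OF SSi], of Z] by (simp add: matrix_mul_assoc)
  show ?thesis
    using N.mat_trans[OF recover[of Y] N.mat_trans[OF N.mat_cong_multL[OF eq] N.mat_sym[OF recover[of Y']]]] .
qed

text \<open>
  Let \<open>V\<close> be the square root of \<open>A\<^sup>-\<^sup>1 B\<close> that is congruent to 1. Then \<open>W = A\<^sup>-\<^sup>1 V\<^sup>t A\<close> is another one,
  because \<open>A\<close> and \<open>B\<close> have the same symmetry. Hence \<open>W = V\<close>, that is \<open>A V = V\<^sup>t A\<close>, and \<open>Y = S V\<close> is a
  solution.
\<close>

lemma normalized_solution_exists:
  assumes sym: "transpose Q = Q \<and> transpose B = B \<or> transpose Q = - Q \<and> transpose B = - B"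
    and B: "B \<simeq>[level p E 1] transpose S ** Q ** S"
  obtains Y where "Y \<simeq>[level p E 1] S" and "solves (null p E) S Q B Y"
proof -
  have inv_unique: "Qi' = Qi" if "Qi' ** Q = mat 1" for Qi'
    by (metis QQi that matrix_mul_assoc matrix_mul_lid matrix_mul_rid)
  have tQi: "transpose Qi ** transpose Q = mat 1"
    using QQi by (metis matrix_transpose_mul transpose_mat)
  have BAi: "transpose B ** transpose Ai = B ** Ai"
  proof -
    have tAi: "transpose Ai = Si ** transpose Qi ** transpose Si"
      by (simp add: Ai_def matrix_transpose_mul matrix_mul_assoc)
    show ?thesis
      using sym
    proof
      assume *: "transpose Q = Q \<and> transpose B = B"
      then have "transpose Qi = Qi" using tQi by (intro inv_unique) simp
      with * show ?thesis unfolding tAi by (simp add: Ai_def)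
    next
      assume *: "transpose Q = - Q \<and> transpose B = - B"
      then have "(- transpose Qi) ** Q = mat 1"
        using tQi by (simp add: matrix_uminus_mult)
      then have "- transpose Qi = Qi" by (rule inv_unique)
      then have "transpose Qi = - Qi" by (metis minus_minus)
      with * show ?thesis unfolding tAi by (simp add: Ai_def matrix_uminus_mult)
    qed
  qed
  define M where "M = Ai ** B"
  have "M \<simeq>[level p E 1] Ai ** A"
    unfolding M_def A_def by (rule L1.mat_cong_multL[OF B])
  then have "M \<simeq>[level p E 1] mat 1"
    by (rule L1.mat_trans[OF _ null_L1[OF AiA]])
  then obtain V where V1: "V \<simeq>[level p E 1] mat 1" and VV: "V ** V \<simeq>[null p E] M"
    using sqrt_exists[OF half] by blast
  define W where "W = Ai ** transpose V ** A"
  have W1: "W \<simeq>[level p E 1] mat 1"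
  proof -
    have "W \<simeq>[level p E 1] Ai ** mat 1 ** A"
      unfolding W_def using L1.mat_cong_transpose[OF V1]
      by (intro L1.mat_cong_multL L1.mat_cong_multR) simp
    also have "Ai ** mat 1 ** A \<simeq>[level p E 1] mat 1"
      using null_L1[OF AiA] by simp
    finally show ?thesis .
  qed
  have WW: "W ** W \<simeq>[null p E] M"
  proof -
    have "W ** W = Ai ** transpose V ** (A ** Ai) ** (transpose V ** A)"
      by (simp add: W_def matrix_mul_assoc)
    also have "\<dots> \<simeq>[null p E] Ai ** transpose V ** mat 1 ** (transpose V ** A)"
      by (intro N.mat_cong_multL N.mat_cong_multR AAi)
    also have "Ai ** transpose V ** mat 1 ** (transpose V ** A) = Ai ** transpose (V ** V) ** A"
      by (simp add: matrix_transpose_mul matrix_mul_assoc)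
    also have "\<dots> \<simeq>[null p E] Ai ** transpose M ** A"
      by (intro N.mat_cong_multL N.mat_cong_multR N.mat_cong_transpose VV)
    also have "Ai ** transpose M ** A = Ai ** B ** (Ai ** A)"
      unfolding M_def matrix_transpose_mul BAi by (simp add: matrix_mul_assoc)
    also have "\<dots> \<simeq>[null p E] Ai ** B ** mat 1"
      by (intro N.mat_cong_multL AiA)
    finally show ?thesis by (simp add: M_def)
  qed
  have WV: "W \<simeq>[null p E] V"
    using ideal_filtration.sqrt_unique[OF ideal_filtration_level half W1 V1]
      N.mat_trans[OF WW N.mat_sym[OF VV]]
    by (simp add: null_def)
  have comm: "A ** V \<simeq>[null p E] transpose V ** A"
  proof -
    have "A ** V \<simeq>[null p E] A ** W" by (rule N.mat_cong_multL[OF N.mat_sym[OF WV]])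
    also have "A ** W = (A ** Ai) ** (transpose V ** A)"
      by (simp add: W_def matrix_mul_assoc)
    also have "\<dots> \<simeq>[null p E] mat 1 ** (transpose V ** A)"
      by (intro N.mat_cong_multR AAi)
    finally show ?thesis by simp
  qed
  show ?thesis
  proof
    show "S ** V \<simeq>[level p E 1] S"
      using L1.mat_cong_multL[OF V1, of S] by simp
    have "transpose (S ** V) ** Q ** (S ** V) = (transpose V ** A) ** V"
      by (simp add: A_def matrix_transpose_mul matrix_mul_assoc)
    also have "\<dots> \<simeq>[null p E] (A ** V) ** V"
      by (intro N.mat_cong_multR N.mat_sym[OF comm])
    also have "(A ** V) ** V = A ** (V ** V)"
      by (simp add: matrix_mul_assoc)
    also have "\<dots> \<simeq>[null p E] A ** M"
      by (rule N.mat_cong_multL[OF VV])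
    also have "A ** M = (A ** Ai) ** B"
      by (simp add: M_def matrix_mul_assoc)
    also have "\<dots> \<simeq>[null p E] mat 1 ** B"
      by (intro N.mat_cong_multR AAi)
    finally have 1: "transpose (S ** V) ** Q ** (S ** V) \<simeq>[null p E] B" by simp
    have 2: "transpose S ** Q ** (S ** V) \<simeq>[null p E] transpose (S ** V) ** Q ** S"
      using comm by (simp add: A_def matrix_transpose_mul matrix_mul_assoc)
    show "solves (null p E) S Q B (S ** V)"
      using 1 2 by (simp add: solves_def)
  qed
qed

end


section \<open>Completions\<close>

abbreviation type_ring :: "'c::comm_ring_1 ring" where "type_ring \<equiv> ring_of_type_algebra"

definition poly_class :: "('v, 'a::comm_ring_1) mpoly set \<Rightarrow> ('v, 'a) mpoly \<Rightarrow> ('v, 'a) mpoly set" where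
  "poly_class E f = gen_ideal E +>\<^bsub>type_ring\<^esub> f"

definition level_class ::
    "nat \<Rightarrow> ('v, 'a::comm_ring_1) mpoly set \<Rightarrow> nat \<Rightarrow> ('v, 'a) mpoly \<Rightarrow> ('v, 'a) mpoly set set" where
  "level_class p E k f = padic_ideal p (coord_ring E) k +>\<^bsub>coord_ring E\<^esub> poly_class E f"

definition series_class ::
    "nat \<Rightarrow> ('v, 'a::comm_ring_1) mpoly set \<Rightarrow> ('v, 'a) series \<Rightarrow> ('v, 'a) ffun" where
  "series_class p E g = (\<lambda>k. level_class p E k (approx p k g))"

lemma poly_class_eq_iff: "poly_class E f = poly_class E g \<longleftrightarrow> f - g \<in> gen_ideal E"
proof -
  interpret G: ring_ideal "gen_ideal E" by (rule ring_ideal_gen_ideal)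
  have eq: "poly_class E f = {h. h - f \<in> gen_ideal E}" for f
    unfolding poly_class_def a_r_coset_def' by (force simp: algebra_simps)
  show ?thesis
    unfolding eq
  proof
    assume "{h. h - f \<in> gen_ideal E} = {h. h - g \<in> gen_ideal E}"
    moreover have "f \<in> {h. h - f \<in> gen_ideal E}" using G.zero_mem by simp
    ultimately show "f - g \<in> gen_ideal E" by blast
  next
    assume fg: "f - g \<in> gen_ideal E"
    show "{h. h - f \<in> gen_ideal E} = {h. h - g \<in> gen_ideal E}"
      using G.add_mem[OF _ fg] G.diff_mem[OF _ fg] by force
  qed
qed

lemma poly_class_hom: "ring_hom_cring type_ring (coord_ring E) (poly_class E)"
proof -
  interpret ideal "gen_ideal E" type_ring
    by (simp add: ideal_iff_ring_ideal ring_ideal_gen_ideal)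
  show ?thesis
    unfolding coord_ring_def poly_class_def[abs_def]
    by (rule rcos_ring_hom_cring) (rule cring_from_type_algebra)
qed

lemma carrier_coord_ring: "carrier (coord_ring E) = range (poly_class E)"
  by (auto simp: coord_ring_def FactRing_def A_RCOSETS_def' poly_class_def)

lemma cring_coord_ring: "cring (coord_ring E)"
  using poly_class_hom[of E] by (simp add: ring_hom_cring_def)

lemma ring_hom_of_nat:
  assumes "ring_hom_cring type_ring S h"
  shows "[n] \<cdot>\<^bsub>S\<^esub> \<one>\<^bsub>S\<^esub> = h (of_nat n)"
proof -
  interpret ring_hom_cring type_ring S h by fact
  show ?thesis
    using hom_zero hom_one hom_add[of 1]
    by (induction n) (simp_all add: S.add.nat_pow_Suc S.a_comm)
qed

lemma padic_ideal_coord_ring: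
  "padic_ideal p (coord_ring E) k = poly_class E ` range (\<lambda>u. of_nat p ^ k * u)"
proof -
  interpret ring_hom_cring type_ring "coord_ring E" "poly_class E" by (rule poly_class_hom)
  have "padic_ideal p (coord_ring E) k
      = {x \<otimes>\<^bsub>coord_ring E\<^esub> poly_class E (of_nat (p ^ k)) | x. x \<in> range (poly_class E)}"
    by (simp add: padic_ideal_def cgenideal_def carrier_coord_ring ring_hom_of_nat[OF poly_class_hom])
  also have "\<dots> = poly_class E ` range (\<lambda>u. of_nat p ^ k * u)"
    using hom_mult[of _ "of_nat (p ^ k)"] by (auto simp: mult.commute image_iff)
  finally show ?thesis .
qed

lemma ideal_padic_ideal: "ideal (padic_ideal p (coord_ring E) k) (coord_ring E)"
proof -
  interpret A: cring "coord_ring E" by (rule cring_coord_ring)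
  show ?thesis
    unfolding padic_ideal_def by (rule A.cgenideal_ideal) simp
qed

lemma level_class_hom:
  "ring_hom_cring type_ring (coord_ring E Quot padic_ideal p (coord_ring E) k) (level_class p E k)"
proof -
  interpret f: ring_hom_cring type_ring "coord_ring E" "poly_class E" by (rule poly_class_hom)
  interpret g: ring_hom_cring "coord_ring E" "coord_ring E Quot padic_ideal p (coord_ring E) k"
    "(+>\<^bsub>coord_ring E\<^esub>) (padic_ideal p (coord_ring E) k)"
    by (rule ideal.rcos_ring_hom_cring[OF ideal_padic_ideal cring_coord_ring])
  have "level_class p E k
      = (+>\<^bsub>coord_ring E\<^esub>) (padic_ideal p (coord_ring E) k) \<circ> poly_class E"
    by (simp add: fun_eq_iff level_class_def)
  then have "level_class p E k \<in> ring_hom type_ring (coord_ring E Quot padic_ideal p (coord_ring E) k)"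
    using ring_hom_trans[OF f.homh g.homh] by simp
  then show ?thesis
    by (intro ring_hom_cringI ring_hom_ringI2 f.R.is_cring g.S.is_cring f.R.ring_axioms g.S.ring_axioms)
qed

text \<open>
  Describing the cosets of cosets as sets of classes of polynomials makes cosets of different levels
  comparable, as the transition maps of the completion require.
\<close>

lemma level_class_eq: "level_class p E k f = poly_class E ` {g. g - f \<in> poly_level p E k}"
proof -
  interpret ring_hom_cring type_ring "coord_ring E" "poly_class E" by (rule poly_class_hom)
  have "level_class p E k f = poly_class E ` range (\<lambda>u. of_nat p ^ k * u + f)"
    unfolding level_class_def padic_ideal_coord_ring a_r_coset_def'
    using hom_add[of _ f] by auto
  also have "\<dots> = poly_class E ` {g. g - f \<in> poly_level p E k}"
  proof (intro equalityI subsetI)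
    fix x assume "x \<in> poly_class E ` range (\<lambda>u. of_nat p ^ k * u + f)"
    then show "x \<in> poly_class E ` {g. g - f \<in> poly_level p E k}"
      using power_mult_poly_level by fastforce
  next
    fix x assume "x \<in> poly_class E ` {g. g - f \<in> poly_level p E k}"
    then obtain g e u where x: "x = poly_class E g" and e: "e \<in> gen_ideal E"
      and g: "g - f = e + of_nat p ^ k * u"
      by (auto simp: poly_level_def)
    have "g - (of_nat p ^ k * u + f) = e"
      using g by (simp add: algebra_simps)
    then have "x = poly_class E (of_nat p ^ k * u + f)"
      unfolding x poly_class_eq_iff using e by simp
    then show "x \<in> poly_class E ` range (\<lambda>u. of_nat p ^ k * u + f)" by blast
  qed
  finally show ?thesis .
qed

lemma poly_class_mem_level_class: "poly_class E f \<in> level_class p E k g \<longleftrightarrow> f - g \<in> poly_level p E k"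
proof -
  interpret P: ring_ideal "poly_level p E k" by (rule ring_ideal_poly_level)
  show ?thesis
  proof
    assume "poly_class E f \<in> level_class p E k g"
    then obtain g' where "g' - g \<in> poly_level p E k" "f - g' \<in> gen_ideal E"
      by (auto simp: level_class_eq poly_class_eq_iff)
    then have "(g' - g) + (f - g') \<in> poly_level p E k"
      using P.add_mem gen_ideal_poly_level by blast
    then show "f - g \<in> poly_level p E k" by simp
  qed (auto simp: level_class_eq)
qed

lemma poly_level_Suc: "poly_level p E (Suc k) \<subseteq> poly_level p E k"
proof
  fix f assume "f \<in> poly_level p E (Suc k)"
  then obtain e u where "e \<in> gen_ideal E" "f = e + of_nat p ^ k * (of_nat p * u)"
    by (auto simp: poly_level_def algebra_simps)
  then show "f \<in> poly_level p E k" unfolding poly_level_def by blast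
qed

lemma level_class_Suc_subset_iff:
  "level_class p E (Suc k) f \<subseteq> level_class p E k g \<longleftrightarrow> f - g \<in> poly_level p E k"
proof -
  interpret P: ring_ideal "poly_level p E k" by (rule ring_ideal_poly_level)
  interpret S: ring_ideal "poly_level p E (Suc k)" by (rule ring_ideal_poly_level)
  show ?thesis
  proof
    assume sub: "level_class p E (Suc k) f \<subseteq> level_class p E k g"
    have "poly_class E f \<in> level_class p E (Suc k) f"
      unfolding poly_class_mem_level_class using S.zero_mem by simp
    with sub have "poly_class E f \<in> level_class p E k g" by blast
    then show "f - g \<in> poly_level p E k"
      unfolding poly_class_mem_level_class .
  next
    assume fg: "f - g \<in> poly_level p E k"
    show "level_class p E (Suc k) f \<subseteq> level_class p E k g"
    proof
      fix x assume "x \<in> level_class p E (Suc k) f"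
      then obtain h where x: "x = poly_class E h" and "h - f \<in> poly_level p E (Suc k)"
        by (auto simp: level_class_eq)
      then have "(h - f) + (f - g) \<in> poly_level p E k"
        using poly_level_Suc fg by (intro P.add_mem) auto
      then show "x \<in> level_class p E k g"
        unfolding x poly_class_mem_level_class by simp
    qed
  qed
qed

lemma level_class_eq_iff: "level_class p E k f = level_class p E k g \<longleftrightarrow> f - g \<in> poly_level p E k"
proof -
  interpret P: ring_ideal "poly_level p E k" by (rule ring_ideal_poly_level)
  show ?thesis
  proof
    assume eq: "level_class p E k f = level_class p E k g"
    have "poly_class E f \<in> level_class p E k f"
      unfolding poly_class_mem_level_class using P.zero_mem by simp
    then show "f - g \<in> poly_level p E k"
      unfolding eq poly_class_mem_level_class .
  next
    assume fg: "f - g \<in> poly_level p E k"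
    have "{h. h - f \<in> poly_level p E k} = {h. h - g \<in> poly_level p E k}"
      using P.add_mem[OF _ fg] P.diff_mem[OF _ fg] by force
    then show "level_class p E k f = level_class p E k g"
      unfolding level_class_eq by simp
  qed
qed

lemma series_class_eq_iff: "series_class p E g = series_class p E h \<longleftrightarrow> g \<approx>[null p E] h"
proof -
  have "approx p k (g - h) = approx p k g - approx p k h" for k
    using approx_add[of p k "g - h" h] by simp
  then show ?thesis
    by (auto simp: series_class_def fun_eq_iff level_class_eq_iff cong_mod_def null_def level_def)
qed

lemma series_class_compatible: "level_class p E (Suc k) (approx p (Suc k) g) \<subseteq> level_class p E k (approx p k g)"
proof -
  have "approx p (Suc k) g - approx p k g = of_nat p ^ k * (of_nat p * fps_nth g (Suc k))"
    by (simp add: approx_Suc algebra_simps)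
  then show ?thesis
    unfolding level_class_Suc_subset_iff using power_mult_poly_level by metis
qed

lemma carrier_level_quotient:
  "carrier (coord_ring E Quot padic_ideal p (coord_ring E) k) = range (level_class p E k)"
  by (auto simp: FactRing_def A_RCOSETS_def' level_class_def carrier_coord_ring)

text \<open>
  That every element of the completion has a representative: polynomials \<open>f\<^sub>k\<close> that represent it at
  the levels \<open>k\<close> satisfy \<open>f\<^sub>k\<^sub>+\<^sub>1 = f\<^sub>k + e\<^sub>k + p\<^sup>k u\<^sub>k\<close> with \<open>e\<^sub>k\<close> in the ideal, and the \<open>u\<^sub>k\<close> are the
  coefficients of a power series with the right value, up to the correction \<open>f\<^sub>0\<close> of the constant term.
\<close>

lemma carrier_formal_ring: "carrier (formal_ring p E) = range (series_class p E)"
proof (intro equalityI subsetI)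
  fix s assume "s \<in> range (series_class p E)"
  then show "s \<in> carrier (formal_ring p E)"
    by (auto simp: formal_ring_def padic_completion_def series_class_def carrier_level_quotient
        dest: subsetD[OF series_class_compatible])
next
  fix s assume s: "s \<in> carrier (formal_ring p E)"
  then have "\<forall>k. s k \<in> range (level_class p E k)"
    by (simp add: formal_ring_def padic_completion_def carrier_level_quotient)
  then have "\<forall>k. \<exists>f. s k = level_class p E k f" by blast
  then obtain f where f: "\<And>k. s k = level_class p E k (f k)" by metis
  have "f (Suc k) - f k \<in> poly_level p E k" for k
    using s unfolding formal_ring_def padic_completion_def
    by (simp add: f level_class_Suc_subset_iff)
  then have "\<forall>k. \<exists>e u. e \<in> gen_ideal E \<and> f (Suc k) - f k = e + of_nat p ^ k * u"
    by (force simp: poly_level_def)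
  then obtain e u where e: "\<And>k. e k \<in> gen_ideal E"
    and fS: "\<And>k. f (Suc k) - f k = e k + of_nat p ^ k * u k"
    by metis
  interpret G: ring_ideal "gen_ideal E" by (rule ring_ideal_gen_ideal)
  \<comment> \<open>The truncation of \<open>g\<close> at \<open>k\<close> has \<open>k + 1\<close> terms and thus the value of \<open>f (Suc k)\<close>.\<close>
  define g where "g = fps_const (f 0) + Abs_fps u"
  have approx: "f (Suc k) - approx p k g \<in> gen_ideal E" for k
  proof (induction k)
    case 0
    have "f (Suc 0) - approx p 0 g = e 0"
      using fS[of 0] by (simp add: approx_def g_def algebra_simps)
    with e show ?case by simp
  next
    case (Suc k)
    have "f (Suc (Suc k)) - approx p (Suc k) g = (f (Suc k) - approx p k g) + e (Suc k)"
      using fS[of "Suc k"] by (simp add: approx_Suc g_def algebra_simps)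
    with Suc e show ?case by (simp add: G.add_mem)
  qed
  have "s = series_class p E g"
  proof
    fix k
    interpret P: ring_ideal "poly_level p E k" by (rule ring_ideal_poly_level)
    have "(e k + of_nat p ^ k * u k) - (f (Suc k) - approx p k g) \<in> poly_level p E k"
      by (intro P.diff_mem P.add_mem gen_ideal_poly_level e power_mult_poly_level approx)
    then have "- ((e k + of_nat p ^ k * u k) - (f (Suc k) - approx p k g)) \<in> poly_level p E k"
      by (rule P.uminus_mem)
    then have "f k - approx p k g \<in> poly_level p E k"
      unfolding fS[symmetric] by simp
    then show "s k = series_class p E g k"
      by (simp add: f series_class_def level_class_eq_iff)
  qed
  then show "s \<in> range (series_class p E)" by blast
qed

lemma series_class_mult: "series_class p E g \<otimes>\<^bsub>formal_ring p E\<^esub> series_class p E h = series_class p E (g * h)"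
proof
  fix k
  interpret ring_hom_cring type_ring "coord_ring E Quot padic_ideal p (coord_ring E) k" "level_class p E k"
    by (rule level_class_hom)
  obtain w where "approx p k (g * h) = approx p k g * approx p k h + of_nat p ^ k * w"
    using approx_mult by blast
  then have "approx p k g * approx p k h - approx p k (g * h) = of_nat p ^ k * (- w)"
    by simp
  then have "approx p k g * approx p k h - approx p k (g * h) \<in> poly_level p E k"
    using power_mult_poly_level by metis
  then have "level_class p E k (approx p k g * approx p k h) = level_class p E k (approx p k (g * h))"
    by (simp add: level_class_eq_iff)
  then show "(series_class p E g \<otimes>\<^bsub>formal_ring p E\<^esub> series_class p E h) k = series_class p E (g * h) k"
    using hom_mult[of "approx p k g" "approx p k h"]
    by (simp add: formal_ring_def padic_completion_def series_class_def)
qed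

lemma series_class_add: "series_class p E g \<oplus>\<^bsub>formal_ring p E\<^esub> series_class p E h = series_class p E (g + h)"
proof
  fix k
  interpret ring_hom_cring type_ring "coord_ring E Quot padic_ideal p (coord_ring E) k" "level_class p E k"
    by (rule level_class_hom)
  show "(series_class p E g \<oplus>\<^bsub>formal_ring p E\<^esub> series_class p E h) k = series_class p E (g + h) k"
    using hom_add[of "approx p k g" "approx p k h"]
    by (simp add: formal_ring_def padic_completion_def series_class_def approx_add)
qed

lemma series_class_1: "\<one>\<^bsub>formal_ring p E\<^esub> = series_class p E 1"
proof
  fix k
  interpret ring_hom_cring type_ring "coord_ring E Quot padic_ideal p (coord_ring E) k" "level_class p E k"
    by (rule level_class_hom)
  show "\<one>\<^bsub>formal_ring p E\<^esub> k = series_class p E 1 k"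
    using hom_one by (simp add: formal_ring_def padic_completion_def series_class_def approx_1)
qed

lemma series_class_0: "\<zero>\<^bsub>formal_ring p E\<^esub> = series_class p E 0"
proof
  fix k
  interpret ring_hom_cring type_ring "coord_ring E Quot padic_ideal p (coord_ring E) k" "level_class p E k"
    by (rule level_class_hom)
  show "\<zero>\<^bsub>formal_ring p E\<^esub> k = series_class p E 0 k"
    using hom_zero by (simp add: formal_ring_def padic_completion_def series_class_def approx_0)
qed

lemmas series_class_simps = series_class_mult series_class_add series_class_1 series_class_0

lemma cring_formal_ring: "cring (formal_ring p E)"
proof (rule cringI)
  show "abelian_group (formal_ring p E)"
  proof (rule abelian_groupI)
    fix x assume "x \<in> carrier (formal_ring p E)"
    then obtain g where g: "x = series_class p E g" by (auto simp: carrier_formal_ring)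
    show "\<exists>y\<in>carrier (formal_ring p E). y \<oplus>\<^bsub>formal_ring p E\<^esub> x = \<zero>\<^bsub>formal_ring p E\<^esub>"
      by (auto simp: g carrier_formal_ring series_class_simps intro!: exI[of _ "- g"])
  qed (auto simp: carrier_formal_ring series_class_simps add_ac)
  show "Group.comm_monoid (formal_ring p E)"
    by (rule comm_monoidI) (auto simp: carrier_formal_ring series_class_simps mult_ac)
qed (auto simp: carrier_formal_ring series_class_simps algebra_simps)

lemma series_class_hom: "ring_hom_cring type_ring (formal_ring p E) (series_class p E)"
proof -
  interpret F: cring "formal_ring p E" by (rule cring_formal_ring)
  interpret T: cring "type_ring :: ('a, 'b) series ring" by (rule cring_from_type_algebra)
  have "series_class p E \<in> ring_hom type_ring (formal_ring p E)"
    by (rule ring_hom_memI) (auto simp: carrier_formal_ring series_class_simps)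
  then show ?thesis
    by (intro ring_hom_cringI ring_hom_ringI2 F.is_cring T.is_cring F.ring_axioms T.ring_axioms)
qed

lemma fn_eq: "fn p E f = series_class p E (fps_const f)"
  by (simp add: fun_eq_iff fn_def to_completion_def series_class_def level_class_def poly_class_def approx_const)

section \<open>Homomorphisms of formal rings given by points\<close>

abbreviation coef :: "'a::comm_ring_1 \<Rightarrow> ('v, 'a) series" where
  "coef c \<equiv> fps_const (Const c)"

abbreviation coord :: "'v \<Rightarrow> ('v, 'a::comm_ring_1) series" where
  "coord v \<equiv> fps_const (Var v)"

definition poly_eval ::
    "('a::comm_ring_1 \<Rightarrow> 'a) \<Rightarrow> ('v \<Rightarrow> ('w, 'a) series) \<Rightarrow> ('v, 'a) mpoly \<Rightarrow> ('w, 'a) series" where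
  "poly_eval \<tau> y = insertion (\<lambda>c. coef (\<tau> c)) y"

definition series_eval ::
    "('a::comm_ring_1 \<Rightarrow> 'a) \<Rightarrow> ('v \<Rightarrow> ('w, 'a) series) \<Rightarrow> ('v, 'a) series \<Rightarrow> ('w, 'a) series" where
  "series_eval \<tau> y = fps_extend (poly_eval \<tau> y)"

definition is_point ::
    "nat \<Rightarrow> ('v, 'a::comm_ring_1) mpoly set \<Rightarrow> ('w, 'a) mpoly set \<Rightarrow> ('a \<Rightarrow> 'a) \<Rightarrow>
      ('v \<Rightarrow> ('w, 'a) series) \<Rightarrow> bool" where
  "is_point p E F \<tau> y \<longleftrightarrow> (\<forall>e\<in>E. poly_eval \<tau> y e \<in> null p F)"

text \<open>
  A homomorphism is evaluated on any representative of its argument; for a point the class of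
  the result is independent of this choice.
\<close>

definition point_hom ::
    "nat \<Rightarrow> ('v, 'a::comm_ring_1) mpoly set \<Rightarrow> ('w, 'a) mpoly set \<Rightarrow> ('a \<Rightarrow> 'a) \<Rightarrow>
      ('v \<Rightarrow> ('w, 'a) series) \<Rightarrow> ('v, 'a) ffun \<Rightarrow> ('w, 'a) ffun" where
  "point_hom p E F \<tau> y =
    restrict (\<lambda>s. series_class p F (series_eval \<tau> y (SOME g. series_class p E g = s)))
      (carrier (formal_ring p E))"

lemma coef_ring_map: "ring_map (coef :: 'a::comm_ring_1 \<Rightarrow> ('v, 'a) series)"
  by (rule ring_map_comp[OF fps_const_ring_map Const_ring_map])

lemma ring_map_id: "ring_map id"
  by (simp add: ring_map_def)

context
  fixes \<tau> :: "'a::comm_ring_1 \<Rightarrow> 'a" and y :: "'v \<Rightarrow> ('w, 'a) series"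
  assumes \<tau>: "ring_map \<tau>"
begin

private lemma coef_\<tau>: "ring_map (\<lambda>c. coef (\<tau> c) :: ('w, 'a) series)"
  by (rule ring_map_comp[OF coef_ring_map \<tau>])

lemma ring_map_poly_eval: "ring_map (poly_eval \<tau> y)"
  unfolding poly_eval_def by (rule ring_map_insertion[OF coef_\<tau>])

lemma poly_eval_Const: "poly_eval \<tau> y (Const c) = coef (\<tau> c)"
  and poly_eval_Var: "poly_eval \<tau> y (Var v) = y v"
  unfolding poly_eval_def insertion_Const[OF coef_\<tau>] insertion_Var[OF coef_\<tau>] by auto

lemma poly_eval_rename_vars: "poly_eval \<tau> y (rename_vars e f) = poly_eval \<tau> (\<lambda>v. y (e v)) f"
  unfolding poly_eval_def by (rule insertion_rename_vars[OF coef_\<tau>])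

lemma ring_map_series_eval: "ring_map (series_eval \<tau> y)"
  unfolding series_eval_def by (rule ring_map_fps_extend[OF ring_map_poly_eval])

lemma series_eval_const: "series_eval \<tau> y (fps_const f) = poly_eval \<tau> y f"
  and series_eval_X: "series_eval \<tau> y fps_X = fps_X"
  unfolding series_eval_def
  by (simp_all add: fps_extend_const[OF ring_map_poly_eval] fps_extend_X[OF ring_map_poly_eval])

lemma series_eval_coef: "series_eval \<tau> y (coef c) = coef (\<tau> c)"
  and series_eval_coord: "series_eval \<tau> y (coord v) = y v"
  by (simp_all add: series_eval_const poly_eval_Const poly_eval_Var)

lemma series_eval_level:
  "is_point p E F \<tau> y \<Longrightarrow> g \<in> level p E k \<Longrightarrow> series_eval \<tau> y g \<in> level p F k"
  unfolding series_eval_def is_point_def by (intro fps_extend_level[OF ring_map_poly_eval]) auto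

lemma series_eval_null: "is_point p E F \<tau> y \<Longrightarrow> g \<in> null p E \<Longrightarrow> series_eval \<tau> y g \<in> null p F"
  using series_eval_level by (auto simp: null_def)

lemma series_eval_cong:
  "is_point p E F \<tau> y \<Longrightarrow> g \<approx>[null p E] h \<Longrightarrow> series_eval \<tau> y g \<approx>[null p F] series_eval \<tau> y h"
  using series_eval_null[of p E F "g - h"]
  by (simp add: cong_mod_def ring_map_diff[OF ring_map_series_eval])

lemma point_hom_class:
  assumes "is_point p E F \<tau> y"
  shows "point_hom p E F \<tau> y (series_class p E g) = series_class p F (series_eval \<tau> y g)"
proof -
  have "series_class p E (SOME h. series_class p E h = series_class p E g) = series_class p E g"
    by (rule someI) simp
  then have "(SOME h. series_class p E h = series_class p E g) \<approx>[null p E] g"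
    by (simp add: series_class_eq_iff)
  from series_eval_cong[OF assms this] show ?thesis
    by (simp add: point_hom_def carrier_formal_ring series_class_eq_iff rangeI)
qed

lemma point_hom_fn:
  assumes "is_point p E F \<tau> y"
  shows "point_hom p E F \<tau> y (fn p E f) = series_class p F (poly_eval \<tau> y f)"
  by (simp add: fn_eq point_hom_class[OF assms] series_eval_const)

lemma point_hom_fn_Const:
  "is_point p E F \<tau> y \<Longrightarrow> point_hom p E F \<tau> y (fn p E (Const c)) = fn p F (Const (\<tau> c))"
  unfolding fn_eq[of _ F] by (simp add: point_hom_fn poly_eval_Const)

lemma point_hom_fn_Var:
  "is_point p E F \<tau> y \<Longrightarrow> point_hom p E F \<tau> y (fn p E (Var v)) = series_class p F (y v)"
  by (simp add: point_hom_fn poly_eval_Var)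

lemma point_hom_formal_hom:
  assumes "is_point p E F \<tau> y"
  shows "point_hom p E F \<tau> y \<in> formal_hom p E F"
proof -
  note simps = carrier_formal_ring series_class_simps point_hom_class[OF assms]
    ring_map_add[OF ring_map_series_eval] ring_map_mult[OF ring_map_series_eval]
    ring_map_1[OF ring_map_series_eval]
  have "point_hom p E F \<tau> y \<in> ring_hom (formal_ring p E) (formal_ring p F)"
    by (rule ring_hom_memI) (auto simp: simps)
  then show ?thesis
    by (simp add: formal_hom_def point_hom_def)
qed

end

text \<open>
  Choose representatives of the images. The variable is congruent to the integer \<open>p\<close>, so it is fixed.
\<close>

lemma formal_hom_lift:
  assumes h: "h \<in> formal_hom p E F"
  obtains \<eta> where "\<And>g. h (series_class p E g) = series_class p F (\<eta> g)"
    and "hom_mod (null p F) \<eta>" and "\<eta> fps_X \<approx>[null p F] fps_X"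
proof -
  interpret N: ring_ideal "null p F" by (rule ring_ideal_null)
  have hom: "h \<in> ring_hom (formal_ring p E) (formal_ring p F)"
    using h by (simp add: formal_hom_def)
  have "\<forall>g. \<exists>g'. h (series_class p E g) = series_class p F g'"
    using ring_hom_closed[OF hom] by (fastforce simp: carrier_formal_ring)
  then obtain \<eta> where \<eta>: "\<And>g. h (series_class p E g) = series_class p F (\<eta> g)" by metis
  have hm: "hom_mod (null p F) \<eta>"
    using ring_hom_add[OF hom, of "series_class p E _" "series_class p E _"]
      ring_hom_mult[OF hom, of "series_class p E _" "series_class p E _"] ring_hom_one[OF hom]
    by (simp add: hom_mod_def carrier_formal_ring series_class_simps \<eta> series_class_eq_iff rangeI)
  have "\<eta> fps_X \<approx>[null p F] \<eta> (of_nat p)"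
    using X_cong_p[of p E] unfolding series_class_eq_iff[symmetric] by (metis \<eta>)
  also have "\<eta> (of_nat p) \<approx>[null p F] of_nat p" by (rule N.hom_mod_of_nat[OF hm])
  also have "of_nat p \<approx>[null p F] fps_X" by (rule N.cong_sym[OF X_cong_p])
  finally show ?thesis using that \<eta> hm by blast
qed

lemma formal_hom_eqI:
  fixes h h' :: "('v, 'a::comm_ring_1) ffun \<Rightarrow> ('w, 'a) ffun"
  assumes h: "h \<in> formal_hom p E F" and h': "h' \<in> formal_hom p E F"
    and C: "\<And>c. h (fn p E (Const c)) = h' (fn p E (Const c))"
    and V: "\<And>v. h (fn p E (Var v)) = h' (fn p E (Var v))"
  shows "h = h'"
proof -
  obtain \<eta> where \<eta>: "\<And>g. h (series_class p E g) = series_class p F (\<eta> g)" "hom_mod (null p F) \<eta>"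
    "\<eta> fps_X \<approx>[null p F] fps_X" using formal_hom_lift[OF h] by blast
  obtain \<eta>' where \<eta>': "\<And>g. h' (series_class p E g) = series_class p F (\<eta>' g)" "hom_mod (null p F) \<eta>'"
    "\<eta>' fps_X \<approx>[null p F] fps_X" using formal_hom_lift[OF h'] by blast
  have "h (series_class p E g) = h' (series_class p E g)" for g
    unfolding \<eta> \<eta>' series_class_eq_iff
    by (rule hom_mod_fps_eq[OF \<eta>(2) \<eta>'(2) \<eta>(3) \<eta>'(3)])
       (use C V in \<open>simp_all add: fn_eq \<eta> \<eta>' series_class_eq_iff\<close>)
  then show ?thesis
    using h h' by (intro extensionalityI[of _ "carrier (formal_ring p E)"])
      (auto simp: formal_hom_def carrier_formal_ring)
qed

text \<open>
  A homomorphism agrees on representatives with the evaluation at the images of the variables, so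
  these satisfy the equations because the equations represent zero.
\<close>

lemma formal_hom_is_point:
  fixes h :: "('v, 'a::comm_ring_1) ffun \<Rightarrow> ('w, 'a) ffun"
  assumes h: "h \<in> formal_hom p E F" and \<tau>: "ring_map \<tau>"
    and C: "\<And>c. h (fn p E (Const c)) = fn p F (Const (\<tau> c))"
    and V: "\<And>v. h (fn p E (Var v)) = series_class p F (y v)"
  shows "is_point p E F \<tau> y" and "h = point_hom p E F \<tau> y"
proof -
  interpret N: ring_ideal "null p F" by (rule ring_ideal_null)
  obtain \<eta> where \<eta>: "\<And>g. h (series_class p E g) = series_class p F (\<eta> g)" "hom_mod (null p F) \<eta>"
    "\<eta> fps_X \<approx>[null p F] fps_X" using formal_hom_lift[OF h] by blast
  show pt: "is_point p E F \<tau> y"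
    unfolding is_point_def
  proof
    fix e assume "e \<in> E"
    then have "fps_const e \<approx>[null p E] 0"
      using const_gen_null[of e E p] gen_ideal_superset[of E] by (auto simp: cong_mod_def)
    then have "\<eta> (fps_const e) \<approx>[null p F] \<eta> 0"
      unfolding series_class_eq_iff[symmetric] by (metis \<eta>(1))
    also have "\<eta> 0 \<approx>[null p F] 0" by (rule N.hom_mod_0[OF \<eta>(2)])
    finally have e0: "\<eta> (fps_const e) \<approx>[null p F] 0" .
    have "\<eta> (fps_const e) \<approx>[null p F] series_eval \<tau> y (fps_const e)"
      by (rule hom_mod_fps_eq[OF \<eta>(2) ring_map_hom_mod[OF ring_map_series_eval[OF \<tau>] ring_ideal_null] \<eta>(3)])
         (use C V in \<open>simp_all add: fn_eq \<eta> series_class_eq_iff series_eval_X[OF \<tau>]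
            series_eval_coef[OF \<tau>] series_eval_coord[OF \<tau>]\<close>)
    then have "series_eval \<tau> y (fps_const e) \<approx>[null p F] 0"
      using e0 N.cong_sym N.cong_trans by blast
    then show "poly_eval \<tau> y e \<in> null p F"
      by (simp add: series_eval_const[OF \<tau>] cong_mod_def)
  qed
  show "h = point_hom p E F \<tau> y"
    by (rule formal_hom_eqI[OF h point_hom_formal_hom[OF \<tau> pt]])
       (simp_all add: C V point_hom_fn_Const[OF \<tau> pt] point_hom_fn_Var[OF \<tau> pt])
qed

lemma point_hom_eq_iff:
  assumes \<tau>: "ring_map \<tau>" and y: "is_point p E F \<tau> y" and y': "is_point p E F \<tau> y'"
  shows "point_hom p E F \<tau> y = point_hom p E F \<tau> y' \<longleftrightarrow> (\<forall>v. y v \<approx>[null p F] y' v)"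
proof
  assume "point_hom p E F \<tau> y = point_hom p E F \<tau> y'"
  then have "series_class p F (y v) = series_class p F (y' v)" for v
    using point_hom_fn_Var[OF \<tau> y, of v] point_hom_fn_Var[OF \<tau> y', of v] by simp
  then show "\<forall>v. y v \<approx>[null p F] y' v" by (simp add: series_class_eq_iff)
next
  assume "\<forall>v. y v \<approx>[null p F] y' v"
  then show "point_hom p E F \<tau> y = point_hom p E F \<tau> y'"
    by (intro formal_hom_eqI[OF point_hom_formal_hom[OF \<tau> y] point_hom_formal_hom[OF \<tau> y']])
       (simp_all add: point_hom_fn_Const[OF \<tau>] point_hom_fn_Var[OF \<tau>] y y' series_class_eq_iff)
qed

text \<open>
  The two sides agree on polynomials, and on power series by induction on the precision.
\<close>

lemma series_eval_series_eval:
  assumes \<sigma>: "ring_map \<sigma>" and \<tau>: "ring_map \<tau>"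
  shows "series_eval \<sigma> z (series_eval \<tau> y g) = series_eval (\<sigma> \<circ> \<tau>) (\<lambda>v. series_eval \<sigma> z (y v)) g"
proof -
  have \<sigma>\<tau>: "ring_map (\<sigma> \<circ> \<tau>)" using ring_map_comp[OF \<sigma> \<tau>] by (simp add: o_def)
  note homs = ring_map_series_eval[OF \<sigma>, of z] ring_map_series_eval[OF \<tau>, of y]
  have const: "series_eval \<sigma> z (poly_eval \<tau> y f) = poly_eval (\<sigma> \<circ> \<tau>) (\<lambda>v. series_eval \<sigma> z (y v)) f" for f
    by (rule ring_map_mpoly_eq[OF ring_map_comp[OF homs(1) ring_map_poly_eval[OF \<tau>]] ring_map_poly_eval[OF \<sigma>\<tau>]])
       (simp_all add: poly_eval_Const[OF \<tau>] poly_eval_Const[OF \<sigma>\<tau>] poly_eval_Var[OF \<tau>]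
          poly_eval_Var[OF \<sigma>\<tau>] series_eval_coef[OF \<sigma>])
  show ?thesis
    unfolding fps_eq_iff_zero_below
  proof
    fix m
    show "series_eval \<sigma> z (series_eval \<tau> y g) - series_eval (\<sigma> \<circ> \<tau>) (\<lambda>v. series_eval \<sigma> z (y v)) g
        \<in> zero_below m"
    proof (induction m arbitrary: g)
      case (Suc m)
      obtain a g' where g: "g = fps_const a + fps_X * g'" by (rule fps_head_tailE)
      have "series_eval \<sigma> z (series_eval \<tau> y g) - series_eval (\<sigma> \<circ> \<tau>) (\<lambda>v. series_eval \<sigma> z (y v)) g
        = fps_X * (series_eval \<sigma> z (series_eval \<tau> y g')
            - series_eval (\<sigma> \<circ> \<tau>) (\<lambda>v. series_eval \<sigma> z (y v)) g')"
        unfolding g series_eval_def[of \<tau>] fps_extend_head_tail[OF ring_map_poly_eval[OF \<tau>]]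
          series_eval_def[of "\<sigma> \<circ> \<tau>"] fps_extend_head_tail[OF ring_map_poly_eval[OF \<sigma>\<tau>]]
        by (simp add: ring_map_add[OF homs(1)] ring_map_mult[OF homs(1)] series_eval_X[OF \<sigma>] const
            right_diff_distrib)
      with Suc show ?case by (simp only: X_mult_zero_below)
    qed simp
  qed
qed

lemma is_point_comp:
  assumes \<sigma>: "ring_map \<sigma>" and \<tau>: "ring_map \<tau>" and y: "is_point p E F \<tau> y" and z: "is_point p F G \<sigma> z"
  shows "is_point p E G (\<sigma> \<circ> \<tau>) (\<lambda>v. series_eval \<sigma> z (y v))"
  unfolding is_point_def
proof
  fix e assume "e \<in> E"
  with y have "series_eval \<tau> y (fps_const e) \<in> null p F"
    by (simp add: is_point_def series_eval_const[OF \<tau>])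
  from series_eval_null[OF \<sigma> z this] show "poly_eval (\<sigma> \<circ> \<tau>) (\<lambda>v. series_eval \<sigma> z (y v)) e \<in> null p G"
    unfolding series_eval_series_eval[OF \<sigma> \<tau>]
    by (simp add: series_eval_const ring_map_comp[OF \<sigma> \<tau>, folded o_def])
qed

lemma point_hom_comp:
  assumes \<sigma>: "ring_map \<sigma>" and \<tau>: "ring_map \<tau>" and y: "is_point p E F \<tau> y" and z: "is_point p F G \<sigma> z"
    and s: "s \<in> carrier (formal_ring p E)"
  shows "point_hom p F G \<sigma> z (point_hom p E F \<tau> y s)
    = point_hom p E G (\<sigma> \<circ> \<tau>) (\<lambda>v. series_eval \<sigma> z (y v)) s"
proof -
  have \<sigma>\<tau>: "ring_map (\<sigma> \<circ> \<tau>)" using ring_map_comp[OF \<sigma> \<tau>] by (simp add: o_def)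
  obtain g where "s = series_class p E g" using s by (auto simp: carrier_formal_ring)
  then show ?thesis
    by (simp add: point_hom_class[OF \<tau> y] point_hom_class[OF \<sigma> z]
        point_hom_class[OF \<sigma>\<tau> is_point_comp[OF \<sigma> \<tau> y z]] series_eval_series_eval[OF \<sigma> \<tau>])
qed

text \<open>
  The conditions of horizontality, symmetry and compatibility with \<open>c\<close> equate two composites of
  homomorphisms. Such an equation can be tested on the coordinates.
\<close>

lemma point_hom_comp_eq_iff:
  assumes \<sigma>: "ring_map \<sigma>" and \<tau>: "ring_map \<tau>" and y: "is_point p E F \<tau> y" and z: "is_point p F G \<sigma> z"
    and \<sigma>': "ring_map \<sigma>'" and \<tau>': "ring_map \<tau>'" and y': "is_point p E F' \<tau>' y'" and z': "is_point p F' G \<sigma>' z'"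
    and eq: "\<sigma> \<circ> \<tau> = \<sigma>' \<circ> \<tau>'"
  shows "(\<forall>s\<in>carrier (formal_ring p E).
      point_hom p F G \<sigma> z (point_hom p E F \<tau> y s) = point_hom p F' G \<sigma>' z' (point_hom p E F' \<tau>' y' s))
    \<longleftrightarrow> (\<forall>v. series_eval \<sigma> z (y v) \<approx>[null p G] series_eval \<sigma>' z' (y' v))"
proof -
  have \<sigma>\<tau>: "ring_map (\<sigma> \<circ> \<tau>)" using ring_map_comp[OF \<sigma> \<tau>] by (simp add: o_def)
  note pts = is_point_comp[OF \<sigma> \<tau> y z] is_point_comp[OF \<sigma>' \<tau>' y' z', folded eq]
  have ext: "point_hom p E G (\<sigma> \<circ> \<tau>) w \<in> extensional (carrier (formal_ring p E))" for w
    by (simp add: point_hom_def)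
  have "(\<forall>s\<in>carrier (formal_ring p E).
      point_hom p F G \<sigma> z (point_hom p E F \<tau> y s) = point_hom p F' G \<sigma>' z' (point_hom p E F' \<tau>' y' s))
    \<longleftrightarrow> (\<forall>s\<in>carrier (formal_ring p E). point_hom p E G (\<sigma> \<circ> \<tau>) (\<lambda>v. series_eval \<sigma> z (y v)) s
        = point_hom p E G (\<sigma> \<circ> \<tau>) (\<lambda>v. series_eval \<sigma>' z' (y' v)) s)"
    by (simp add: point_hom_comp[OF \<sigma> \<tau> y z] point_hom_comp[OF \<sigma>' \<tau>' y' z'] eq)
  also have "\<dots> \<longleftrightarrow> point_hom p E G (\<sigma> \<circ> \<tau>) (\<lambda>v. series_eval \<sigma> z (y v))
        = point_hom p E G (\<sigma> \<circ> \<tau>) (\<lambda>v. series_eval \<sigma>' z' (y' v))"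
    using extensionalityI[OF ext ext] by metis
  also have "\<dots> \<longleftrightarrow> (\<forall>v. series_eval \<sigma> z (y v) \<approx>[null p G] series_eval \<sigma>' z' (y' v))"
    by (rule point_hom_eq_iff[OF \<sigma>\<tau> pts])
  finally show ?thesis .
qed

lemma is_point_mono:
  "is_point p E F \<tau> y \<Longrightarrow> E' \<subseteq> E \<Longrightarrow> F \<subseteq> F' \<Longrightarrow> is_point p E' F' \<tau> y"
  using null_mono[of F F' p] by (auto simp: is_point_def)

lemma poly_eval_id_coord: "poly_eval id (\<lambda>v. coord (e v)) f = fps_const (rename_vars e f)"
proof -
  have rv: "ring_map (rename_vars e)"
    unfolding rename_vars_eq by (rule ring_map_insertion[OF Const_ring_map])
  show ?thesis
    by (rule ring_map_mpoly_eq[OF ring_map_poly_eval[OF ring_map_id]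
          ring_map_comp[OF fps_const_ring_map rv]])
       (simp_all add: poly_eval_Const[OF ring_map_id] poly_eval_Var[OF ring_map_id]
          rename_vars_eq insertion_Const[OF Const_ring_map] insertion_Var[OF Const_ring_map])
qed

lemma rename_vars_id: "rename_vars (\<lambda>v. v) f = f" for f :: "('v, 'a::comm_ring_1) mpoly"
proof -
  have "ring_map (\<lambda>f. f :: ('v, 'a) mpoly)" by (simp add: ring_map_def)
  then show ?thesis
    unfolding rename_vars_eq
    by (rule ring_map_mpoly_eq[where h' = "\<lambda>f. f", OF ring_map_insertion[OF Const_ring_map]])
       (simp_all add: insertion_Const[OF Const_ring_map] insertion_Var[OF Const_ring_map])
qed

text \<open>
  On representatives, restriction to a closed subscheme is the identity.
\<close>

lemma series_eval_id: "series_eval id coord g = g" for g :: "('v, 'a::comm_ring_1) series"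
proof -
  have "poly_eval id coord f = fps_const f" for f :: "('v, 'a) mpoly"
    using poly_eval_id_coord[of "\<lambda>v. v" f] by (simp add: rename_vars_id)
  then show ?thesis
    by (intro fps_ext) (simp add: series_eval_def fps_extend_nth sum.delta)
qed

lemma is_point_coord:
  fixes E F :: "('v, 'a::comm_ring_1) mpoly set"
  shows "E \<subseteq> F \<Longrightarrow> is_point p E F id coord"
proof -
  assume EF: "E \<subseteq> F"
  have "fps_const e \<in> null p F" if "e \<in> E" for e
    using that EF gen_ideal_superset[of F] by (intro const_gen_null) auto
  then show ?thesis
    by (simp add: is_point_def rename_vars_id poly_eval_id_coord[of "\<lambda>v. v"])
qed

lemma is_point_product_iff:
  assumes "ring_map \<tau>"
  shows "is_point p (product_eqs E F) G \<tau> y \<longleftrightarrow>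
    is_point p E G \<tau> (\<lambda>v. y (Inl v)) \<and> is_point p F G \<tau> (\<lambda>v. y (Inr v))"
  by (auto simp: is_point_def product_eqs_def ball_Un poly_eval_rename_vars[OF assms])

lemma is_point_Inl: "is_point p E (product_eqs E F) id (\<lambda>v. coord (Inl v))"
  and is_point_Inr: "is_point p F (product_eqs E F) id (\<lambda>v. coord (Inr v))"
  using is_point_product_iff[of id p E F "product_eqs E F" coord] is_point_coord[of "product_eqs E F"]
  by (auto simp: ring_map_id)


section \<open>Lifts of Frobenius as points\<close>

text \<open>
  The ideal generated by \<open>p\<close> in the completion is the kernel of the reduction modulo \<open>p\<close>.
\<close>

lemma principal_p_iff:
  "series_class p E d \<in> PIdl\<^bsub>formal_ring p E\<^esub> ([p] \<cdot>\<^bsub>formal_ring p E\<^esub> \<one>\<^bsub>formal_ring p E\<^esub>)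
    \<longleftrightarrow> d \<in> level p E 1"
proof -
  interpret N: ring_ideal "null p E" by (rule ring_ideal_null)
  interpret L: ring_ideal "level p E 1" by (rule ring_ideal_level)
  have "series_class p E d \<in> PIdl\<^bsub>formal_ring p E\<^esub> ([p] \<cdot>\<^bsub>formal_ring p E\<^esub> \<one>\<^bsub>formal_ring p E\<^esub>)
    \<longleftrightarrow> (\<exists>u. series_class p E d = series_class p E u \<otimes>\<^bsub>formal_ring p E\<^esub> series_class p E (of_nat p))"
    unfolding ring_hom_of_nat[OF series_class_hom]
    by (auto simp: cgenideal_def carrier_formal_ring)
  also have "\<dots> \<longleftrightarrow> (\<exists>u. d \<approx>[null p E] u * of_nat p)"
    by (simp add: series_class_mult series_class_eq_iff)
  also have "\<dots> \<longleftrightarrow> d \<in> level p E 1"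
  proof
    assume "\<exists>u. d \<approx>[null p E] u * of_nat p"
    then obtain u where "d - u * of_nat p \<in> level p E 1"
      using subsetD[OF null_subset_level[of p E 1]] unfolding cong_mod_def by blast
    then have "(d - u * of_nat p) + u * of_nat p \<in> level p E 1"
      by (intro L.add_mem L.mult_mem of_nat_level)
    then show "d \<in> level p E 1" by simp
  next
    assume "d \<in> level p E 1"
    then obtain u where "d \<approx>[null p E] fps_X * u" by (rule level_1E)
    also have "fps_X * u \<approx>[null p E] of_nat p * u"
      by (intro N.cong_mult X_cong_p N.cong_refl)
    finally show "\<exists>u. d \<approx>[null p E] u * of_nat p" by (metis mult.commute)
  qed
  finally show ?thesis .
qed

lemma series_class_Frobenius_iff:
  "series_class p E h \<ominus>\<^bsub>formal_ring p E\<^esub> series_class p E g [^]\<^bsub>formal_ring p E\<^esub> p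
     \<in> PIdl\<^bsub>formal_ring p E\<^esub> ([p] \<cdot>\<^bsub>formal_ring p E\<^esub> \<one>\<^bsub>formal_ring p E\<^esub>)
    \<longleftrightarrow> h \<approx>[level p E 1] g ^ p"
proof -
  interpret ring_hom_cring type_ring "formal_ring p E" "series_class p E" by (rule series_class_hom)
  have pow: "series_class p E g [^]\<^bsub>formal_ring p E\<^esub> n = series_class p E (g ^ n)" for n :: nat
    by (induction n) (simp_all add: series_class_simps mult.commute)
  have "series_class p E h \<ominus>\<^bsub>formal_ring p E\<^esub> series_class p E g [^]\<^bsub>formal_ring p E\<^esub> p
      = series_class p E (h - g ^ p)"
    using hom_add[of h "- (g ^ p)"] hom_a_inv[of "g ^ p"] by (simp add: a_minus_def pow)
  then show ?thesis by (simp add: principal_p_iff cong_mod_def)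
qed

text \<open>
  Both sides are homomorphisms modulo \<open>p\<close>, hence they agree on polynomials if they agree on
  constants and coordinates; the higher terms of a power series vanish modulo \<open>p\<close>.
\<close>

lemma series_eval_Frobenius:
  fixes y :: "'v \<Rightarrow> ('v, 'a::comm_ring_1) series"
  assumes p: "prime p" and \<phi>: "ring_map \<phi>" and \<phi>p: "\<And>x. of_nat p dvd \<phi> x - x ^ p"
    and y: "\<And>v. y v \<approx>[level p E 1] coord v ^ p"
  shows "series_eval \<phi> y g \<approx>[level p E 1] g ^ p"
proof -
  interpret L: ring_ideal "level p E 1" by (rule ring_ideal_level)
  note pow = L.hom_mod_Frobenius[OF p of_nat_level]
  have X: "fps_X * u \<in> level p E 1" for u
    using X_power_level[of 1] by simp
  have const: "poly_eval \<phi> y f \<approx>[level p E 1] fps_const f ^ p" for f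
  proof (rule L.hom_mod_mpoly_eq[where h' = "\<lambda>f. fps_const f ^ p"])
    show "hom_mod (level p E 1) (poly_eval \<phi> y)"
      by (rule ring_map_hom_mod[OF ring_map_poly_eval[OF \<phi>] ring_ideal_level])
    show "hom_mod (level p E 1) (\<lambda>f. fps_const f ^ p)"
      using pow unfolding hom_mod_def
      by (metis (mono_tags, lifting) fps_const_add fps_const_mult fps_const_1_eq_1)
    fix c
    obtain r where "\<phi> c - c ^ p = of_nat p * r" using \<phi>p[of c] by (auto elim: dvdE)
    then have "\<phi> c = c ^ p + of_nat p * r" by (simp add: algebra_simps)
    then have "coef (\<phi> c) - coef c ^ p = of_nat p * (coef r :: ('v, 'a) series)"
      by (simp only: ring_map_add[OF coef_ring_map] ring_map_mult[OF coef_ring_map]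
          ring_map_power[OF coef_ring_map] ring_map_of_nat[OF coef_ring_map]) simp
    then show "poly_eval \<phi> y (Const c) \<approx>[level p E 1] coef c ^ p"
      unfolding poly_eval_Const[OF \<phi>] cong_mod_def
      using L.mult_mem_right[OF of_nat_level] by metis
    fix v
    show "poly_eval \<phi> y (Var v) \<approx>[level p E 1] coord v ^ p"
      unfolding poly_eval_Var[OF \<phi>] by (rule y)
  qed
  obtain a g' where g: "g = fps_const a + fps_X * g'" by (rule fps_head_tailE)
  have p0: "p > 0" using p by (rule prime_gt_0_nat)
  have "series_eval \<phi> y g = poly_eval \<phi> y a + fps_X * series_eval \<phi> y g'"
    unfolding g series_eval_def by (rule fps_extend_head_tail[OF ring_map_poly_eval[OF \<phi>]])
  also have "\<dots> \<approx>[level p E 1] fps_const a ^ p + (fps_X * g') ^ p"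
  proof (intro L.cong_add const)
    have "(fps_X * g') ^ p \<in> level p E 1"
      using L.mult_mem_right[OF X[of g'], of "(fps_X * g') ^ (p - 1)"] p0
      by (cases p) simp_all
    then show "fps_X * series_eval \<phi> y g' \<approx>[level p E 1] (fps_X * g') ^ p"
      unfolding cong_mod_def by (rule L.diff_mem[OF X])
  qed
  also have "\<dots> \<approx>[level p E 1] g ^ p"
    unfolding g by (rule L.cong_sym[OF L.hom_mod_add[OF pow]])
  finally show ?thesis .
qed

definition lifts_power :: "nat \<Rightarrow> ('v, 'a::comm_ring_1) mpoly set \<Rightarrow> ('v \<Rightarrow> ('v, 'a) series) \<Rightarrow> bool" where
  "lifts_power p E y \<longleftrightarrow> (\<forall>v. y v \<approx>[level p E 1] coord v ^ p)"

lemma lifts_power_mono: "lifts_power p E y \<Longrightarrow> E \<subseteq> F \<Longrightarrow> lifts_power p F y"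
  using level_mono[of E F p 1] by (auto simp: lifts_power_def intro: cong_mod_mono)

lemma frobenius_lift_iff:
  fixes E :: "('v, 'a::comm_ring_1) mpoly set"
  assumes p: "prime p" and \<phi>: "ring_map \<phi>" and \<phi>p: "\<And>x. of_nat p dvd \<phi> x - x ^ p"
  shows "frobenius_lift p \<phi> E \<Phi> \<longleftrightarrow>
    (\<exists>y. is_point p E E \<phi> y \<and> lifts_power p E y \<and> \<Phi> = point_hom p E E \<phi> y)"
  unfolding lifts_power_def
proof
  assume \<Phi>: "frobenius_lift p \<phi> E \<Phi>"
  then have hom: "\<Phi> \<in> formal_hom p E E" by (simp add: frobenius_lift_def)
  obtain \<eta> where \<eta>: "\<And>g. \<Phi> (series_class p E g) = series_class p E (\<eta> g)"
    using formal_hom_lift[OF hom] by blast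
  define y where "y v = \<eta> (coord v)" for v
  have V: "\<Phi> (fn p E (Var v)) = series_class p E (y v)" for v
    by (simp add: fn_eq \<eta> y_def)
  have C: "\<Phi> (fn p E (Const c)) = fn p E (Const (\<phi> c))" for c
    using \<Phi> by (simp add: frobenius_lift_def)
  have "y v \<approx>[level p E 1] coord v ^ p" for v
  proof -
    have "fn p E (Var v) \<in> carrier (formal_ring p E)"
      by (simp add: fn_eq carrier_formal_ring rangeI)
    then show ?thesis
      using \<Phi> V[of v] unfolding frobenius_lift_def fn_eq
      by (metis series_class_Frobenius_iff)
  qed
  with formal_hom_is_point[OF hom \<phi> C V]
  show "\<exists>y. is_point p E E \<phi> y \<and> (\<forall>v. y v \<approx>[level p E 1] coord v ^ p) \<and> \<Phi> = point_hom p E E \<phi> y"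
    by blast
next
  assume "\<exists>y. is_point p E E \<phi> y \<and> (\<forall>v. y v \<approx>[level p E 1] coord v ^ p) \<and> \<Phi> = point_hom p E E \<phi> y"
  then obtain y where y: "is_point p E E \<phi> y" "\<And>v. y v \<approx>[level p E 1] coord v ^ p"
    and \<Phi>: "\<Phi> = point_hom p E E \<phi> y" by blast
  show "frobenius_lift p \<phi> E \<Phi>"
    unfolding frobenius_lift_def \<Phi>
    using series_eval_Frobenius[OF p \<phi> \<phi>p y(2)] point_hom_formal_hom[OF \<phi> y(1)]
    by (auto simp: point_hom_fn_Const[OF \<phi> y(1)] carrier_formal_ring point_hom_class[OF \<phi> y(1)]
        series_class_Frobenius_iff)
qed

section \<open>Points of closed subschemes of the general linear group\<close>

abbreviation coef_matrix :: "'a::comm_ring_1 ^ 'n ^ 'n \<Rightarrow> ('v, 'a) series ^ 'n ^ 'n" where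
  "coef_matrix \<equiv> map_matrix coef"

abbreviation power_matrix :: "nat \<Rightarrow> 'c::comm_ring_1 ^ 'n ^ 'n \<Rightarrow> 'c ^ 'n ^ 'n" where
  "power_matrix p \<equiv> map_matrix (\<lambda>a. a ^ p)"

definition coord_matrix :: "('n gl_var \<Rightarrow> 'v) \<Rightarrow> ('v, 'a::comm_ring_1) series ^ 'n ^ 'n" where
  "coord_matrix e = (\<chi> i j. coord (e (Entry i j)))"

definition entries :: "('n gl_var \<Rightarrow> 'c) \<Rightarrow> 'c ^ 'n ^ 'n" where
  "entries y = (\<chi> i j. y (Entry i j))"

definition matrix_point :: "'c ^ 'n ^ 'n \<Rightarrow> 'c \<Rightarrow> 'n gl_var \<Rightarrow> 'c" where
  "matrix_point M d v = (case v of Entry i j \<Rightarrow> M $ i $ j | DetInv \<Rightarrow> d)"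

lemma entries_matrix_point [simp]: "entries (matrix_point M d) = M"
  and matrix_point_DetInv [simp]: "matrix_point M d DetInv = d"
  by (simp_all add: entries_def matrix_point_def vec_eq_iff)

lemma fps_const_Xmat: "map_matrix fps_const (Xmat e) = coord_matrix e"
  by (simp add: map_matrix_def Xmat_def coord_matrix_def)

lemma fps_const_Cmat: "map_matrix fps_const (Cmat q) = coef_matrix q"
  by (simp add: map_matrix_def Cmat_def)

lemma entries_coord: "entries (\<lambda>v. coord (e v)) = coord_matrix e"
  by (simp add: entries_def coord_matrix_def)

lemma map_matrix_entries: "map_matrix h (entries y) = entries (\<lambda>v. h (y v))"
  by (simp add: map_matrix_def entries_def)

context
  fixes \<tau> :: "'a::comm_ring_1 \<Rightarrow> 'a" and y :: "'n::finite gl_var \<Rightarrow> ('w, 'a) series"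
  assumes \<tau>: "ring_map \<tau>"
begin

lemma poly_eval_Xmat: "map_matrix (poly_eval \<tau> y) (Xmat id) = entries y"
  by (simp add: map_matrix_def Xmat_def entries_def poly_eval_Var[OF \<tau>])

lemma poly_eval_Cmat: "map_matrix (poly_eval \<tau> y) (Cmat q) = coef_matrix (map_matrix \<tau> q)"
  by (simp add: map_matrix_def Cmat_def poly_eval_Const[OF \<tau>])

lemma series_eval_coef_matrix: "map_matrix (series_eval \<tau> y) (coef_matrix q) = coef_matrix (map_matrix \<tau> q)"
  by (simp add: map_matrix_def series_eval_coef[OF \<tau>])

lemma series_eval_coord_matrix: "map_matrix (series_eval \<tau> y) (coord_matrix id) = entries y"
  by (simp add: map_matrix_def coord_matrix_def entries_def series_eval_coord[OF \<tau>])

lemma is_point_GL_iff: "is_point p GL F \<tau> y \<longleftrightarrow> y DetInv * det (entries y) \<approx>[null p F] 1"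
proof -
  note hom = ring_map_poly_eval[OF \<tau>, of y]
  have "poly_eval \<tau> y (Var DetInv * det (Xmat id) - 1) = y DetInv * det (entries y) - 1"
    by (simp add: ring_map_diff[OF hom] ring_map_mult[OF hom] ring_map_1[OF hom] ring_map_det[OF hom]
        poly_eval_Xmat poly_eval_Var[OF \<tau>])
  then show ?thesis by (simp add: is_point_def GL_def cong_mod_def)
qed

lemma is_point_commutator_iff:
  "is_point p {(Xmat id ** Cmat w - Cmat w ** Xmat id) $ i $ j | i j. True} F \<tau> y
    \<longleftrightarrow> entries y ** coef_matrix (map_matrix \<tau> w) \<simeq>[null p F] coef_matrix (map_matrix \<tau> w) ** entries y"
proof -
  note hom = ring_map_poly_eval[OF \<tau>, of y]
  have "map_matrix (poly_eval \<tau> y) (Xmat id ** Cmat w - Cmat w ** Xmat id)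
      = entries y ** coef_matrix (map_matrix \<tau> w) - coef_matrix (map_matrix \<tau> w) ** entries y"
    unfolding poly_eval_Xmat[symmetric] poly_eval_Cmat[symmetric] ring_map_matrix_mult[OF hom, symmetric]
    by (simp add: map_matrix_def vec_eq_iff ring_map_diff[OF hom])
  then have "poly_eval \<tau> y ((Xmat id ** Cmat w - Cmat w ** Xmat id) $ i $ j)
      = (entries y ** coef_matrix (map_matrix \<tau> w) - coef_matrix (map_matrix \<tau> w) ** entries y) $ i $ j" for i j
    by (metis nth_map_matrix)
  then show ?thesis
    by (fastforce simp: is_point_def mat_cong_def cong_mod_def)
qed

end

lemma is_point_Un: "is_point p (E \<union> E') F \<tau> y \<longleftrightarrow> is_point p E F \<tau> y \<and> is_point p E' F \<tau> y"
  by (auto simp: is_point_def)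

text \<open>
  The value of the coordinate \<open>DetInv\<close> is an inverse of the determinant, and inverses are unique.
\<close>

lemma point_eq_of_entries:
  fixes y :: "'n::finite gl_var \<Rightarrow> ('w, 'a::comm_ring_1) series"
  assumes \<tau>: "ring_map \<tau>" and E: "GL \<subseteq> E" and y: "is_point p E F \<tau> y" and y': "is_point p E F \<tau> y'"
    and eq: "entries y \<simeq>[null p F] entries y'"
  shows "y v \<approx>[null p F] y' v"
proof (cases v)
  case (Entry i j)
  then show ?thesis using eq by (simp add: mat_cong_def entries_def)
next
  case DetInv
  interpret N: ring_ideal "null p F" by (rule ring_ideal_null)
  have d: "y DetInv * det (entries y) \<approx>[null p F] 1" and d': "y' DetInv * det (entries y') \<approx>[null p F] 1"
    using is_point_mono[OF y E order_refl] is_point_mono[OF y' E order_refl]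
    by (simp_all add: is_point_GL_iff[OF \<tau>])
  have "det (entries y) * y DetInv \<approx>[null p F] det (entries y') * y' DetInv"
    using N.cong_trans[OF d N.cong_sym[OF d']] by (simp add: mult.commute)
  also have "det (entries y') * y' DetInv \<approx>[null p F] det (entries y) * y' DetInv"
    by (intro N.cong_mult N.cong_refl N.cong_sym[OF N.cong_det[OF eq]])
  finally show ?thesis
    unfolding DetInv by (rule N.cong_cancel_unit[OF d])
qed

lemma matrix_map_eq:
  fixes M :: "('w, 'a::comm_ring_1) mpoly ^ 'n::finite ^ 'n"
  assumes E: "GL \<subseteq> E" and y: "is_point p E F id y" and M: "entries y = map_matrix fps_const M"
  shows "matrix_map p E F M = point_hom p E F id y"
  unfolding matrix_map_def
proof (rule the_equality)
  have yM: "y (Entry i j) = fps_const (M $ i $ j)" for i j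
    using M by (simp add: entries_def map_matrix_def vec_eq_iff)
  have V: "point_hom p E F id y (fn p E (Var (Entry i j))) = fn p F (M $ i $ j)" for i j
  proof -
    show ?thesis unfolding point_hom_fn_Var[OF ring_map_id y] unfolding fn_eq by (simp add: yM)
  qed
  then show "point_hom p E F id y \<in> formal_hom p E F \<and>
    (\<forall>c. point_hom p E F id y (fn p E (Const c)) = fn p F (Const c)) \<and>
    (\<forall>i j. point_hom p E F id y (fn p E (Var (Entry i j))) = fn p F (M $ i $ j))"
    by (simp add: point_hom_formal_hom[OF ring_map_id y] point_hom_fn_Const[OF ring_map_id y])
  fix h
  assume h: "h \<in> formal_hom p E F \<and> (\<forall>c. h (fn p E (Const c)) = fn p F (Const c)) \<and>
    (\<forall>i j. h (fn p E (Var (Entry i j))) = fn p F (M $ i $ j))"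
  then obtain \<eta> where \<eta>: "\<And>g. h (series_class p E g) = series_class p F (\<eta> g)"
    using formal_hom_lift by metis
  have hom: "h \<in> formal_hom p E F" and C: "\<And>c. h (fn p E (Const c)) = fn p F (Const (id c))"
    using h by simp_all
  have V: "\<And>v. h (fn p E (Var v)) = series_class p F (\<eta> (coord v))" by (simp add: fn_eq \<eta>)
  have z: "is_point p E F id (\<lambda>v. \<eta> (coord v))" "h = point_hom p E F id (\<lambda>v. \<eta> (coord v))"
    by (rule formal_hom_is_point[OF hom ring_map_id C V])+
  have "entries (\<lambda>v. \<eta> (coord v)) \<simeq>[null p F] entries y"
    using h by (simp add: mat_cong_def yM entries_def fn_eq \<eta> series_class_eq_iff)
  then have "\<forall>v. \<eta> (coord v) \<approx>[null p F] y v"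
    using point_eq_of_entries[OF ring_map_id E z(1) y] by blast
  then show "h = point_hom p E F id y"
    using point_hom_eq_iff[OF ring_map_id z(1) y] z(2) by metis
qed

lemma restriction_eq:
  assumes E: "GL \<subseteq> E" and EZ: "E \<subseteq> Z"
  shows "restriction p E Z = point_hom p E Z id coord"
  unfolding restriction_def
  by (rule matrix_map_eq[OF E is_point_coord[OF EZ]])
     (simp add: fps_const_Xmat entries_def coord_matrix_def)


section \<open>Induced lifts of Frobenius\<close>

locale frobenius_setting =
  fixes p :: nat and \<phi> :: "'a::comm_ring_1 \<Rightarrow> 'a"
  assumes prime: "prime p" and odd: "odd p" and \<phi>: "ring_map \<phi>"
    and \<phi>p: "\<And>x. of_nat p dvd \<phi> x - x ^ p" and half: "\<exists>c::'a. c * 2 = 1"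
begin

lemma half_series: "\<exists>c :: ('v, 'a) series. c * 2 = 1"
proof -
  obtain c :: 'a where "c * 2 = 1" using half by blast
  then have "coef c * coef 2 = (1 :: ('v, 'a) series)"
    using ring_map_mult[OF coef_ring_map] ring_map_1[OF coef_ring_map] by metis
  moreover have "coef 2 = (2 :: ('v, 'a) series)"
    using ring_map_of_nat[OF coef_ring_map, of 2] by simp
  ultimately show ?thesis by metis
qed

lemmas lift_iff = frobenius_lift_iff[OF prime \<phi> \<phi>p]

text \<open>
  The same point \<open>y\<close> describes the lift on the ambient scheme and the induced one, because restriction
  does not change representatives. Horizontality says that evaluation at \<open>y\<close> maps the power
  series that vanish on \<open>Z\<close> to such power series, which holds as soon as \<open>y\<close> satisfies the equations of \<open>Z\<close>.
\<close>

lemma horizontal_and_induced_lift: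
  fixes E Z :: "('n::finite gl_var, 'a) mpoly set"
  assumes E: "GL \<subseteq> E" and EZ: "E \<subseteq> Z"
    and y: "is_point p E E \<phi> y" and yp: "lifts_power p E y"
    and yZ: "is_point p Z Z \<phi> y"
  shows "horizontal p E Z (point_hom p E E \<phi> y)"
    and "induced_lift p \<phi> E Z (point_hom p E E \<phi> y) = point_hom p Z Z \<phi> y"
proof -
  note res = restriction_eq[OF E EZ, of p]
  have coord: "is_point p E Z id coord" by (rule is_point_coord[OF EZ])
  have res_class: "restriction p E Z (series_class p E g) = series_class p Z g" for g
    by (simp add: res point_hom_class[OF ring_map_id coord] series_eval_id)
  show "horizontal p E Z (point_hom p E E \<phi> y)"
    using series_eval_null[OF \<phi> yZ]
    by (auto simp: horizontal_def Let_def a_kernel_def' carrier_formal_ring res_class series_class_0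
        series_class_eq_iff point_hom_class[OF \<phi> y] cong_mod_def rangeI)
  show "induced_lift p \<phi> E Z (point_hom p E E \<phi> y) = point_hom p Z Z \<phi> y"
    unfolding induced_lift_def
  proof (rule the_equality)
    have "frobenius_lift p \<phi> Z (point_hom p Z Z \<phi> y)"
      using yZ lifts_power_mono[OF yp EZ] by (auto simp: lift_iff)
    then show "frobenius_lift p \<phi> Z (point_hom p Z Z \<phi> y) \<and>
      (\<forall>f\<in>carrier (formal_ring p E). point_hom p Z Z \<phi> y (restriction p E Z f)
        = restriction p E Z (point_hom p E E \<phi> y f))"
      by (auto simp: carrier_formal_ring res_class point_hom_class[OF \<phi> y] point_hom_class[OF \<phi> yZ])
    fix \<Psi>
    assume \<Psi>: "frobenius_lift p \<phi> Z \<Psi> \<and> (\<forall>f\<in>carrier (formal_ring p E).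
      \<Psi> (restriction p E Z f) = restriction p E Z (point_hom p E E \<phi> y f))"
    show "\<Psi> = point_hom p Z Z \<phi> y"
    proof (rule formal_hom_eqI)
      show "\<Psi> \<in> formal_hom p Z Z" using \<Psi> by (simp add: frobenius_lift_def)
      show "\<Psi> (fn p Z (Const c)) = point_hom p Z Z \<phi> y (fn p Z (Const c))" for c
        using \<Psi> by (simp add: frobenius_lift_def point_hom_fn_Const[OF \<phi> yZ])
      show "\<Psi> (fn p Z (Var v)) = point_hom p Z Z \<phi> y (fn p Z (Var v))" for v
      proof -
        have "series_class p E (coord v) \<in> carrier (formal_ring p E)"
          by (simp add: carrier_formal_ring rangeI)
        with \<Psi> have "\<Psi> (restriction p E Z (series_class p E (coord v)))
          = restriction p E Z (point_hom p E E \<phi> y (series_class p E (coord v)))" by blast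
        then show ?thesis
          by (simp add: res_class fn_eq point_hom_class[OF \<phi> y] point_hom_class[OF \<phi> yZ])
      qed
    qed (rule point_hom_formal_hom[OF \<phi> yZ])
  qed
qed

lemma pairing_eq:
  fixes E :: "('n::finite gl_var, 'a) mpoly set"
  assumes E: "GL \<subseteq> E" and y: "is_point p E E \<phi> y" and z: "is_point p E E \<phi> z"
  shows "pairing p E (point_hom p E E \<phi> y) (point_hom p E E \<phi> z)
    = point_hom p (product_eqs E E) E \<phi> (case_sum y z)"
    and "is_point p (product_eqs E E) E \<phi> (case_sum y z)"
proof -
  show yz: "is_point p (product_eqs E E) E \<phi> (case_sum y z)"
    by (simp add: is_point_product_iff[OF \<phi>] y z)
  have L: "matrix_map p E (product_eqs E E) (Xmat Inl)
      = point_hom p E (product_eqs E E) id (\<lambda>v. coord (Inl v))"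
    by (rule matrix_map_eq[OF E is_point_Inl]) (simp add: fps_const_Xmat entries_coord)
  have R: "matrix_map p E (product_eqs E E) (Xmat Inr)
      = point_hom p E (product_eqs E E) id (\<lambda>v. coord (Inr v))"
    by (rule matrix_map_eq[OF E is_point_Inr]) (simp add: fps_const_Xmat entries_coord)
  show "pairing p E (point_hom p E E \<phi> y) (point_hom p E E \<phi> z)
    = point_hom p (product_eqs E E) E \<phi> (case_sum y z)"
    unfolding pairing_def L R
  proof (rule the_equality)
    show "point_hom p (product_eqs E E) E \<phi> (case_sum y z) \<in> formal_hom p (product_eqs E E) E \<and>
      (\<forall>f\<in>carrier (formal_ring p E).
        point_hom p (product_eqs E E) E \<phi> (case_sum y z)
          (point_hom p E (product_eqs E E) id (\<lambda>v. coord (Inl v)) f) = point_hom p E E \<phi> y f \<and>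
        point_hom p (product_eqs E E) E \<phi> (case_sum y z)
          (point_hom p E (product_eqs E E) id (\<lambda>v. coord (Inr v)) f) = point_hom p E E \<phi> z f)"
      by (simp add: point_hom_formal_hom[OF \<phi> yz] point_hom_comp[OF \<phi> ring_map_id is_point_Inl yz]
          point_hom_comp[OF \<phi> ring_map_id is_point_Inr yz] series_eval_coord[OF \<phi>])
    fix h
    assume h: "h \<in> formal_hom p (product_eqs E E) E \<and> (\<forall>f\<in>carrier (formal_ring p E).
      h (point_hom p E (product_eqs E E) id (\<lambda>v. coord (Inl v)) f) = point_hom p E E \<phi> y f \<and>
      h (point_hom p E (product_eqs E E) id (\<lambda>v. coord (Inr v)) f) = point_hom p E E \<phi> z f)"
    have mem: "fn p E f \<in> carrier (formal_ring p E)" for f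
      by (simp add: fn_eq carrier_formal_ring rangeI)
    have InlC: "point_hom p E (product_eqs E E) id (\<lambda>v. coord (Inl v)) (fn p E (Const c))
        = fn p (product_eqs E E) (Const c)" for c
      by (simp add: point_hom_fn_Const[OF ring_map_id is_point_Inl])
    have InlV: "point_hom p E (product_eqs E E) id (\<lambda>v. coord (Inl v)) (fn p E (Var v))
        = fn p (product_eqs E E) (Var (Inl v))" for v
      unfolding point_hom_fn_Var[OF ring_map_id is_point_Inl] unfolding fn_eq ..
    have InrV: "point_hom p E (product_eqs E E) id (\<lambda>v. coord (Inr v)) (fn p E (Var v))
        = fn p (product_eqs E E) (Var (Inr v))" for v
      unfolding point_hom_fn_Var[OF ring_map_id is_point_Inr] unfolding fn_eq ..
    show "h = point_hom p (product_eqs E E) E \<phi> (case_sum y z)"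
    proof (rule formal_hom_eqI)
      show "h (fn p (product_eqs E E) (Const c))
        = point_hom p (product_eqs E E) E \<phi> (case_sum y z) (fn p (product_eqs E E) (Const c))" for c
      proof -
        have "h (fn p (product_eqs E E) (Const c)) = point_hom p E E \<phi> y (fn p E (Const c))"
          using h mem[of "Const c"] unfolding InlC[symmetric] by blast
        then show ?thesis
          by (simp add: point_hom_fn_Const[OF \<phi> y] point_hom_fn_Const[OF \<phi> yz])
      qed
      show "h (fn p (product_eqs E E) (Var v))
        = point_hom p (product_eqs E E) E \<phi> (case_sum y z) (fn p (product_eqs E E) (Var v))" for v
      proof (cases v)
        case (Inl u)
        have "h (fn p (product_eqs E E) (Var (Inl u))) = point_hom p E E \<phi> y (fn p E (Var u))"
          using h mem[of "Var u"] unfolding InlV[symmetric] by blast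
        then show ?thesis
          by (simp add: Inl point_hom_fn_Var[OF \<phi> y] point_hom_fn_Var[OF \<phi> yz])
      next
        case (Inr u)
        have "h (fn p (product_eqs E E) (Var (Inr u))) = point_hom p E E \<phi> z (fn p E (Var u))"
          using h mem[of "Var u"] unfolding InrV[symmetric] by blast
        then show ?thesis
          by (simp add: Inr point_hom_fn_Var[OF \<phi> z] point_hom_fn_Var[OF \<phi> yz])
      qed
    qed (use h point_hom_formal_hom[OF \<phi> yz] in auto)
  qed
qed

end

section \<open>The lift of Frobenius attached to a quadratic form\<close>

lemma (in ring_ideal) commutes_transpose:
  assumes W: "transpose W ** W = mat 1" "W ** transpose W = mat 1" and A: "A ** W \<simeq>[J] W ** A"
  shows "transpose A ** W \<simeq>[J] W ** transpose A"
proof -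
  have "transpose A ** W = W ** (transpose W ** transpose A) ** W"
    using W by (simp add: matrix_mul_assoc)
  also have "\<dots> \<simeq>[J] W ** (transpose A ** transpose W) ** W"
    using mat_cong_transpose[OF A] by (intro mat_cong_multR mat_cong_multL) (simp add: matrix_transpose_mul)
  also have "W ** (transpose A ** transpose W) ** W = W ** transpose A"
    using W by (simp flip: matrix_mul_assoc)
  finally show ?thesis .
qed

lemma (in ring_ideal) commutes_mult:
  assumes A: "A ** W \<simeq>[J] W ** A" and B: "B ** W \<simeq>[J] W ** B"
  shows "(A ** B) ** W \<simeq>[J] W ** (A ** B)"
proof -
  have "(A ** B) ** W \<simeq>[J] (A ** W) ** B"
    using mat_cong_multL[OF B, of A] by (simp add: matrix_mul_assoc)
  also have "(A ** W) ** B \<simeq>[J] W ** (A ** B)"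
    using mat_cong_multR[OF A, of B] by (simp add: matrix_mul_assoc)
  finally show ?thesis .
qed

lemma (in ring_ideal) commutes_conj:
  assumes "transpose W ** W = mat 1" and "A ** W \<simeq>[J] W ** A"
  shows "transpose W ** A ** W \<simeq>[J] A"
  using mat_cong_multL[OF assms(2), of "transpose W"] assms(1) by (simp add: matrix_mul_assoc)

lemma (in ring_ideal) mat_cong_map:
  assumes "A \<simeq>[J] B" and "\<And>a b. a \<approx>[J] b \<Longrightarrow> h a \<approx>[J] h b"
  shows "map_matrix h A \<simeq>[J] map_matrix h B"
  using assms by (simp add: mat_cong_def)

text \<open>
  The general linear group and the centralizer of \<open>q0\<close> are treated together: the former is the
  case \<open>w = 1\<close>, in which the commutation condition is void. The matrices \<open>1\<close> and \<open>q0\<close> are signed permutation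
  matrices, so multiplication by them commutes with raising the entries to an odd power.
\<close>

locale centralizer_setting = frobenius_setting p \<phi> for p and \<phi> :: "'a::comm_ring_1 \<Rightarrow> 'a" +
  fixes w :: "'a ^ 'n::finite ^ 'n" and E :: "('n gl_var, 'a) mpoly set"
  assumes E: "E = GL \<and> w = mat 1 \<or>
      E = GL \<union> {(Xmat id ** Cmat w - Cmat w ** Xmat id) $ i $ j | i j. True}"
    and orthogonal: "transpose w ** w = mat 1" "w ** transpose w = mat 1"
    and \<phi>w: "map_matrix \<phi> w = w"
    and power_w: "\<And>M :: ('n gl_var, 'a) series ^ 'n ^ 'n.
        power_matrix p (M ** coef_matrix w) = power_matrix p M ** coef_matrix w"
      "\<And>M :: ('n gl_var, 'a) series ^ 'n ^ 'n.
        power_matrix p (coef_matrix w ** M) = coef_matrix w ** power_matrix p M"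
begin

lemma GL_subset: "GL \<subseteq> E"
  using E by auto

lemma is_point_iff:
  assumes \<tau>: "ring_map \<tau>" and w: "map_matrix \<tau> w = w"
  shows "is_point p E F \<tau> y \<longleftrightarrow> y DetInv * det (entries y) \<approx>[null p F] 1 \<and>
    entries y ** coef_matrix w \<simeq>[null p F] coef_matrix w ** entries y"
  using E
proof
  interpret ring_ideal "null p F" by (rule ring_ideal_null)
  assume "E = GL \<and> w = mat 1"
  then show ?thesis
    by (simp add: is_point_GL_iff[OF \<tau>] ring_map_matrix_1[OF coef_ring_map])
next
  assume "E = GL \<union> {(Xmat id ** Cmat w - Cmat w ** Xmat id) $ i $ j | i j. True}"
  then show ?thesis
    by (simp only: is_point_Un is_point_GL_iff[OF \<tau>] is_point_commutator_iff[OF \<tau>] w)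
qed

abbreviation x :: "('n gl_var, 'a) series ^ 'n ^ 'n" where "x \<equiv> coord_matrix id"
abbreviation x0 :: "('n gl_var, 'a) series ^ 'n ^ 'n" where "x0 \<equiv> power_matrix p x"
abbreviation quad :: "'a ^ 'n ^ 'n \<Rightarrow> ('n gl_var, 'a) series ^ 'n ^ 'n" where
  "quad q \<equiv> transpose x ** coef_matrix q ** x"
abbreviation \<phi>coef :: "'a ^ 'n ^ 'n \<Rightarrow> ('n gl_var, 'a) series ^ 'n ^ 'n" where
  "\<phi>coef q \<equiv> coef_matrix (map_matrix \<phi> q)"
abbreviation solution :: "'a ^ 'n ^ 'n \<Rightarrow> ('n gl_var, 'a) series ^ 'n ^ 'n \<Rightarrow> bool" where
  "solution q \<equiv> solves (null p E) x0 (\<phi>coef q) (power_matrix p (quad q))"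

lemma map_matrix_id: "map_matrix id M = M"
  by (simp add: map_matrix_def vec_eq_iff)

lemma orthogonal_coef:
  "transpose (coef_matrix w) ** coef_matrix w = (mat 1 :: ('v, 'a) series ^ 'n ^ 'n)"
  "coef_matrix w ** transpose (coef_matrix w) = (mat 1 :: ('v, 'a) series ^ 'n ^ 'n)"
  by (simp_all add: transpose_map_matrix orthogonal ring_map_matrix_1[OF coef_ring_map]
      flip: ring_map_matrix_mult[OF coef_ring_map])

lemma x_commutes: "x ** coef_matrix w \<simeq>[null p E] coef_matrix w ** x"
  and DetInv_det: "coord DetInv * det x \<approx>[null p E] 1"
  using is_point_iff[OF ring_map_id map_matrix_id, of E coord] is_point_coord[of E E p]
  by (simp_all add: entries_coord[of "\<lambda>v. v"] id_def)

lemma x0_commutes: "x0 ** coef_matrix w \<simeq>[null p E] coef_matrix w ** x0"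
proof -
  interpret N: ring_ideal "null p E" by (rule ring_ideal_null)
  show ?thesis
    unfolding power_w[symmetric] by (rule N.mat_cong_map[OF x_commutes N.cong_power])
qed

lemma coef_commutes:
  assumes "q ** w = w ** q"
  shows "coef_matrix q ** coef_matrix w = coef_matrix w ** coef_matrix q"
    and "\<phi>coef q ** coef_matrix w = coef_matrix w ** \<phi>coef q"
proof -
  have "map_matrix \<phi> q ** w = w ** map_matrix \<phi> q"
    using arg_cong[OF assms, of "map_matrix \<phi>"] by (simp add: ring_map_matrix_mult[OF \<phi>] \<phi>w)
  with assms show "coef_matrix q ** coef_matrix w = coef_matrix w ** coef_matrix q"
    "\<phi>coef q ** coef_matrix w = coef_matrix w ** \<phi>coef q"
    by (simp_all flip: ring_map_matrix_mult[OF coef_ring_map])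
qed

lemma quad_commutes:
  assumes q: "q ** w = w ** q"
  shows "quad q ** coef_matrix w \<simeq>[null p E] coef_matrix w ** quad q"
    and "power_matrix p (quad q) ** coef_matrix w \<simeq>[null p E] coef_matrix w ** power_matrix p (quad q)"
proof -
  interpret N: ring_ideal "null p E" by (rule ring_ideal_null)
  show "quad q ** coef_matrix w \<simeq>[null p E] coef_matrix w ** quad q"
    by (intro N.commutes_mult N.commutes_transpose[OF orthogonal_coef] x_commutes)
       (simp add: coef_commutes(1)[OF q])
  then show "power_matrix p (quad q) ** coef_matrix w \<simeq>[null p E] coef_matrix w ** power_matrix p (quad q)"
    unfolding power_w[symmetric] by (rule N.mat_cong_map[OF _ N.cong_power])
qed

lemma power_hom: "hom_mod (level p E 1) (\<lambda>a. a ^ p)"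
  by (rule ring_ideal.hom_mod_Frobenius[OF ring_ideal_level prime of_nat_level])

text \<open>
  Modulo \<open>p\<close> the determinant of the matrix of p-th powers is the p-th power of the determinant.
\<close>

lemma det_near_x0:
  assumes M: "M \<simeq>[level p E 1] x0"
  shows "coord DetInv ^ p * det M \<approx>[level p E 1] 1"
proof -
  interpret L: ring_ideal "level p E 1" by (rule ring_ideal_level)
  have "coord DetInv ^ p * det M \<approx>[level p E 1] coord DetInv ^ p * det x0"
    by (intro L.cong_mult L.cong_refl L.cong_det M)
  also have "coord DetInv ^ p * det x0 \<approx>[level p E 1] coord DetInv ^ p * det x ^ p"
    by (intro L.cong_mult L.cong_refl L.cong_sym[OF L.hom_mod_det[OF power_hom]])
  also have "coord DetInv ^ p * det x ^ p = (coord DetInv * det x) ^ p"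
    by (rule power_mult_distrib[symmetric])
  also have "\<dots> \<approx>[level p E 1] 1 ^ p"
    by (intro L.cong_power cong_mod_mono[OF DetInv_det null_subset_level])
  finally show ?thesis by simp
qed

text \<open>
  The determinant of \<open>M\<close> is a unit modulo \<open>p\<close>, hence a unit; its inverse is the value of \<open>DetInv\<close>.
\<close>

lemma frobenius_point:
  assumes M: "M \<simeq>[level p E 1] x0" and MW: "M ** coef_matrix w \<simeq>[null p E] coef_matrix w ** M"
  obtains y where "is_point p E E \<phi> y" "entries y = M" "lifts_power p E y"
proof -
  interpret N: ring_ideal "null p E" by (rule ring_ideal_null)
  interpret L: ring_ideal "level p E 1" by (rule ring_ideal_level)
  obtain c where c: "c * (coord DetInv ^ p * det M) \<approx>[null p E] 1"
    using unit_lift[OF det_near_x0[OF M]] by blast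
  define d where "d = c * coord DetInv ^ p"
  have d: "d * det M \<approx>[null p E] 1" using c by (simp add: d_def mult.assoc)
  show ?thesis
  proof (rule that)
    show "is_point p E E \<phi> (matrix_point M d)"
      by (simp add: is_point_iff[OF \<phi> \<phi>w] d MW)
    show "entries (matrix_point M d) = M" by simp
    have "1 * d \<approx>[level p E 1] (coord DetInv ^ p * det M) * d"
      by (intro L.cong_mult L.cong_refl L.cong_sym[OF det_near_x0[OF M]])
    also have "(coord DetInv ^ p * det M) * d = coord DetInv ^ p * (d * det M)"
      by (simp add: mult_ac)
    also have "\<dots> \<approx>[level p E 1] coord DetInv ^ p * 1"
      by (intro L.cong_mult L.cong_refl cong_mod_mono[OF d null_subset_level])
    finally have dp: "d \<approx>[level p E 1] coord DetInv ^ p" by simp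
    have "matrix_point M d v \<approx>[level p E 1] coord v ^ p" for v
    proof (cases v)
      case (Entry i j)
      have "M $ i $ j \<approx>[level p E 1] x0 $ i $ j" using M by (simp add: mat_cong_def)
      moreover have "x0 $ i $ j = coord (Entry i j) ^ p" by (simp add: coord_matrix_def)
      ultimately show ?thesis unfolding Entry matrix_point_def by simp
    qed (use dp in simp)
    then show "lifts_power p E (matrix_point M d)" by (simp add: lifts_power_def)
  qed
qed

text \<open>
  With \<open>y = z\<close> this yields the quadratic map, and with the two coordinate points of the product it
  yields the bilinear map.
\<close>

lemma bilinear_point:
  assumes q: "invertible q" "q ** w = w ** q"
    and y: "is_point p E F id y" and z: "is_point p E F id z"
  obtains b where "is_point p E F id b" "entries b = transpose (entries y) ** coef_matrix q ** entries z"
proof -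
  interpret N: ring_ideal "null p F" by (rule ring_ideal_null)
  obtain qi where qi: "qi ** q = mat 1" using q(1) by (auto simp: invertible_def)
  note y' = y[unfolded is_point_iff[OF ring_map_id map_matrix_id]]
  note z' = z[unfolded is_point_iff[OF ring_map_id map_matrix_id]]
  define M where "M = transpose (entries y) ** coef_matrix q ** entries z"
  define d where "d = y DetInv * det (coef_matrix qi) * z DetInv"
  have "det (coef_matrix qi) * det (coef_matrix q) = (1 :: ('b, 'a) series)"
    by (simp add: qi ring_map_matrix_1[OF coef_ring_map]
        flip: det_mul ring_map_matrix_mult[OF coef_ring_map])
  then have "d * det M = (y DetInv * det (entries y)) * 1 * (z DetInv * det (entries z))"
    by (simp add: d_def M_def det_mul algebra_simps)
  also have "\<dots> \<approx>[null p F] 1 * 1 * 1"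
    using y' z' by (intro N.cong_mult) auto
  finally have d: "d * det M \<approx>[null p F] 1" by simp
  have "M ** coef_matrix w \<simeq>[null p F] coef_matrix w ** M"
    unfolding M_def using y' z'
    by (intro N.commutes_mult N.commutes_transpose[OF orthogonal_coef])
       (simp_all add: coef_commutes(1)[OF q(2)])
  with d have "is_point p E F id (matrix_point M d)"
    by (simp add: is_point_iff[OF ring_map_id map_matrix_id])
  then show ?thesis by (rule that) (simp add: M_def)
qed

lemma solution_context:
  assumes q: "invertible q"
  obtains c :: "('n gl_var, 'a) series" and Si Qi where "c * 2 = 1"
    "x0 ** Si \<simeq>[null p E] mat 1" "Si ** x0 \<simeq>[null p E] mat 1"
    "\<phi>coef q ** Qi = mat 1" "Qi ** \<phi>coef q = mat 1"
proof -
  interpret N: ring_ideal "null p E" by (rule ring_ideal_null)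
  interpret L: ring_ideal "level p E 1" by (rule ring_ideal_level)
  obtain c :: "('n gl_var, 'a) series" where c: "c * 2 = 1" using half_series by blast
  obtain u where "u * (coord DetInv ^ p * det x0) \<approx>[null p E] 1"
    using unit_lift[OF det_near_x0[OF L.mat_refl]] by blast
  then have "(u * coord DetInv ^ p) * det x0 \<approx>[null p E] 1" by (simp add: mult.assoc)
  then obtain Si where Si: "x0 ** Si \<simeq>[null p E] mat 1" "Si ** x0 \<simeq>[null p E] mat 1"
    by (rule N.inverse_mod)
  obtain qi where qi: "q ** qi = mat 1" "qi ** q = mat 1" using q by (auto simp: invertible_def)
  have "\<phi>coef a ** \<phi>coef b = (mat 1 :: ('n gl_var, 'a) series ^ 'n ^ 'n)" if "a ** b = mat 1" for a b
    using that by (simp add: ring_map_matrix_1[OF coef_ring_map] ring_map_matrix_1[OF \<phi>]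
        flip: ring_map_matrix_mult[OF coef_ring_map] ring_map_matrix_mult[OF \<phi>])
  from this[OF qi(1)] this[OF qi(2)] show ?thesis
    by (rule that[OF c Si])
qed

lemma solution_unique:
  assumes q: "invertible q"
    and Y: "Y \<simeq>[level p E 1] x0" "solution q Y" and Y': "Y' \<simeq>[level p E 1] x0" "solution q Y'"
  shows "Y \<simeq>[null p E] Y'"
proof -
  obtain c :: "('n gl_var, 'a) series" and Si Qi where "c * 2 = 1"
    "x0 ** Si \<simeq>[null p E] mat 1" "Si ** x0 \<simeq>[null p E] mat 1"
    "\<phi>coef q ** Qi = mat 1" "Qi ** \<phi>coef q = mat 1" by (rule solution_context[OF q])
  from normalized_solution_unique[OF this Y Y'] show ?thesis .
qed

lemma coef_power_cong: "coef c ^ p \<approx>[level p E 1] coef (\<phi> c)"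
proof -
  interpret L: ring_ideal "level p E 1" by (rule ring_ideal_level)
  have "series_eval \<phi> (\<lambda>v. coord v ^ p) (coef c) \<approx>[level p E 1] coef c ^ p"
    by (rule series_eval_Frobenius[OF prime \<phi> \<phi>p L.cong_refl])
  from L.cong_sym[OF this] show ?thesis by (simp only: series_eval_coef[OF \<phi>])
qed

lemma solution_exists:
  assumes q: "invertible q" and sym: "transpose q = q \<or> transpose q = - q"
  obtains Y where "Y \<simeq>[level p E 1] x0" "solution q Y"
proof -
  interpret L: ring_ideal "level p E 1" by (rule ring_ideal_level)
  obtain c :: "('n gl_var, 'a) series" and Si Qi where ctxt: "c * 2 = 1"
    "x0 ** Si \<simeq>[null p E] mat 1" "Si ** x0 \<simeq>[null p E] mat 1"
    "\<phi>coef q ** Qi = mat 1" "Qi ** \<phi>coef q = mat 1" by (rule solution_context[OF q])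
  have neg: "map_matrix h (- M) = - map_matrix h M" if "\<And>a. h (- a) = - h a"
    for h :: "'b::comm_ring_1 \<Rightarrow> 'c::comm_ring_1" and M :: "'b ^ 'n ^ 'n"
    using that by (simp add: map_matrix_def vec_eq_iff)
  have negs: "\<phi>coef (- q) = - \<phi>coef q" "coef_matrix (- q) = - (coef_matrix q :: ('n gl_var, 'a) series ^ 'n ^ 'n)"
    "power_matrix p (- M) = - power_matrix p M" for M :: "('n gl_var, 'a) series ^ 'n ^ 'n"
    using odd by (simp_all add: neg[of \<phi>, OF ring_map_uminus[OF \<phi>]]
        neg[of "coef :: 'a \<Rightarrow> ('n gl_var, 'a) series", OF ring_map_uminus[OF coef_ring_map]]
        neg[of "\<lambda>a. a ^ p"])
  have symQ: "transpose (\<phi>coef q) = \<phi>coef q \<and> transpose (power_matrix p (quad q)) = power_matrix p (quad q) \<or>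
      transpose (\<phi>coef q) = - \<phi>coef q \<and> transpose (power_matrix p (quad q)) = - power_matrix p (quad q)"
  proof -
    have t: "transpose (\<phi>coef q) = \<phi>coef (transpose q)"
      "transpose (power_matrix p (quad q)) = power_matrix p (quad (transpose q))"
      by (simp_all only: transpose_map_matrix matrix_transpose_mul transpose_transpose matrix_mul_assoc)
    have quad_neg: "quad (- q) = - quad q"
      by (simp only: negs matrix_uminus_mult)
    from sym show ?thesis
    proof
      assume *: "transpose q = q"
      show ?thesis unfolding t * by simp
    next
      assume *: "transpose q = - q"
      show ?thesis unfolding t * negs(1) quad_neg negs(3) by simp
    qed
  qed
  have B: "power_matrix p (quad q) \<simeq>[level p E 1] transpose x0 ** \<phi>coef q ** x0"
  proof -
    have q\<phi>: "power_matrix p (coef_matrix q) \<simeq>[level p E 1] \<phi>coef q"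
      using coef_power_cong unfolding mat_cong_def nth_map_matrix by blast
    have "power_matrix p (quad q) \<simeq>[level p E 1] power_matrix p (transpose x ** coef_matrix q) ** x0"
      by (rule L.hom_mod_matrix_mult[OF power_hom])
    also have "\<dots> \<simeq>[level p E 1] (transpose x0 ** power_matrix p (coef_matrix q)) ** x0"
      unfolding transpose_map_matrix by (intro L.mat_cong_multR L.hom_mod_matrix_mult[OF power_hom])
    also have "\<dots> \<simeq>[level p E 1] transpose x0 ** \<phi>coef q ** x0"
      by (intro L.mat_cong_multR L.mat_cong_multL q\<phi>)
    finally show ?thesis .
  qed
  from normalized_solution_exists[OF ctxt symQ B] that show ?thesis by blast
qed

text \<open>
  Since \<open>x\<^sub>0\<close>, \<open>Q\<close> and \<open>B\<close> commute with the orthogonal matrix \<open>w\<close>, the conjugate of \<open>Y\<close> by \<open>w\<close> is a solution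
  as well, and solutions are unique.
\<close>

lemma solution_commutes:
  assumes q: "invertible q" "q ** w = w ** q" and Y: "Y \<simeq>[level p E 1] x0" "solution q Y"
  shows "Y ** coef_matrix w \<simeq>[null p E] coef_matrix w ** Y"
proof -
  interpret N: ring_ideal "null p E" by (rule ring_ideal_null)
  interpret L: ring_ideal "level p E 1" by (rule ring_ideal_level)
  define W :: "('n gl_var, 'a) series ^ 'n ^ 'n" where "W = coef_matrix w"
  define Q where "Q = \<phi>coef q"
  define B where "B = power_matrix p (quad q)"
  have W: "transpose W ** W = mat 1" "W ** transpose W = mat 1"
    by (simp_all add: W_def orthogonal_coef)
  have sol: "transpose Y ** Q ** Y \<simeq>[null p E] B" "transpose x0 ** Q ** Y \<simeq>[null p E] transpose Y ** Q ** x0"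
    using Y(2) by (simp_all add: solves_def Q_def B_def)
  have WQ: "W ** Q ** transpose W = Q"
  proof -
    have "W ** Q = Q ** W" unfolding W_def Q_def by (rule coef_commutes(2)[OF q(2), symmetric])
    then have "W ** Q ** transpose W = Q ** (W ** transpose W)" by (simp add: matrix_mul_assoc)
    then show ?thesis by (simp only: W(2) matrix_mul_rid)
  qed
  have conj: "transpose (transpose W ** A ** W) ** Q ** (transpose W ** C ** W)
      = transpose W ** (transpose A ** Q ** C) ** W" for A C
  proof -
    have "transpose (transpose W ** A ** W) ** Q ** (transpose W ** C ** W)
        = transpose W ** transpose A ** (W ** Q ** transpose W) ** C ** W"
      by (simp add: matrix_transpose_mul matrix_mul_assoc)
    then show ?thesis by (simp add: WQ matrix_mul_assoc)
  qed
  \<comment> \<open>The inverse of the orthogonal matrix \<open>W\<close> is its transpose.\<close>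
  define Y' where "Y' = transpose W ** Y ** W"
  have x0W: "transpose W ** x0 ** W \<simeq>[null p E] x0"
    using N.commutes_conj[OF W(1)] x0_commutes by (simp add: W_def)
  have "Y' \<simeq>[level p E 1] transpose W ** x0 ** W"
    unfolding Y'_def by (intro L.mat_cong_multR L.mat_cong_multL Y(1))
  then have Y'1: "Y' \<simeq>[level p E 1] x0"
    using mat_cong_mono[OF x0W null_subset_level] by (rule L.mat_trans)
  have "transpose Y' ** Q ** Y' \<simeq>[null p E] transpose W ** B ** W"
    unfolding Y'_def conj by (intro N.mat_cong_multR N.mat_cong_multL sol)
  also have "transpose W ** B ** W \<simeq>[null p E] B"
    using N.commutes_conj[OF W(1)] quad_commutes(2)[OF q(2)] by (simp add: W_def B_def)
  finally have 1: "transpose Y' ** Q ** Y' \<simeq>[null p E] B" .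
  have "transpose x0 ** Q ** Y' \<simeq>[null p E] transpose (transpose W ** x0 ** W) ** Q ** Y'"
    by (intro N.mat_cong_multR N.mat_cong_transpose N.mat_sym[OF x0W])
  also have "\<dots> \<simeq>[null p E] transpose Y' ** Q ** (transpose W ** x0 ** W)"
    unfolding Y'_def conj by (intro N.mat_cong_multR N.mat_cong_multL sol)
  also have "\<dots> \<simeq>[null p E] transpose Y' ** Q ** x0"
    by (intro N.mat_cong_multL x0W)
  finally have "solution q Y'"
    using 1 by (simp add: solves_def Q_def B_def)
  from solution_unique[OF q(1) Y'1 this Y] have "W ** Y' \<simeq>[null p E] W ** Y"
    by (rule N.mat_cong_multL)
  moreover have "W ** Y' = Y ** W"
    by (simp add: Y'_def W matrix_mul_assoc)
  ultimately show ?thesis by (simp add: W_def)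
qed

text \<open>
  Both conditions equate composites of homomorphisms given by points, and comparing the images of
  the coordinates turns them into the two matrix equations.
\<close>

lemma symmetric_horizontal_iff:
  assumes q: "invertible q" "q ** w = w ** q"
    and y0: "is_point p E E \<phi> y0" "entries y0 = x0"
    and y: "is_point p E E \<phi> y" "lifts_power p E y"
  shows "symmetric_horizontal_lift p \<phi> E q (point_hom p E E \<phi> y0) (point_hom p E E \<phi> y)
    \<longleftrightarrow> solution q (entries y)"
proof -
  note coordE = is_point_coord[OF order_refl[of E], of p]
  obtain a where a: "is_point p E E id a" "entries a = quad q"
    using bilinear_point[OF q coordE coordE] by (auto simp: entries_coord[of "\<lambda>v. v"] id_def)
  obtain b where b: "is_point p E (product_eqs E E) id b"
    "entries b = transpose (coord_matrix Inl) ** coef_matrix q ** coord_matrix Inr"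
    using bilinear_point[OF q is_point_Inl is_point_Inr] by (metis entries_coord)
  have Ha: "quadratic_map p E q = point_hom p E E id a"
    unfolding quadratic_map_def
    by (rule matrix_map_eq[OF GL_subset a(1)])
       (simp add: a(2) ring_map_matrix_mult[OF fps_const_ring_map] fps_const_Xmat fps_const_Cmat
          flip: transpose_map_matrix)
  have Bb: "bilinear_map p E q = point_hom p E (product_eqs E E) id b"
    unfolding bilinear_map_def
    by (rule matrix_map_eq[OF GL_subset b(1)])
       (simp add: b(2) ring_map_matrix_mult[OF fps_const_ring_map] fps_const_Xmat fps_const_Cmat
          flip: transpose_map_matrix)
  have of_entries: "(\<forall>v. u v \<approx>[null p E] u' v) \<longleftrightarrow> entries u \<simeq>[null p E] entries u'"
    if "is_point p E E \<phi> u" "is_point p E E \<phi> u'" for u u'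
    using point_eq_of_entries[OF \<phi> GL_subset that] by (auto simp: mat_cong_def entries_def)
  have H: "H_horizontal p E q (point_hom p E E \<phi> y0) (point_hom p E E \<phi> y) \<longleftrightarrow>
    transpose (entries y) ** \<phi>coef q ** entries y \<simeq>[null p E] power_matrix p (quad q)"
  proof -
    have "H_horizontal p E q (point_hom p E E \<phi> y0) (point_hom p E E \<phi> y) \<longleftrightarrow>
      (\<forall>v. series_eval \<phi> y (a v) \<approx>[null p E] series_eval id a (y0 v))"
      unfolding H_horizontal_def Ha
      by (rule point_hom_comp_eq_iff[OF \<phi> ring_map_id a(1) y(1) ring_map_id \<phi> y0(1) a(1)]) simp
    also have "\<dots> \<longleftrightarrow> entries (\<lambda>v. series_eval \<phi> y (a v)) \<simeq>[null p E] entries (\<lambda>v. series_eval id a (y0 v))"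
      using is_point_comp[OF \<phi> ring_map_id a(1) y(1)] is_point_comp[OF ring_map_id \<phi> y0(1) a(1)]
      by (intro of_entries) simp_all
    also have "entries (\<lambda>v. series_eval \<phi> y (a v)) = transpose (entries y) ** \<phi>coef q ** entries y"
      unfolding map_matrix_entries[symmetric] a(2)
      by (simp add: ring_map_matrix_mult[OF ring_map_series_eval[OF \<phi>]] series_eval_coord_matrix[OF \<phi>]
          series_eval_coef_matrix[OF \<phi>] flip: transpose_map_matrix)
    also have "entries (\<lambda>v. series_eval id a (y0 v)) = power_matrix p (quad q)"
    proof -
      have "map_matrix (series_eval id a) x0 = power_matrix p (map_matrix (series_eval id a) x)"
        unfolding map_matrix_map_matrix ring_map_power[OF ring_map_series_eval[OF ring_map_id]] ..
      then show ?thesis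
        unfolding map_matrix_entries[symmetric] y0(2) series_eval_coord_matrix[OF ring_map_id] a(2) .
    qed
    finally show ?thesis .
  qed
  have B: "B_symmetric p E q (point_hom p E E \<phi> y0) (point_hom p E E \<phi> y) \<longleftrightarrow>
    transpose x0 ** \<phi>coef q ** entries y \<simeq>[null p E] transpose (entries y) ** \<phi>coef q ** x0"
  proof -
    note pair = pairing_eq[OF GL_subset y0(1) y(1)] pairing_eq[OF GL_subset y(1) y0(1)]
    have ev: "entries (\<lambda>v. series_eval \<phi> (case_sum u u') (b v)) = transpose (entries u) ** \<phi>coef q ** entries u'"
      for u u' :: "'n gl_var \<Rightarrow> ('n gl_var, 'a) series"
    proof -
      have "map_matrix (series_eval \<phi> (case_sum u u')) (coord_matrix Inl) = entries u"
        "map_matrix (series_eval \<phi> (case_sum u u')) (coord_matrix Inr) = entries u'"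
        by (simp_all add: map_matrix_def coord_matrix_def entries_def series_eval_coord[OF \<phi>])
      moreover have "map_matrix (series_eval \<phi> (case_sum u u')) (coef_matrix q) = \<phi>coef q"
        by (simp add: map_matrix_def series_eval_coef[OF \<phi>])
      ultimately show ?thesis
        unfolding map_matrix_entries[symmetric] b(2)
        by (simp add: ring_map_matrix_mult[OF ring_map_series_eval[OF \<phi>]] flip: transpose_map_matrix)
    qed
    have "B_symmetric p E q (point_hom p E E \<phi> y0) (point_hom p E E \<phi> y) \<longleftrightarrow>
      (\<forall>v. series_eval \<phi> (case_sum y0 y) (b v) \<approx>[null p E] series_eval \<phi> (case_sum y y0) (b v))"
      unfolding B_symmetric_def Bb pair(1,3)
      by (rule point_hom_comp_eq_iff[OF \<phi> ring_map_id b(1) pair(2) \<phi> ring_map_id b(1) pair(4)]) simp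
    also have "\<dots> \<longleftrightarrow> entries (\<lambda>v. series_eval \<phi> (case_sum y0 y) (b v))
        \<simeq>[null p E] entries (\<lambda>v. series_eval \<phi> (case_sum y y0) (b v))"
      using is_point_comp[OF \<phi> ring_map_id b(1) pair(2)] is_point_comp[OF \<phi> ring_map_id b(1) pair(4)]
      by (intro of_entries) simp_all
    finally show ?thesis unfolding ev y0(2) .
  qed
  have "frobenius_lift p \<phi> E (point_hom p E E \<phi> y)"
    unfolding lift_iff using y by blast
  then show ?thesis
    by (simp add: symmetric_horizontal_lift_def H B solves_def)
qed

lemma entries_near_x0:
  assumes "lifts_power p E y"
  shows "entries y \<simeq>[level p E 1] x0"
  using assms unfolding lifts_power_def mat_cong_def entries_def coord_matrix_def nth_map_matrix vec_lambda_beta by simp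

lemma symmetric_horizontal_unique:
  assumes q: "invertible q" "q ** w = w ** q"
    and y0: "is_point p E E \<phi> y0" "entries y0 = x0"
    and y: "is_point p E E \<phi> y" "lifts_power p E y" and sol: "solution q (entries y)"
  shows "symmetric_horizontal_lift p \<phi> E q (point_hom p E E \<phi> y0) \<Phi> \<longleftrightarrow> \<Phi> = point_hom p E E \<phi> y"
proof
  assume \<Phi>: "symmetric_horizontal_lift p \<phi> E q (point_hom p E E \<phi> y0) \<Phi>"
  then obtain z where z: "is_point p E E \<phi> z" "lifts_power p E z"
    and \<Phi>z: "\<Phi> = point_hom p E E \<phi> z"
    by (auto simp: symmetric_horizontal_lift_def lift_iff)
  have "solution q (entries z)"
    using \<Phi> symmetric_horizontal_iff[OF q y0 z] by (simp add: \<Phi>z)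
  then have "entries z \<simeq>[null p E] entries y"
    by (intro solution_unique[OF q(1)] entries_near_x0 z y sol)
  then show "\<Phi> = point_hom p E E \<phi> y"
    unfolding \<Phi>z point_hom_eq_iff[OF \<phi> z(1) y(1)]
    using point_eq_of_entries[OF \<phi> GL_subset z(1) y(1)] by blast
next
  assume "\<Phi> = point_hom p E E \<phi> y"
  then show "symmetric_horizontal_lift p \<phi> E q (point_hom p E E \<phi> y0) \<Phi>"
    using symmetric_horizontal_iff[OF q y0 y] sol by simp
qed

end

section \<open>The base ring\<close>

lemma padic_ideal_type_ring: "padic_ideal p type_ring k = range (\<lambda>u. u * of_nat p ^ k)"
proof -
  have "ring_hom_cring (type_ring :: 'a ring) type_ring id"
    by (intro ring_hom_cringI ring_hom_ringI2 cring_from_type_algebra ring_from_type_algebra ring_hom_memI) auto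
  from ring_hom_of_nat[OF this, of "p ^ k"] show ?thesis
    by (auto simp: padic_ideal_def cgenideal_def)
qed

lemma to_completion_type_ring: "to_completion p type_ring a k = {b. of_nat p ^ k dvd b - a}"
proof -
  have "(\<exists>u. b = u * of_nat p ^ k + a) \<longleftrightarrow> of_nat p ^ k dvd b - a" for b :: 'a
    by (metis add_diff_cancel_right' diff_add_cancel dvd_def mult.commute)
  then show ?thesis
    by (auto simp: to_completion_def padic_ideal_type_ring a_r_coset_def')
qed

locale complete_ring =
  fixes p :: nat and T :: "'a::idom itself"
  assumes complete: "complete_dvr_Fpbar p TYPE('a)" and prime: "prime p"
begin

lemma bij_to_completion:
  "bij_betw (to_completion p (type_ring :: 'a ring)) UNIV (carrier (padic_completion p type_ring))"
  using complete by (simp add: complete_dvr_Fpbar_def Let_def)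

lemma principal_p: "PIdl\<^bsub>type_ring\<^esub> (of_nat p :: 'a) = {x. of_nat p dvd x}"
  by (auto simp: cgenideal_def dvd_def mult.commute)

lemma p_nonzero: "of_nat p \<noteq> (0 :: 'a)"
proof -
  have "{x :: 'a. of_nat p dvd x} \<noteq> {0}"
    using complete by (simp add: complete_dvr_Fpbar_def Let_def principal_p)
  then show ?thesis by auto
qed

lemma eq_0_if_p_divisible: "(\<And>k. of_nat p ^ k dvd c) \<Longrightarrow> c = (0 :: 'a)"
proof -
  assume c: "\<And>k. of_nat p ^ k dvd c"
  have "of_nat p ^ k dvd b - c \<longleftrightarrow> of_nat p ^ k dvd b" for b k
    using c[of k] by (metis diff_add_cancel dvd_add dvd_diff)
  then have "to_completion p type_ring c = to_completion p type_ring 0"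
    by (simp add: fun_eq_iff to_completion_type_ring)
  then show "c = 0"
    using bij_to_completion by (auto simp: bij_betw_def dest: injD)
qed

text \<open>
  This is the surjectivity of the map to the completion.
\<close>

lemma p_limit_exists:
  fixes f :: "nat \<Rightarrow> 'a"
  assumes "\<And>k. of_nat p ^ k dvd f (Suc k) - f k"
  obtains c where "\<And>k. of_nat p ^ k dvd c - f k"
proof -
  define s where "s k = {b. of_nat p ^ k dvd b - f k}" for k
  have "s k \<in> carrier (type_ring Quot padic_ideal p type_ring k)" for k
    using to_completion_type_ring[of p "f k" k]
    by (auto simp: FactRing_def A_RCOSETS_def' s_def to_completion_def)
  moreover have "s (Suc k) \<subseteq> s k" for k
  proof
    fix b assume "b \<in> s (Suc k)"
    then have "of_nat p ^ k dvd b - f (Suc k)"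
      using dvd_trans[of "of_nat p ^ k" "of_nat p ^ Suc k"] by (simp add: s_def)
    from dvd_add[OF this assms[of k]] show "b \<in> s k" by (simp add: s_def)
  qed
  ultimately have "s \<in> carrier (padic_completion p type_ring)"
    by (simp add: padic_completion_def)
  then obtain c where c: "s = to_completion p type_ring c"
    using bij_to_completion by (auto simp: bij_betw_def)
  have "of_nat p ^ k dvd c - f k" for k
  proof -
    have "c \<in> to_completion p type_ring c k" by (simp add: to_completion_type_ring)
    then show ?thesis unfolding c[symmetric] by (simp add: s_def)
  qed
  then show ?thesis by (rule that)
qed

text \<open>
  The geometric series converges.
\<close>

lemma one_minus_p_unit: "\<exists>v::'a. v * (1 - of_nat p * w) = 1"
proof -
  define f where "f k = (\<Sum>i<k. (of_nat p * w) ^ i)" for k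
  have "of_nat p ^ k dvd f (Suc k) - f k" for k
    by (simp add: f_def power_mult_distrib)
  then obtain v where v: "\<And>k. of_nat p ^ k dvd v - f k" by (rule p_limit_exists) blast
  have "v * (1 - of_nat p * w) - 1 = 0"
  proof (rule eq_0_if_p_divisible)
    fix k
    have "(1 - of_nat p * w) * f k = 1 - (of_nat p * w) ^ k"
      unfolding f_def by (simp add: one_diff_power_eq)
    then have "v * (1 - of_nat p * w) - 1 = (v - f k) * (1 - of_nat p * w) - of_nat p ^ k * w ^ k"
      by (simp add: algebra_simps power_mult_distrib)
    then show "of_nat p ^ k dvd v * (1 - of_nat p * w) - 1"
      using v[of k] by simp
  qed
  then show ?thesis by auto
qed

lemma unit_if_unit_mod_p:
  assumes "of_nat p dvd u * a - (1 :: 'a)"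
  obtains v where "v * a = 1"
proof -
  obtain w where "u * a - 1 = of_nat p * w" using assms by (rule dvdE)
  then have "u * a = 1 - of_nat p * (- w)" by (simp add: algebra_simps)
  then obtain v where "v * (u * a) = 1" using one_minus_p_unit by metis
  then show ?thesis by (intro that[of "v * u"]) (simp add: mult.assoc)
qed

lemma of_nat_unit:
  assumes "coprime n p"
  obtains v where "v * of_nat n = (1 :: 'a)"
proof -
  have "gcd (int n) (int p) = 1" using assms by (simp add: coprime_iff_gcd_eq_1)
  then obtain u t where "u * int n + t * int p = 1"
    using bezout_int[of "int n" "int p"] by auto
  then have "of_int (u * int n + t * int p) = (1 :: 'a)" by simp
  then have "of_int u * of_nat n - 1 = of_nat p * (- of_int t :: 'a)"
    by (simp add: algebra_simps)
  then have "of_nat p dvd of_int u * of_nat n - (1 :: 'a)" by (rule dvdI)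
  from unit_if_unit_mod_p[OF this] that show ?thesis by blast
qed

text \<open>
  A nonzero integer is the product of a power of \<open>p\<close>, which is not zero, and of an integer prime to
  \<open>p\<close>, which is a unit.
\<close>

lemma of_int_eq_0:
  assumes "of_int z = (0 :: 'a)"
  shows "z = 0"
proof (rule ccontr)
  assume "z \<noteq> 0"
  then have nz: "nat \<bar>z\<bar> \<noteq> 0" by simp
  have z0: "of_nat (nat \<bar>z\<bar>) = (0 :: 'a)"
    using assms by (cases "z \<ge> 0") (simp_all add: of_nat_nat)
  obtain m where m: "nat \<bar>z\<bar> = p ^ multiplicity p (nat \<bar>z\<bar>) * m" "\<not> p dvd m"
    using multiplicity_decompose'[OF nz, of p] prime_gt_1_nat[OF prime] by auto
  have "coprime m p"
    using prime_imp_coprime[OF prime m(2)] by (simp only: coprime_commute)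
  then obtain v where "v * of_nat m = (1 :: 'a)" by (rule of_nat_unit)
  then have "of_nat m \<noteq> (0 :: 'a)" by auto
  with p_nonzero have "of_nat (p ^ multiplicity p (nat \<bar>z\<bar>) * m) \<noteq> (0 :: 'a)" by simp
  with z0 m(1) show False by simp
qed

text \<open>
  Constants are detected by setting all variables to zero.
\<close>

lemma coef_null_empty:
  assumes "coef c \<in> null p ({} :: ('v, 'a) mpoly set)"
  shows "c = 0"
proof (rule eq_0_if_p_divisible)
  fix k
  have id: "ring_map (\<lambda>c::'a. c)" by (simp add: ring_map_def)
  note hom = ring_map_insertion[OF id, of "\<lambda>_::'v. 0"]
  have "gen_ideal ({} :: ('v, 'a) mpoly set) \<subseteq> {0}"
    by (rule gen_ideal_minimal[OF ring_ideal_0]) simp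
  moreover have "(Const c :: ('v, 'a) mpoly) \<in> poly_level p {} k"
    using subsetD[OF null_subset_level assms, of k] by (simp add: level_def approx_const)
  ultimately obtain u :: "('v, 'a) mpoly" where "Const c = of_nat p ^ k * u"
    by (auto simp: poly_level_def)
  from arg_cong[OF this, of "insertion (\<lambda>c. c) (\<lambda>_. 0)"]
  have "c = of_nat p ^ k * insertion (\<lambda>c. c) (\<lambda>_. 0) u"
    by (simp add: insertion_Const[OF id] ring_map_mult[OF hom] ring_map_power[OF hom] ring_map_of_nat[OF hom])
  then show "of_nat p ^ k dvd c" by simp
qed

end


section \<open>Complex scalars as block matrices\<close>

text \<open>
  The matrix \<open>a + b i\<close> for the complex structure \<open>i = q0\<close>.
\<close>

definition scalar_block :: "'c \<Rightarrow> 'c \<Rightarrow> 'c::comm_ring_1 ^ ('r::finite + 'r) ^ ('r + 'r)" where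
  "scalar_block a b = (\<chi> i j. case (i, j) of
      (Inl k, Inl l) \<Rightarrow> if k = l then a else 0
    | (Inl k, Inr l) \<Rightarrow> if k = l then b else 0
    | (Inr k, Inl l) \<Rightarrow> if k = l then - b else 0
    | (Inr k, Inr l) \<Rightarrow> if k = l then a else 0)"

lemma q0_eq: "q0 = scalar_block 0 1"
  by (auto simp: q0_def scalar_block_def vec_eq_iff split: sum.splits)

lemma mat_eq_scalar_block: "mat a = scalar_block a 0"
  by (auto simp: mat_def scalar_block_def vec_eq_iff split: sum.splits)

lemma transpose_scalar_block: "transpose (scalar_block a b) = scalar_block a (- b)"
  by (auto simp: transpose_def scalar_block_def vec_eq_iff split: sum.splits)

lemma map_scalar_block:
  "h 0 = 0 \<Longrightarrow> h (- b) = - h b \<Longrightarrow> map_matrix h (scalar_block a b) = scalar_block (h a) (h b)"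
  by (auto simp: map_matrix_def scalar_block_def vec_eq_iff split: sum.splits)

lemma sum_UNIV_sum: "sum f (UNIV :: ('r::finite + 's::finite) set) = (\<Sum>k\<in>UNIV. f (Inl k)) + (\<Sum>k\<in>UNIV. f (Inr k))"
proof -
  have "sum f UNIV = sum f (range Inl) + sum f (range Inr)"
    unfolding UNIV_sum by (rule sum.union_disjoint) auto
  then show ?thesis by (simp add: sum.reindex)
qed

lemma mult_scalar_block:
  "(M ** scalar_block a b) $ i $ Inl k = M $ i $ Inl k * a - M $ i $ Inr k * b"
  "(M ** scalar_block a b) $ i $ Inr k = M $ i $ Inl k * b + M $ i $ Inr k * a"
  "(scalar_block a b ** M) $ Inl k $ i = a * M $ Inl k $ i + b * M $ Inr k $ i"
  "(scalar_block a b ** M) $ Inr k $ i = a * M $ Inr k $ i - b * M $ Inl k $ i"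
  by (simp_all add: matrix_matrix_mult_def scalar_block_def sum_UNIV_sum if_distrib if_distribR sum.delta sum.delta'
      cong: if_cong)

lemma vec_eq_sum_iff: "M = N \<longleftrightarrow> (\<forall>k l. M $ Inl k $ Inl l = N $ Inl k $ Inl l \<and> M $ Inl k $ Inr l = N $ Inl k $ Inr l
    \<and> M $ Inr k $ Inl l = N $ Inr k $ Inl l \<and> M $ Inr k $ Inr l = N $ Inr k $ Inr l)"
  for M N :: "'c ^ ('r::finite + 'r) ^ ('r + 'r)"
  unfolding vec_eq_iff by (metis sum.exhaust)

lemma scalar_block_nth:
  "scalar_block a b $ Inl k $ Inl l = (if k = l then a else 0)"
  "scalar_block a b $ Inl k $ Inr l = (if k = l then b else 0)"
  "scalar_block a b $ Inr k $ Inl l = (if k = l then - b else 0)"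
  "scalar_block a b $ Inr k $ Inr l = (if k = l then a else 0)"
  by (simp_all add: scalar_block_def)

lemma scalar_block_mult: "scalar_block a b ** scalar_block c d = scalar_block (a * c - b * d) (a * d + b * c)"
  unfolding vec_eq_sum_iff mult_scalar_block by (simp add: scalar_block_nth)

lemma map_q0: "ring_map h \<Longrightarrow> map_matrix h q0 = q0"
  unfolding q0_eq by (simp add: map_scalar_block ring_map_0 ring_map_1 ring_map_uminus)

lemma power_matrix_q0:
  assumes "odd p"
  shows "power_matrix p (M ** q0) = power_matrix p M ** q0"
    and "power_matrix p (q0 ** M) = q0 ** power_matrix p M"
  using assms unfolding q0_eq vec_eq_sum_iff nth_map_matrix mult_scalar_block by simp_all

definition c_matrix :: "'c \<Rightarrow> 'c::comm_ring_1 ^ ('r::finite + 'r) ^ ('r + 'r) \<Rightarrow> 'c ^ 'r ^ 'r" where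
  "c_matrix \<iota> M = (\<chi> i j. M $ Inl i $ Inl j + \<iota> * M $ Inl i $ Inr j)"

text \<open>
  A matrix that commutes with \<open>q0\<close> has the blocks \<open>a\<close>, \<open>b\<close>, \<open>- b\<close>, \<open>a\<close>, and \<open>\<iota>\<^sup>2 = - 1\<close> makes \<open>a + \<iota> b\<close>
  multiplicative, as for complex numbers.
\<close>

lemma (in ring_ideal) c_matrix_mult:
  assumes \<iota>: "\<iota> ^ 2 = - 1" and N: "N ** q0 \<simeq>[J] q0 ** N"
  shows "c_matrix \<iota> (M ** N) \<simeq>[J] c_matrix \<iota> M ** c_matrix \<iota> N"
proof -
  have \<iota>2: "\<iota> * (\<iota> * z) = - z" for z
    using \<iota> by (simp add: power2_eq_square mult.assoc[symmetric])
  have RL: "N $ Inr k $ Inl l \<approx>[J] - (N $ Inl k $ Inr l)" and RR: "N $ Inr k $ Inr l \<approx>[J] N $ Inl k $ Inl l" for k l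
  proof -
    have "(N ** q0) $ Inr k $ Inr l \<approx>[J] (q0 ** N) $ Inr k $ Inr l"
      "(N ** q0) $ Inl k $ Inr l \<approx>[J] (q0 ** N) $ Inl k $ Inr l"
      using N by (simp_all add: mat_cong_def)
    then show "N $ Inr k $ Inl l \<approx>[J] - (N $ Inl k $ Inr l)" "N $ Inr k $ Inr l \<approx>[J] N $ Inl k $ Inl l"
      unfolding q0_eq mult_scalar_block by (simp_all add: cong_sym)
  qed
  show ?thesis
    unfolding mat_cong_def
  proof (intro allI)
    fix i j
    have 1: "c_matrix \<iota> (M ** N) $ i $ j = (\<Sum>k\<in>UNIV. M $ Inl i $ Inl k * (N $ Inl k $ Inl j + \<iota> * N $ Inl k $ Inr j)
        + M $ Inl i $ Inr k * (N $ Inr k $ Inl j + \<iota> * N $ Inr k $ Inr j))"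
      by (simp add: c_matrix_def matrix_matrix_mult_def sum_UNIV_sum sum.distrib sum_distrib_left algebra_simps)
    have 2: "(c_matrix \<iota> M ** c_matrix \<iota> N) $ i $ j = (\<Sum>k\<in>UNIV. M $ Inl i $ Inl k * (N $ Inl k $ Inl j + \<iota> * N $ Inl k $ Inr j)
        + M $ Inl i $ Inr k * (- (N $ Inl k $ Inr j) + \<iota> * N $ Inl k $ Inl j))"
      by (simp add: c_matrix_def matrix_matrix_mult_def algebra_simps \<iota>2)
    show "c_matrix \<iota> (M ** N) $ i $ j \<approx>[J] (c_matrix \<iota> M ** c_matrix \<iota> N) $ i $ j"
      unfolding 1 2 by (intro cong_sum cong_add cong_mult cong_refl RL RR)
  qed
qed

lemma c_matrix_scalar_block: "c_matrix \<iota> (scalar_block a b) = mat (a + \<iota> * b)"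
  by (simp add: c_matrix_def scalar_block_nth mat_def vec_eq_iff)

lemma (in ring_ideal) c_matrix_cong: "M \<simeq>[J] N \<Longrightarrow> c_matrix \<iota> M \<simeq>[J] c_matrix \<iota> N"
  unfolding mat_cong_def c_matrix_def vec_lambda_beta by (intro allI cong_add cong_mult cong_refl) auto

section \<open>The lifts on the general linear group and on the centralizer\<close>

context frobenius_setting
begin

lemma GL_setting: "centralizer_setting p \<phi> (mat 1 :: 'a ^ 'n::finite ^ 'n) GL"
proof (intro centralizer_setting.intro frobenius_setting_axioms centralizer_setting_axioms.intro)
  show "map_matrix \<phi> (mat 1 :: 'a ^ 'n ^ 'n) = mat 1" by (rule ring_map_matrix_1[OF \<phi>])
qed (simp_all add: ring_map_matrix_1[OF coef_ring_map])

lemma GLc_setting: "centralizer_setting p \<phi> (q0 :: 'a ^ ('r::finite + 'r) ^ ('r + 'r)) GLc"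
proof (intro centralizer_setting.intro frobenius_setting_axioms centralizer_setting_axioms.intro)
  show "map_matrix \<phi> (q0 :: 'a ^ ('r + 'r) ^ ('r + 'r)) = q0" by (rule map_q0[OF \<phi>])
  show "transpose q0 ** q0 = (mat 1 :: 'a ^ ('r + 'r) ^ ('r + 'r))"
    "q0 ** transpose q0 = (mat 1 :: 'a ^ ('r + 'r) ^ ('r + 'r))"
    by (simp_all add: q0_eq transpose_scalar_block scalar_block_mult mat_eq_scalar_block)
qed (simp_all add: GLc_def map_q0[OF coef_ring_map] power_matrix_q0[OF odd])

abbreviation solves_form ::
    "('n::finite gl_var, 'a) mpoly set \<Rightarrow> 'a ^ 'n ^ 'n \<Rightarrow> ('n gl_var, 'a) series ^ 'n ^ 'n \<Rightarrow> bool" where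
  "solves_form E q \<equiv> solves (null p E) (power_matrix p (coord_matrix id)) (coef_matrix (map_matrix \<phi> q))
    (power_matrix p (transpose (coord_matrix id) ** coef_matrix q ** coord_matrix id))"

lemma phi_GL0_point:
  obtains y0 :: "'n::finite gl_var \<Rightarrow> ('n gl_var, 'a) series"
  where "is_point p GL GL \<phi> y0" "lifts_power p GL y0"
    "entries y0 = power_matrix p (coord_matrix id)" "phi_GL0 p \<phi> = point_hom p GL GL \<phi> y0"
proof -
  interpret C: centralizer_setting p \<phi> "mat 1 :: 'a ^ 'n ^ 'n" GL by (rule GL_setting)
  interpret L: ring_ideal "level p (GL :: ('n gl_var, 'a) mpoly set) 1" by (rule ring_ideal_level)
  obtain y0 where y0: "is_point p GL GL \<phi> y0" "entries y0 = power_matrix p (coord_matrix id)"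
    "lifts_power p (GL :: ('n gl_var, 'a) mpoly set) y0"
    by (rule C.frobenius_point[OF L.mat_refl C.x0_commutes])
  have val: "fn p (GL :: ('n gl_var, 'a) mpoly set) (Var (Entry i j) ^ p) = series_class p GL (y0 (Entry i j))" for i j
  proof -
    have "y0 (Entry i j) = entries y0 $ i $ j" by (simp add: entries_def)
    then show ?thesis unfolding y0(2) by (simp add: fn_eq coord_matrix_def)
  qed
  have "phi_GL0 p \<phi> = point_hom p GL GL \<phi> y0"
    unfolding phi_GL0_def
  proof (rule the_equality)
    show "frobenius_lift p \<phi> GL (point_hom p GL GL \<phi> y0) \<and> (\<forall>i j.
        point_hom p GL GL \<phi> y0 (fn p GL (Var (Entry i j))) = fn p GL (Var (Entry i j) ^ p))"
      using y0 lift_iff by (auto simp: val point_hom_fn_Var[OF \<phi> y0(1)])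
    fix \<Phi> :: "('n gl_var, 'a) ffun \<Rightarrow> ('n gl_var, 'a) ffun"
    assume *: "frobenius_lift p \<phi> GL \<Phi> \<and> (\<forall>i j. \<Phi> (fn p GL (Var (Entry i j))) = fn p GL (Var (Entry i j) ^ p))"
    then obtain z where z: "is_point p GL GL \<phi> z" "\<Phi> = point_hom p GL GL \<phi> z"
      by (auto simp: lift_iff)
    have "z (Entry i j) \<approx>[null p GL] y0 (Entry i j)" for i j
      using * unfolding z(2) val by (simp add: point_hom_fn_Var[OF \<phi> z(1)] series_class_eq_iff)
    then have "entries z \<simeq>[null p GL] entries y0" by (simp add: entries_def mat_cong_def)
    then show "\<Phi> = point_hom p GL GL \<phi> y0"
      unfolding z(2) point_hom_eq_iff[OF \<phi> z(1) y0(1)]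
      using point_eq_of_entries[OF \<phi> order_refl z(1) y0(1)] by blast
  qed
  then show ?thesis using that y0 by blast
qed

lemma phi_GL_point:
  fixes q :: "'a ^ 'n::finite ^ 'n"
  assumes q: "invertible q" "transpose q = q \<or> transpose q = - q"
  obtains y where "is_point p GL GL \<phi> y" "lifts_power p GL y"
    "solves_form GL q (entries y)"
    "\<forall>\<Phi>. symmetric_horizontal_lift p \<phi> GL q (phi_GL0 p \<phi>) \<Phi> \<longleftrightarrow> \<Phi> = point_hom p GL GL \<phi> y"
    "phi_GL p \<phi> q = point_hom p GL GL \<phi> y"
proof -
  interpret C: centralizer_setting p \<phi> "mat 1 :: 'a ^ 'n ^ 'n" GL by (rule GL_setting)
  obtain y0 :: "'n gl_var \<Rightarrow> ('n gl_var, 'a) series" where y0: "is_point p GL GL \<phi> y0"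
    "entries y0 = power_matrix p (coord_matrix id)" "phi_GL0 p \<phi> = point_hom p GL GL \<phi> y0"
    using phi_GL0_point by metis
  obtain Y where Y: "Y \<simeq>[level p GL 1] power_matrix p (coord_matrix id)" "solves_form GL q Y"
    by (rule C.solution_exists[OF q])
  have q1: "q ** mat 1 = mat 1 ** q" by simp
  obtain y where y: "is_point p GL GL \<phi> y" "entries y = Y" "lifts_power p GL y"
    by (rule C.frobenius_point[OF Y(1) C.solution_commutes[OF q(1) q1 Y]])
  have sol: "solves_form GL q (entries y)" using Y(2) y(2) by simp
  have iff: "symmetric_horizontal_lift p \<phi> GL q (phi_GL0 p \<phi>) \<Phi> \<longleftrightarrow> \<Phi> = point_hom p GL GL \<phi> y" for \<Phi>
    unfolding y0(3) by (rule C.symmetric_horizontal_unique[OF q(1) q1 y0(1,2) y(1,3) sol])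
  then have "phi_GL p \<phi> q = point_hom p GL GL \<phi> y" by (simp add: phi_GL_def)
  with that[OF y(1,3) sol] iff show ?thesis by blast
qed

text \<open>
  A solution on the general linear group is a solution on the centralizer. There it commutes with
  \<open>q0\<close>, so its point satisfies the equations of the centralizer and describes the induced lift.
\<close>

lemma phi_GLc_point:
  fixes q :: "'a ^ ('r::finite + 'r) ^ ('r + 'r)"
  assumes q: "invertible q" "transpose q = q" "q ** q0 = q0 ** q"
  obtains y where "is_point p GLc GLc \<phi> y" "lifts_power p GLc y"
    "solves_form GLc q (entries y)" "phi_GLc p \<phi> q = point_hom p GLc GLc \<phi> y"
    "horizontal p GL GLc (phi_GL p \<phi> q)"
    "\<forall>\<Psi>. symmetric_horizontal_lift p \<phi> GLc q (phi_GLc0 p \<phi>) \<Psi> \<longleftrightarrow> \<Psi> = phi_GLc p \<phi> q"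
proof -
  interpret D: centralizer_setting p \<phi> "q0 :: 'a ^ ('r + 'r) ^ ('r + 'r)" GLc by (rule GLc_setting)
  let ?GL = "GL :: (('r + 'r) gl_var, 'a) mpoly set"
  have frob: "lifts_power p GLc y" if "lifts_power p ?GL y" for y
    by (rule lifts_power_mono[OF that D.GL_subset])
  have pt: "is_point p GLc GLc \<phi> y" if "is_point p ?GL GL \<phi> y"
    "entries y ** coef_matrix q0 \<simeq>[null p GLc] coef_matrix q0 ** entries y"
    for y :: "('r + 'r) gl_var \<Rightarrow> (('r + 'r) gl_var, 'a) series"
    using is_point_mono[OF that(1) order_refl D.GL_subset] that(2)
    by (simp add: D.is_point_iff[OF \<phi> D.\<phi>w] is_point_GL_iff[OF \<phi>])
  obtain y0 :: "('r + 'r) gl_var \<Rightarrow> (('r + 'r) gl_var, 'a) series" where y0: "is_point p GL GL \<phi> y0"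
    "lifts_power p GL y0"
    "entries y0 = power_matrix p (coord_matrix id)" "phi_GL0 p \<phi> = point_hom p GL GL \<phi> y0"
    using phi_GL0_point by blast
  have y0c: "is_point p GLc GLc \<phi> y0"
    by (rule pt[OF y0(1)]) (unfold y0(3), rule D.x0_commutes)
  have phi0: "phi_GLc0 p \<phi> = point_hom p GLc GLc \<phi> y0"
    unfolding phi_GLc0_def y0(4)
    by (rule horizontal_and_induced_lift(2)[OF order_refl D.GL_subset y0(1,2) y0c])
  obtain y where y: "is_point p ?GL GL \<phi> y" "lifts_power p GL y"
    "solves_form GL q (entries y)"
    "\<forall>\<Phi>. symmetric_horizontal_lift p \<phi> GL q (phi_GL0 p \<phi>) \<Phi> \<longleftrightarrow> \<Phi> = point_hom p GL GL \<phi> y"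
    "phi_GL p \<phi> q = point_hom p GL GL \<phi> y"
    by (rule phi_GL_point[OF q(1) disjI1[OF q(2)]])
  have sol: "solves_form GLc q (entries y)"
    using y(3) mat_cong_mono[OF _ null_mono[OF D.GL_subset]] unfolding solves_def by blast
  have yc: "is_point p GLc GLc \<phi> y"
    by (rule pt[OF y(1) D.solution_commutes[OF q(1,3) D.entries_near_x0[OF frob[OF y(2)]] sol]])
  note ind = horizontal_and_induced_lift[OF order_refl D.GL_subset y(1,2) yc]
  have phi: "phi_GLc p \<phi> q = point_hom p GLc GLc \<phi> y"
    unfolding phi_GLc_def y(5) by (rule ind(2))
  show ?thesis
  proof (rule that[OF yc frob[OF y(2)] sol phi])
    show "horizontal p GL GLc (phi_GL p \<phi> q)" unfolding y(5) by (rule ind(1))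
    show "\<forall>\<Psi>. symmetric_horizontal_lift p \<phi> GLc q (phi_GLc0 p \<phi>) \<Psi> \<longleftrightarrow> \<Psi> = phi_GLc p \<phi> q"
      unfolding phi phi0
      by (rule allI, rule D.symmetric_horizontal_unique[OF q(1,3) y0c y0(3) yc frob[OF y(2)] sol])
  qed
qed

text \<open>
  The point exists because the image of \<open>x\<close> under \<open>c\<close> is invertible: \<open>c\<close> is multiplicative, so an
  inverse is the image of the inverse of \<open>x\<close>.
\<close>

lemma c_map_point:
  fixes \<iota> :: 'a
  assumes \<iota>: "\<iota> ^ 2 = - 1"
  obtains b :: "'r::finite gl_var \<Rightarrow> (('r + 'r) gl_var, 'a) series" where "is_point p GL GLc id b"
    "entries b = c_matrix (coef \<iota>) (coord_matrix id)" "c_map p \<iota> = point_hom p GL GLc id b"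
proof -
  let ?GLc = "GLc :: (('r + 'r) gl_var, 'a) mpoly set"
  interpret D: centralizer_setting p \<phi> "q0 :: 'a ^ ('r + 'r) ^ ('r + 'r)" GLc by (rule GLc_setting)
  interpret N: ring_ideal "null p ?GLc" by (rule ring_ideal_null)
  have \<iota>c: "(coef \<iota> :: (('r + 'r) gl_var, 'a) series) ^ 2 = - 1"
    using arg_cong[OF \<iota>, of "coef :: 'a \<Rightarrow> (('r + 'r) gl_var, 'a) series"]
    by (simp only: ring_map_power[OF coef_ring_map] ring_map_uminus[OF coef_ring_map] ring_map_1[OF coef_ring_map])
  have x: "coord_matrix id ** q0 \<simeq>[null p ?GLc] q0 ** coord_matrix id"
    using D.x_commutes by (simp add: map_q0[OF coef_ring_map])
  obtain xi where xi: "coord_matrix id ** xi \<simeq>[null p ?GLc] mat 1" "xi ** coord_matrix id \<simeq>[null p ?GLc] mat 1"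
    using N.inverse_mod[OF D.DetInv_det] by blast
  define M where "M = c_matrix (coef \<iota>) (coord_matrix id :: (('r + 'r) gl_var, 'a) series ^ ('r + 'r) ^ ('r + 'r))"
  define d where "d = det (c_matrix (coef \<iota>) xi)"
  have "c_matrix (coef \<iota>) xi ** M \<simeq>[null p ?GLc] c_matrix (coef \<iota>) (xi ** coord_matrix id)"
    unfolding M_def by (rule N.mat_sym[OF N.c_matrix_mult[OF \<iota>c x]])
  also have "\<dots> \<simeq>[null p ?GLc] c_matrix (coef \<iota>) (mat 1)"
    by (rule N.c_matrix_cong[OF xi(2)])
  also have "c_matrix (coef \<iota>) (mat 1) = (mat 1 :: (('r + 'r) gl_var, 'a) series ^ 'r ^ 'r)"
    by (simp add: mat_eq_scalar_block[of "1 :: (('r + 'r) gl_var, 'a) series"] c_matrix_scalar_block)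
  finally have "det (c_matrix (coef \<iota>) xi ** M) \<approx>[null p ?GLc] det (mat 1 :: (('r + 'r) gl_var, 'a) series ^ 'r ^ 'r)"
    by (rule N.cong_det)
  then have "is_point p GL GLc id (matrix_point M d)"
    by (simp add: is_point_GL_iff[OF ring_map_id] det_mul d_def)
  moreover have "c_map p \<iota> = point_hom p GL GLc id (matrix_point M d)"
    unfolding c_map_def
  proof (rule matrix_map_eq[OF order_refl calculation])
    have "map_matrix fps_const (\<chi> i j. Var (Entry (Inl i) (Inl j)) + Const \<iota> * Var (Entry (Inl i) (Inr j))) = M"
      unfolding M_def c_matrix_def map_matrix_def coord_matrix_def
      by (simp flip: fps_const_add fps_const_mult)
    then show "entries (matrix_point M d)
        = map_matrix fps_const (\<chi> i j. Var (Entry (Inl i) (Inl j)) + Const \<iota> * Var (Entry (Inl i) (Inr j)))"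
      by simp
  qed
  ultimately show ?thesis by (intro that[of "matrix_point M d"]) (simp_all add: M_def)
qed

end

lemma solves_map:
  assumes h: "ring_map h" and J: "\<And>g. g \<in> J \<Longrightarrow> h g \<in> J'" and sol: "solves J S Q B Y"
  shows "solves J' (map_matrix h S) (map_matrix h Q) (map_matrix h B) (map_matrix h Y)"
proof -
  have cong: "map_matrix h A \<simeq>[J'] map_matrix h C" if "A \<simeq>[J] C" for A C :: "'a ^ 'c ^ 'c"
    using that J by (simp add: mat_cong_def cong_mod_def flip: ring_map_diff[OF h])
  from sol show ?thesis
    unfolding solves_def transpose_map_matrix ring_map_matrix_mult[OF h, symmetric]
    by (intro conjI cong) auto
qed

lemma mult_mat_commute: "A ** mat c = mat c ** A" for A :: "'c::comm_ring_1 ^ 'n ^ 'n"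
  unfolding mat_mult mult_mat by (simp add: vec_eq_iff mult.commute)

lemma mult_mat_mult: "A ** (mat c ** B) = mat c ** (A ** B)" for A B :: "'c::comm_ring_1 ^ 'n ^ 'n"
  by (simp add: matrix_mul_assoc mult_mat_commute)


section \<open>Values at complex scalars\<close>

locale complete_frobenius_setting = frobenius_setting p \<phi> + complete_ring p "TYPE('a)"
  for p and \<phi> :: "'a::idom \<Rightarrow> 'a"
begin

text \<open>
  At the matrix with scalar blocks \<open>a\<close> and \<open>b\<close>, a scalar multiple of the matrix with blocks \<open>a\<^sup>p\<close> and
  \<open>b\<^sup>p\<close> solves the evaluated equations if the square of the scalar is \<open>n\<^sup>p / (a\<^sup>2\<^sup>p + b\<^sup>2\<^sup>p)\<close>. This quotient is
  congruent to 1 modulo \<open>p\<close>, so it has a square root \<open>l\<close> congruent to 1, and uniqueness of solutions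
  applies. The points have values in the ring of functions on affine space, where constants are
  detected.
\<close>

lemma value_at_scalar:
  fixes a b n :: 'a
  assumes n: "n = a ^ 2 + b ^ 2" and v: "v * n = 1"
  obtains z :: "('r::finite + 'r) gl_var \<Rightarrow> (('r + 'r) gl_var, 'a) series" and l
  where "is_point p GLc {} id z" "entries z = coef_matrix (scalar_block a b)"
    "l ^ 2 * coef ((a ^ p) ^ 2 + (b ^ p) ^ 2) \<approx>[null p {}] coef (n ^ p)"
    "\<And>Y. Y \<simeq>[level p GLc 1] power_matrix p (coord_matrix id) \<Longrightarrow> solves_form GLc (mat 1) Y \<Longrightarrow>
      map_matrix (series_eval id z) Y \<simeq>[null p {}] mat l ** coef_matrix (scalar_block (a ^ p) (b ^ p))"
proof -
  let ?GLc = "GLc :: (('r + 'r) gl_var, 'a) mpoly set" and ?E = "{} :: (('r + 'r) gl_var, 'a) mpoly set"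
  interpret D: centralizer_setting p \<phi> "q0 :: 'a ^ ('r + 'r) ^ ('r + 'r)" GLc by (rule GLc_setting)
  interpret N: ring_ideal "null p ?E" by (rule ring_ideal_null)
  interpret L: ring_ideal "level p ?E 1" by (rule ring_ideal_level)
  define Z where "Z = (scalar_block a b :: 'a ^ ('r + 'r) ^ ('r + 'r))"
  define Zp where "Zp = (scalar_block (a ^ p) (b ^ p) :: 'a ^ ('r + 'r) ^ ('r + 'r))"
  define m where "m = (a ^ p) ^ 2 + (b ^ p) ^ 2"
  have p0: "p > 0" using prime by (rule prime_gt_0_nat)
  have inv: "scalar_block c d ** scalar_block (u * c) (- (u * d)) = (mat 1 :: 'a ^ ('r + 'r) ^ ('r + 'r))"
    "scalar_block (u * c) (- (u * d)) ** scalar_block c d = (mat 1 :: 'a ^ ('r + 'r) ^ ('r + 'r))"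
    if "u * (c ^ 2 + d ^ 2) = 1" for u c d
    using that by (simp_all add: scalar_block_mult mat_eq_scalar_block power2_eq_square algebra_simps)
  define d where "d = det (scalar_block (v * a) (- (v * b)) :: 'a ^ ('r + 'r) ^ ('r + 'r))"
  have "d * det Z = 1"
    using inv(2)[of v a b] v by (simp add: d_def Z_def n flip: det_mul)
  then have dZ: "coef d * det (coef_matrix Z) = (1 :: (('r + 'r) gl_var, 'a) series)"
    by (simp only: ring_map_mult[OF coef_ring_map, symmetric] ring_map_det[OF coef_ring_map, symmetric]
        ring_map_1[OF coef_ring_map])
  have "Z ** q0 = q0 ** Z"
    by (simp add: Z_def q0_eq scalar_block_mult)
  then have Zq: "coef_matrix Z ** coef_matrix q0
      = (coef_matrix q0 ** coef_matrix Z :: (('r + 'r) gl_var, 'a) series ^ ('r + 'r) ^ ('r + 'r))"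
    by (simp only: ring_map_matrix_mult[OF coef_ring_map, symmetric])
  define z where "z = matrix_point (coef_matrix Z) (coef d :: (('r + 'r) gl_var, 'a) series)"
  have z: "is_point p ?GLc ?E id z"
    unfolding D.is_point_iff[OF ring_map_id D.map_matrix_id] by (simp add: z_def dZ Zq)
  have "ring_ideal {x :: 'a. of_nat p dvd x}" by unfold_locales auto
  from ring_ideal.hom_mod_add[OF this ring_ideal.hom_mod_Frobenius[OF this prime]]
  have "of_nat p dvd (a ^ 2 + b ^ 2) ^ p - ((a ^ 2) ^ p + (b ^ 2) ^ p)"
    by (simp add: cong_mod_def)
  then have nm: "of_nat p dvd n ^ p - m"
    by (simp only: n m_def power_mult[symmetric] mult.commute)
  have "v ^ p * m - 1 = - (v ^ p * (n ^ p - m))"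
    using v by (simp add: algebra_simps flip: power_mult_distrib)
  then have "of_nat p dvd v ^ p * m - 1" using nm by simp
  then obtain mi where mi: "mi * m = 1" by (rule unit_if_unit_mod_p)
  \<comment> \<open>A scalar square root is a square root of a matrix of size one.\<close>
  define M where "M = (mat (coef (mi * n ^ p)) :: (('r + 'r) gl_var, 'a) series ^ 1 ^ 1)"
  have c1: "coef (mi * n ^ p) \<approx>[level p ?E 1] 1"
  proof -
    obtain r where "n ^ p - m = of_nat p * r" using nm by (rule dvdE)
    then have "mi * n ^ p - 1 = of_nat p * (mi * r)"
      using mi by (simp add: algebra_simps)
    then have "coef (mi * n ^ p) - coef 1 = of_nat p * (coef (mi * r) :: (('r + 'r) gl_var, 'a) series)"
      by (simp only: ring_map_diff[OF coef_ring_map, symmetric] ring_map_of_nat[OF coef_ring_map, symmetric]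
          ring_map_mult[OF coef_ring_map, symmetric])
    then show ?thesis
      unfolding cong_mod_def ring_map_1[OF coef_ring_map] using L.mult_mem_right[OF of_nat_level] by metis
  qed
  then have "M \<simeq>[level p ?E 1] mat 1"
    unfolding M_def by (rule L.mat_cong_mat)
  moreover obtain c :: "(('r + 'r) gl_var, 'a) series" where half: "c * 2 = 1"
    using half_series by blast
  ultimately obtain V where V: "V \<simeq>[level p ?E 1] mat 1" "V ** V \<simeq>[null p ?E] M"
    using sqrt_exists by blast
  define l where "l = V $ 1 $ 1"
  have l1: "l \<approx>[level p ?E 1] 1"
    using V(1) by (simp add: mat_cong_def l_def mat_def)
  have ll: "l * l \<approx>[null p ?E] coef (mi * n ^ p)"
    using V(2) by (simp add: mat_cong_def l_def M_def mat_def matrix_matrix_mult_def)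
  have llm: "l * l * coef m \<approx>[null p ?E] coef (n ^ p)"
  proof -
    have "l * l * coef m \<approx>[null p ?E] coef (mi * n ^ p) * coef m"
      by (intro N.cong_mult ll N.cong_refl)
    also have "coef (mi * n ^ p) * coef m = (coef (mi * n ^ p * m) :: (('r + 'r) gl_var, 'a) series)"
      by (rule ring_map_mult[OF coef_ring_map, symmetric])
    also have "mi * n ^ p * m = n ^ p" using mi by (metis mult.commute mult.left_commute mult_1)
    finally show ?thesis .
  qed
  let ?S = "coef_matrix Zp :: (('r + 'r) gl_var, 'a) series ^ ('r + 'r) ^ ('r + 'r)"
  let ?Si = "coef_matrix (scalar_block (mi * a ^ p) (- (mi * b ^ p))) :: (('r + 'r) gl_var, 'a) series ^ ('r + 'r) ^ ('r + 'r)"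
  have "?S ** ?Si = mat 1" "?Si ** ?S = mat 1"
    using inv[of mi "a ^ p" "b ^ p"] mi
    by (simp_all add: Zp_def m_def ring_map_matrix_1[OF coef_ring_map] flip: ring_map_matrix_mult[OF coef_ring_map])
  then have Si: "?S ** ?Si \<simeq>[null p ?E] mat 1" "?Si ** ?S \<simeq>[null p ?E] mat 1"
    by simp_all
  have pow: "power_matrix p (coef_matrix (A :: 'a ^ ('r + 'r) ^ ('r + 'r)))
      = (coef_matrix (power_matrix p A) :: (('r + 'r) gl_var, 'a) series ^ ('r + 'r) ^ ('r + 'r))" for A
    unfolding map_matrix_map_matrix ring_map_power[OF coef_ring_map] ..
  have Zpow: "power_matrix p Z = Zp"
    unfolding Z_def Zp_def by (rule map_scalar_block) (use p0 odd in simp_all)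
  have SS: "transpose ?S ** ?S = mat (coef m)"
  proof -
    have "transpose Zp ** Zp = mat m"
      by (simp add: Zp_def transpose_scalar_block scalar_block_mult mat_eq_scalar_block m_def power2_eq_square algebra_simps)
    moreover have "coef_matrix (mat m) = (mat (coef m) :: (('r + 'r) gl_var, 'a) series ^ ('r + 'r) ^ ('r + 'r))"
      by (simp add: map_matrix_def mat_def vec_eq_iff ring_map_0[OF coef_ring_map])
    ultimately show ?thesis
      by (simp add: transpose_map_matrix flip: ring_map_matrix_mult[OF coef_ring_map])
  qed
  define B where "B = (mat (coef (n ^ p)) :: (('r + 'r) gl_var, 'a) series ^ ('r + 'r) ^ ('r + 'r))"
  have lS: "solves (null p ?E) ?S (mat 1) B (mat l ** ?S)"
  proof -
    have t: "transpose (mat l ** ?S) = mat l ** transpose ?S"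
      by (simp add: matrix_transpose_mul mult_mat_commute)
    have "transpose (mat l ** ?S) ** mat 1 ** (mat l ** ?S) = mat l ** (mat l ** (transpose ?S ** ?S))"
      unfolding t matrix_mul_rid by (simp only: matrix_mul_assoc[symmetric] mult_mat_mult[of "transpose ?S"])
    also have "\<dots> = mat (l * l * coef m)"
      by (simp add: SS mat_mult_mat mult.assoc)
    also have "\<dots> \<simeq>[null p ?E] B"
      unfolding B_def by (rule N.mat_cong_mat[OF llm])
    finally have "transpose (mat l ** ?S) ** mat 1 ** (mat l ** ?S) \<simeq>[null p ?E] B" .
    moreover have "transpose ?S ** mat 1 ** (mat l ** ?S) = transpose (mat l ** ?S) ** mat 1 ** ?S"
      unfolding t matrix_mul_rid by (simp only: matrix_mul_assoc[symmetric] mult_mat_mult[of "transpose ?S"])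
    ultimately show ?thesis by (simp add: solves_def)
  qed
  have lS1: "mat l ** ?S \<simeq>[level p ?E 1] ?S"
    using L.mat_cong_multR[OF L.mat_cong_mat[OF l1], of ?S] by simp
  note hom = ring_map_series_eval[OF ring_map_id, of z]
  have hx: "map_matrix (series_eval id z) (coord_matrix id) = coef_matrix Z"
    by (simp add: series_eval_coord_matrix[OF ring_map_id] z_def)
  have hp: "map_matrix (series_eval id z) (power_matrix p A) = power_matrix p (map_matrix (series_eval id z) A)"
    for A :: "(('r + 'r) gl_var, 'a) series ^ ('r + 'r) ^ ('r + 'r)"
    unfolding map_matrix_map_matrix ring_map_power[OF hom] ..
  have hS: "map_matrix (series_eval id z) (power_matrix p (coord_matrix id)) = ?S"
    unfolding hp hx pow Zpow ..
  have mat1: "coef_matrix (map_matrix \<phi> (mat 1)) = (mat 1 :: (('r + 'r) gl_var, 'a) series ^ ('r + 'r) ^ ('r + 'r))"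
    "coef_matrix (mat 1) = (mat 1 :: (('r + 'r) gl_var, 'a) series ^ ('r + 'r) ^ ('r + 'r))"
    by (simp_all add: ring_map_matrix_1[OF \<phi>] ring_map_matrix_1[OF coef_ring_map])
  have hB: "map_matrix (series_eval id z) (power_matrix p (transpose (coord_matrix id) ** coef_matrix (mat 1) ** coord_matrix id)) = B"
  proof -
    have "map_matrix (series_eval id z) (transpose (coord_matrix id) ** coef_matrix (mat 1) ** coord_matrix id)
        = coef_matrix (transpose Z ** Z)"
      by (simp add: mat1 ring_map_matrix_mult[OF hom] hx ring_map_matrix_mult[OF coef_ring_map] flip: transpose_map_matrix)
    also have "transpose Z ** Z = mat n"
      by (simp add: Z_def transpose_scalar_block scalar_block_mult mat_eq_scalar_block n power2_eq_square algebra_simps)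
    finally have *: "map_matrix (series_eval id z) (transpose (coord_matrix id) ** coef_matrix (mat 1) ** coord_matrix id)
        = coef_matrix (mat n)" .
    have "power_matrix p (mat n) = (mat (n ^ p) :: 'a ^ ('r + 'r) ^ ('r + 'r))"
      using p0 by (simp add: map_matrix_def mat_def vec_eq_iff)
    moreover have "coef_matrix (mat (n ^ p)) = B"
      by (simp add: B_def map_matrix_def mat_def vec_eq_iff ring_map_0[OF coef_ring_map])
    ultimately show ?thesis
      unfolding hp * pow by simp
  qed
  show ?thesis
  proof (rule that[OF z])
    show "entries z = coef_matrix (scalar_block a b)" by (simp add: z_def Z_def)
    show "l ^ 2 * coef ((a ^ p) ^ 2 + (b ^ p) ^ 2) \<approx>[null p {}] coef (n ^ p)"
      using llm unfolding m_def power2_eq_square .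
    fix Y assume Y: "Y \<simeq>[level p ?GLc 1] power_matrix p (coord_matrix id)" "solves_form ?GLc (mat 1) Y"
    have "map_matrix (series_eval id z) Y \<simeq>[level p ?E 1] map_matrix (series_eval id z) (power_matrix p (coord_matrix id))"
      using Y(1) series_eval_level[OF ring_map_id z] ring_map_diff[OF hom]
      unfolding mat_cong_def cong_mod_def nth_map_matrix by metis
    then have 1: "map_matrix (series_eval id z) Y \<simeq>[level p ?E 1] ?S"
      by (simp only: hS)
    have 2: "solves (null p ?E) ?S (mat 1) B (map_matrix (series_eval id z) Y)"
    proof -
      have "solves (null p ?E) (map_matrix (series_eval id z) (power_matrix p (coord_matrix id)))
        (map_matrix (series_eval id z) (coef_matrix (map_matrix \<phi> (mat 1))))
        (map_matrix (series_eval id z) (power_matrix p (transpose (coord_matrix id) ** coef_matrix (mat 1) ** coord_matrix id)))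
        (map_matrix (series_eval id z) Y)"
        by (rule solves_map[OF hom _ Y(2)]) (rule series_eval_null[OF ring_map_id z])
      then show ?thesis
        by (simp only: hS hB mat1(1) ring_map_matrix_1[OF hom])
    qed
    show "map_matrix (series_eval id z) Y \<simeq>[null p {}] mat l ** coef_matrix (scalar_block (a ^ p) (b ^ p))"
      using normalized_solution_unique[OF half Si _ _ 1 2 lS1 lS] by (simp add: Zp_def)
  qed
qed

text \<open>
  The points \<open>(a, b) = (2, 0)\<close> and \<open>(3, \<iota>)\<close> have the same image under \<open>c\<close>. If the lift were
  c-horizontal, it would take values at them which have the same image under \<open>c\<close> too. The squares of
  these images are rational numbers, and they differ.
\<close>

lemma no_c_horizontal_lift:
  fixes \<iota> :: 'a and \<Theta> :: "('r::finite gl_var, 'a) ffun \<Rightarrow> ('r gl_var, 'a) ffun"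
  assumes \<iota>: "\<iota> ^ 2 = - 1" and \<Theta>: "frobenius_lift p \<phi> GL \<Theta>"
    and hor: "c_horizontal p \<iota> \<Theta> (phi_GLc p \<phi> (mat 1 :: 'a ^ ('r + 'r) ^ ('r + 'r)))"
  shows False
proof -
  let ?GLc = "GLc :: (('r + 'r) gl_var, 'a) mpoly set" and ?E = "{} :: (('r + 'r) gl_var, 'a) mpoly set"
  interpret D: centralizer_setting p \<phi> "q0 :: 'a ^ ('r + 'r) ^ ('r + 'r)" GLc by (rule GLc_setting)
  interpret N: ring_ideal "null p ?E" by (rule ring_ideal_null)
  have "invertible (mat 1 :: 'a ^ ('r + 'r) ^ ('r + 'r))"
    unfolding invertible_def by (intro exI[of _ "mat 1"]) simp
  moreover have "(mat 1 :: 'a ^ ('r + 'r) ^ ('r + 'r)) ** q0 = q0 ** mat 1" by simp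
  ultimately obtain y :: "('r + 'r) gl_var \<Rightarrow> (('r + 'r) gl_var, 'a) series" where y: "is_point p GLc GLc \<phi> y"
    "lifts_power p GLc y" "solves_form GLc (mat 1) (entries y)"
    "phi_GLc p \<phi> (mat 1 :: 'a ^ ('r + 'r) ^ ('r + 'r)) = point_hom p GLc GLc \<phi> y"
    "horizontal p GL GLc (phi_GL p \<phi> (mat 1 :: 'a ^ ('r + 'r) ^ ('r + 'r)))"
    "\<forall>\<Psi>. symmetric_horizontal_lift p \<phi> GLc (mat 1 :: 'a ^ ('r + 'r) ^ ('r + 'r)) (phi_GLc0 p \<phi>) \<Psi>
      \<longleftrightarrow> \<Psi> = phi_GLc p \<phi> (mat 1)"
    by (rule phi_GLc_point[OF _ transpose_mat])
  obtain t where t: "is_point p GL GL \<phi> t" "\<Theta> = point_hom p GL GL \<phi> t"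
    using \<Theta> by (auto simp: lift_iff)
  obtain b :: "'r gl_var \<Rightarrow> (('r + 'r) gl_var, 'a) series" where b: "is_point p GL GLc id b"
    "entries b = c_matrix (coef \<iota>) (coord_matrix id)" "c_map p \<iota> = point_hom p GL GLc id b"
    by (rule c_map_point[OF \<iota>])
  obtain i :: 'r where True by blast
  have "\<forall>v. series_eval \<phi> y (b v) \<approx>[null p GLc] series_eval id b (t v)"
    using hor unfolding c_horizontal_def y(4) t(2) b(3)
    by (subst (asm) point_hom_comp_eq_iff[OF \<phi> ring_map_id b(1) y(1) ring_map_id \<phi> t(1) b(1)]) simp_all
  then have hor_i: "series_eval \<phi> y (b (Entry i i)) \<approx>[null p GLc] series_eval id b (t (Entry i i))" by blast
  \<comment> \<open>It suffices to compare a single diagonal entry.\<close>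
  have "b (Entry i i) = entries b $ i $ i" by (simp add: entries_def)
  then have bi: "b (Entry i i) = coord (Entry (Inl i) (Inl i)) + coef \<iota> * coord (Entry (Inl i) (Inr i))"
    unfolding b(2) by (simp add: c_matrix_def coord_matrix_def)
  define val where "val = entries y $ Inl i $ Inl i + coef (\<phi> \<iota>) * entries y $ Inl i $ Inr i"
  have val: "val \<approx>[null p GLc] series_eval id b (t (Entry i i))"
    using hor_i unfolding bi
    by (simp add: ring_map_add[OF ring_map_series_eval[OF \<phi>]] ring_map_mult[OF ring_map_series_eval[OF \<phi>]]
        series_eval_coef[OF \<phi>] series_eval_coord[OF \<phi>] val_def entries_def del: fps_const_mult fps_const_add)
  note yx = D.entries_near_x0[OF y(2)]
  have val_z: "series_eval id z val \<approx>[null p ?E] l * coef (a ^ p + \<phi> \<iota> * c ^ p)"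
    if "map_matrix (series_eval id z) (entries y) \<simeq>[null p ?E] mat l ** coef_matrix (scalar_block (a ^ p) (c ^ p))"
    for z l a c
  proof -
    note hom = ring_map_series_eval[OF ring_map_id, of z]
    have "series_eval id z (entries y $ Inl i $ Inl i) \<approx>[null p ?E] l * coef (a ^ p)"
      "series_eval id z (entries y $ Inl i $ Inr i) \<approx>[null p ?E] l * coef (c ^ p)"
      using that unfolding mat_cong_def mat_mult vec_lambda_beta nth_map_matrix
      by (metis scalar_block_nth(1), metis scalar_block_nth(2))
    then have "series_eval id z val \<approx>[null p ?E] l * coef (a ^ p) + coef (\<phi> \<iota>) * (l * coef (c ^ p))"
      unfolding val_def ring_map_add[OF hom] ring_map_mult[OF hom] series_eval_coef[OF ring_map_id] id_apply
      by (intro N.cong_add N.cong_mult N.cong_refl)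
    then show ?thesis
      by (simp only: ring_map_add[OF coef_ring_map] ring_map_mult[OF coef_ring_map] distrib_left mult_ac)
  qed
  have odd_coprime: "coprime 2 p" using odd by simp
  obtain v2 :: 'a where v2: "v2 * of_nat 2 = 1" using of_nat_unit[OF odd_coprime] by blast
  have v4: "v2 ^ 2 * 4 = 1" "v2 ^ 3 * 8 = 1"
    using arg_cong[OF v2, of "\<lambda>a. a ^ 2"] arg_cong[OF v2, of "\<lambda>a. a ^ 3"] by (simp_all add: power_mult_distrib)
  have n1: "(4 :: 'a) = 2 ^ 2 + 0 ^ 2" and n2: "(8 :: 'a) = 3 ^ 2 + \<iota> ^ 2" using \<iota> by simp_all
  obtain z1 :: "('r + 'r) gl_var \<Rightarrow> (('r + 'r) gl_var, 'a) series" and l1 where z1: "is_point p GLc {} id z1"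
    "entries z1 = coef_matrix (scalar_block 2 0)"
    "l1 ^ 2 * coef ((2 ^ p) ^ 2 + (0 ^ p) ^ 2) \<approx>[null p {}] coef (4 ^ p)"
    "map_matrix (series_eval id z1) (entries y) \<simeq>[null p {}] mat l1 ** coef_matrix (scalar_block (2 ^ p) (0 ^ p))"
    using value_at_scalar[OF n1 v4(1)] yx y(3) by metis
  obtain z2 :: "('r + 'r) gl_var \<Rightarrow> (('r + 'r) gl_var, 'a) series" and l2 where z2: "is_point p GLc {} id z2"
    "entries z2 = coef_matrix (scalar_block 3 \<iota>)"
    "l2 ^ 2 * coef ((3 ^ p) ^ 2 + (\<iota> ^ p) ^ 2) \<approx>[null p {}] coef (8 ^ p)"
    "map_matrix (series_eval id z2) (entries y) \<simeq>[null p {}] mat l2 ** coef_matrix (scalar_block (3 ^ p) (\<iota> ^ p))"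
    using value_at_scalar[OF n2 v4(2)] yx y(3) by metis
  have comp: "is_point p GL {} id (\<lambda>v. series_eval id z (b v))"
    "entries (\<lambda>v. series_eval id z (b v)) = mat (coef (a + \<iota> * c))"
    if "is_point p GLc {} id z" "entries z = coef_matrix (scalar_block a c)"
    for z :: "('r + 'r) gl_var \<Rightarrow> (('r + 'r) gl_var, 'a) series" and a c
  proof -
    note hom = ring_map_series_eval[OF ring_map_id, of z]
    show "is_point p GL {} id (\<lambda>v. series_eval id z (b v))"
      using is_point_comp[OF ring_map_id ring_map_id b(1) that(1)] by simp
    have "map_matrix (series_eval id z) (c_matrix (coef \<iota>) (coord_matrix id)) = c_matrix (coef \<iota>) (entries z)"
      unfolding c_matrix_def map_matrix_def vec_lambda_beta ring_map_add[OF hom] ring_map_mult[OF hom]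
        series_eval_coef[OF ring_map_id] id_apply
      by (simp add: coord_matrix_def entries_def vec_eq_iff series_eval_coord[OF ring_map_id, unfolded id_def] id_def)
    also have "\<dots> = c_matrix (coef \<iota>) (scalar_block (coef a) (coef c))"
      unfolding that(2) by (subst map_scalar_block)
        (simp_all add: ring_map_0[OF coef_ring_map] ring_map_uminus[OF coef_ring_map] del: fps_const_neg)
    finally show "entries (\<lambda>v. series_eval id z (b v)) = mat (coef (a + \<iota> * c))"
      unfolding map_matrix_entries[symmetric] b(2) c_matrix_scalar_block
      by (simp only: ring_map_add[OF coef_ring_map] ring_map_mult[OF coef_ring_map])
  qed
  \<comment> \<open>The two points have the same image under \<open>c\<close>.\<close>
  have "3 + \<iota> * \<iota> = 2 + \<iota> * 0" using \<iota> by (simp add: power2_eq_square)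
  then have "entries (\<lambda>v. series_eval id z1 (b v)) = entries (\<lambda>v. series_eval id z2 (b v))"
    by (simp only: comp(2)[OF z1(1,2)] comp(2)[OF z2(1,2)])
  then have "entries (\<lambda>v. series_eval id z1 (b v)) \<simeq>[null p ?E] entries (\<lambda>v. series_eval id z2 (b v))"
    by simp
  from point_eq_of_entries[OF ring_map_id order_refl comp(1)[OF z1(1,2)] comp(1)[OF z2(1,2)] this]
  have "point_hom p GL ?E id (\<lambda>v. series_eval id z1 (b v)) = point_hom p GL ?E id (\<lambda>v. series_eval id z2 (b v))"
    unfolding point_hom_eq_iff[OF ring_map_id comp(1)[OF z1(1,2)] comp(1)[OF z2(1,2)]] by blast
  then have z12: "series_eval id z1 (series_eval id b g) \<approx>[null p ?E] series_eval id z2 (series_eval id b g)" for g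
    using point_hom_class[OF ring_map_id comp(1)[OF z1(1,2)], of g] point_hom_class[OF ring_map_id comp(1)[OF z2(1,2)], of g]
    by (simp add: series_eval_series_eval[OF ring_map_id ring_map_id] series_class_eq_iff N.cong_sym)
  have "l1 * coef (2 ^ p + \<phi> \<iota> * 0 ^ p) \<approx>[null p ?E] series_eval id z1 val"
    by (rule N.cong_sym[OF val_z[OF z1(4)]])
  also have "\<dots> \<approx>[null p ?E] series_eval id z1 (series_eval id b (t (Entry i i)))"
    by (rule series_eval_cong[OF ring_map_id z1(1) val])
  also have "\<dots> \<approx>[null p ?E] series_eval id z2 (series_eval id b (t (Entry i i)))"
    by (rule z12)
  also have "\<dots> \<approx>[null p ?E] series_eval id z2 val"
    by (rule N.cong_sym[OF series_eval_cong[OF ring_map_id z2(1) val]])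
  also have "\<dots> \<approx>[null p ?E] l2 * coef (3 ^ p + \<phi> \<iota> * \<iota> ^ p)"
    by (rule val_z[OF z2(4)])
  finally have eq: "l1 * coef (2 ^ p + \<phi> \<iota> * 0 ^ p) \<approx>[null p ?E] l2 * coef (3 ^ p + \<phi> \<iota> * \<iota> ^ p)" .
  define T :: 'a where "T = 3 ^ p"
  define e where "e = \<phi> \<iota> * \<iota> ^ p"
  have p0: "p > 0" using prime by (rule prime_gt_0_nat)
  have ip: "(\<iota> ^ p) ^ 2 = - 1"
  proof -
    have "(\<iota> ^ p) ^ 2 = (\<iota> ^ 2) ^ p" by (simp add: power_mult[symmetric] mult.commute)
    then show ?thesis using odd by (simp add: \<iota>)
  qed
  \<comment> \<open>Which sign \<open>\<phi>(\<iota>) \<iota>\<^sup>p\<close> has depends on \<open>p\<close>; either one leads to a contradiction.\<close>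
  have "(\<phi> \<iota>) ^ 2 = - 1"
    using arg_cong[OF \<iota>, of \<phi>] by (simp add: ring_map_power[OF \<phi>] ring_map_uminus[OF \<phi>] ring_map_1[OF \<phi>])
  then have "e ^ 2 = 1" using ip by (simp add: e_def power_mult_distrib)
  then have e: "e = 1 \<or> e = - 1" by (simp add: power2_eq_1_iff)
  note cm = ring_map_mult[OF coef_ring_map] and cp = ring_map_power[OF coef_ring_map]
  have four: "((2 :: 'a) ^ p) ^ 2 = 4 ^ p"
  proof -
    have "((2 :: 'a) ^ p) ^ 2 = (2 ^ 2) ^ p" by (simp only: power_mult[symmetric] mult.commute)
    then show ?thesis by simp
  qed
  have l1: "l1 ^ 2 * coef (4 ^ p) \<approx>[null p ?E] coef (4 ^ p)"
    using z1(3) by (simp only: four zero_power[OF p0] power_zero_numeral add_0_right)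
  have "coef (4 ^ p * (T ^ 2 - 1)) = coef (4 ^ p) * (coef (T ^ 2 - 1) :: (('r + 'r) gl_var, 'a) series)"
    by (rule cm)
  also have "\<dots> \<approx>[null p ?E] (l1 ^ 2 * coef (4 ^ p)) * coef (T ^ 2 - 1)"
    by (intro N.cong_mult N.cong_refl N.cong_sym[OF l1])
  also have "\<dots> = (l1 * coef (2 ^ p + \<phi> \<iota> * 0 ^ p)) ^ 2 * coef (T ^ 2 - 1)"
    using p0 by (simp only: power_mult_distrib cp[symmetric] four zero_power mult_zero_right add_0_right)
  also have "\<dots> \<approx>[null p ?E] (l2 * coef (T + e)) ^ 2 * coef (T ^ 2 - 1)"
    using N.cong_mult[OF N.cong_power[OF eq] N.cong_refl] unfolding T_def e_def .
  also have "\<dots> = (l2 ^ 2 * coef (T ^ 2 - 1)) * coef ((T + e) ^ 2)"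
    by (simp only: power_mult_distrib cp mult_ac)
  also have "\<dots> \<approx>[null p ?E] coef (8 ^ p) * coef ((T + e) ^ 2)"
    using N.cong_mult[OF z2(3) N.cong_refl] unfolding ip T_def diff_conv_add_uminus .
  also have "\<dots> = coef (8 ^ p * (T + e) ^ 2)" by (rule cm[symmetric])
  finally have "coef (4 ^ p * (T ^ 2 - 1) - 8 ^ p * (T + e) ^ 2) \<in> null p ?E"
    unfolding cong_mod_def ring_map_diff[OF coef_ring_map] .
  then have zero: "4 ^ p * (T ^ 2 - 1) - 8 ^ p * (T + e) ^ 2 = 0" by (rule coef_null_empty)
  define s :: int where "s = (if e = 1 then 1 else - 1)"
  have se: "e = of_int s" and s: "s = 1 \<or> s = - 1" using e by (auto simp: s_def)
  have "of_int (4 ^ p * ((3 ^ p) ^ 2 - 1) - 8 ^ p * (3 ^ p + s) ^ 2) = (0 :: 'a)"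
    using zero by (simp add: T_def se)
  from of_int_eq_0[OF this] have "4 ^ p * ((3 ^ p) ^ 2 - 1) = 8 ^ p * (3 ^ p + s) ^ 2" by simp
  moreover have "(8 :: int) ^ p = 4 ^ p * 2 ^ p" by (simp flip: power_mult_distrib)
  ultimately have "(4 :: int) ^ p * ((3 ^ p) ^ 2 - 1) = 4 ^ p * (2 ^ p * (3 ^ p + s) ^ 2)" by (simp only: mult.assoc)
  then have int: "((3 :: int) ^ p) ^ 2 - 1 = 2 ^ p * (3 ^ p + s) ^ 2" by simp
  have p2: "p \<ge> 2" using prime by (rule prime_ge_2_nat)
  have "(3 :: int) ^ 2 \<le> 3 ^ p" and "(2 :: int) ^ 1 \<le> 2 ^ p"
    using p2 p0 by (intro power_increasing; simp)+
  then have T3: "(3 :: int) ^ p > 3" and U2: "(2 :: int) \<le> 2 ^ p" by simp_all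
  have "((3 :: int) ^ p) ^ 2 - 1 < 2 * (3 ^ p - 1) ^ 2"
  proof -
    have "0 < ((3 :: int) ^ p - 1) * (3 ^ p - 3)" using T3 by simp
    then show ?thesis by (simp add: power2_eq_square algebra_simps)
  qed
  also have "\<dots> \<le> 2 ^ p * (3 ^ p + s) ^ 2"
    using T3 U2 s by (intro mult_mono power_mono) auto
  finally show False using int by simp
qed

end

theorem theorem1p1:
  fixes p :: nat
    and \<phi> :: "'a::idom \<Rightarrow> 'a"
  assumes "prime p" and "odd p"
    and "complete_dvr_Fpbar p TYPE('a)"
    and "\<phi> \<in> ring_hom ring_of_type_algebra ring_of_type_algebra"
    and "\<forall>x. of_nat p dvd \<phi> x - x ^ p"
  shows
    "(\<forall>q :: 'a ^ 'n::finite ^ 'n.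
        invertible q \<and> (transpose q = q \<or> transpose q = - q) \<longrightarrow>
          (\<exists>!\<Phi>. symmetric_horizontal_lift p \<phi> GL q (phi_GL0 p \<phi>) \<Phi>)) \<and>
     (\<forall>q :: 'a ^ ('r::finite + 'r) ^ ('r + 'r).
        invertible q \<and> transpose q = q \<and> q ** q0 = q0 ** q \<longrightarrow>
          horizontal p GL GLc (phi_GL p \<phi> q) \<and>
          symmetric_horizontal_lift p \<phi> GLc q (phi_GLc0 p \<phi>) (phi_GLc p \<phi> q) \<and>
          (\<forall>\<Psi>. symmetric_horizontal_lift p \<phi> GLc q (phi_GLc0 p \<phi>) \<Psi> \<longrightarrow> \<Psi> = phi_GLc p \<phi> q)) \<and>
     (\<forall>\<iota> :: 'a. \<iota> ^ 2 = - 1 \<longrightarrow>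
        \<not> (\<exists>\<Theta> :: ('r gl_var, 'a) ffun \<Rightarrow> ('r gl_var, 'a) ffun.
             frobenius_lift p \<phi> GL \<Theta> \<and>
             c_horizontal p \<iota> \<Theta> (phi_GLc p \<phi> (mat 1 :: 'a ^ ('r + 'r) ^ ('r + 'r)))))"
proof -
  interpret R: complete_ring p "TYPE('a)" using assms by unfold_locales
  have \<phi>: "ring_map \<phi>"
    using assms(4) by (auto simp: ring_hom_def ring_map_def)
  have "coprime 2 p" using assms(2) by simp
  then obtain v :: 'a where "v * of_nat 2 = 1" by (rule R.of_nat_unit)
  then have half: "\<exists>c::'a. c * 2 = 1" by auto
  interpret complete_frobenius_setting p \<phi>
    using assms \<phi> half by unfold_locales auto
  show ?thesis
  proof (intro conjI allI impI)
    fix q :: "'a ^ 'n ^ 'n"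
    assume "invertible q \<and> (transpose q = q \<or> transpose q = - q)"
    then have q: "invertible q" "transpose q = q \<or> transpose q = - q" by auto
    obtain y where "is_point p GL GL \<phi> y" "lifts_power p GL y"
      "solves_form GL q (entries y)"
      "\<forall>\<Phi>. symmetric_horizontal_lift p \<phi> GL q (phi_GL0 p \<phi>) \<Phi> \<longleftrightarrow> \<Phi> = point_hom p GL GL \<phi> y"
      "phi_GL p \<phi> q = point_hom p GL GL \<phi> y"
      by (rule phi_GL_point[OF q])
    then show "\<exists>!\<Phi>. symmetric_horizontal_lift p \<phi> GL q (phi_GL0 p \<phi>) \<Phi>" by simp
  next
    fix q :: "'a ^ ('r + 'r) ^ ('r + 'r)"
    assume "invertible q \<and> transpose q = q \<and> q ** q0 = q0 ** q"
    then have q: "invertible q" "transpose q = q" "q ** q0 = q0 ** q" by auto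
    obtain y where "is_point p GLc GLc \<phi> y" "lifts_power p GLc y"
      "solves_form GLc q (entries y)" "phi_GLc p \<phi> q = point_hom p GLc GLc \<phi> y"
      and h: "horizontal p GL GLc (phi_GL p \<phi> q)" and
      iff: "\<forall>\<Psi>. symmetric_horizontal_lift p \<phi> GLc q (phi_GLc0 p \<phi>) \<Psi> \<longleftrightarrow> \<Psi> = phi_GLc p \<phi> q"
      by (rule phi_GLc_point[OF q])
    show "horizontal p GL GLc (phi_GL p \<phi> q)" by (rule h)
    show "symmetric_horizontal_lift p \<phi> GLc q (phi_GLc0 p \<phi>) (phi_GLc p \<phi> q)" using iff by simp
    show "\<Psi> = phi_GLc p \<phi> q" if "symmetric_horizontal_lift p \<phi> GLc q (phi_GLc0 p \<phi>) \<Psi>" for \<Psi>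
      using that iff by simp
  next
    fix \<iota> :: 'a
    assume "\<iota> ^ 2 = - 1"
    then show "\<not> (\<exists>\<Theta> :: ('r gl_var, 'a) ffun \<Rightarrow> ('r gl_var, 'a) ffun. frobenius_lift p \<phi> GL \<Theta> \<and>
        c_horizontal p \<iota> \<Theta> (phi_GLc p \<phi> (mat 1 :: 'a ^ ('r + 'r) ^ ('r + 'r))))"
      using no_c_horizontal_lift by blast
  qed
qed

end
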